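(* Let $\lambda\neq 1$ be an eigenvalue of $U_\mu'$ and let $V\subset\mathbb{C}$ be an open set such that $V\cap\sigma(U_\mu')=\{\lambda\}$. Then: (1) $U_{n,\mu}'$ converges compactly to $U_\mu'$ almost surely. (2) The eigenvalues in $\sigma(U_{n,\mu}')\cap V$ converge to $\lambda$ almost surely. (3) If $\mathrm{Pr}_n$ is the spectral projection of $\sigma(U_{n,\mu}')\cap V$ (for the operator $U_{n,\mu}'$) and $\mathrm{Pr}$ is the spectral projection of $\sigma(U_\mu')\cap V$ (for the operator $U_\mu'$), then $\mathrm{Pr}_n$ converges to $\mathrm{Pr}$ pointwise almost surely. This convergence is in the uniform topology of functions, i.e. in the norm $\|\cdot\|_{B(\mathcal{X})}$.
   Context: Let $(\Omega,\mathcal{F},\mathbb{P})$ be a probability space, $(\mathcal{X},d)$ a compact metric space with a Borel probability measure $\mu$, and $k:\mathcal{X}\times\mathcal{X}\to[0,\infty)$ a symmetric measurable kernel. Let $X_1,X_2,\dots:\Omega\to\mathcal{X}$ be independent random variables with law $\mu$ and $\mu_n=\frac1n\sum_{i=1}^n\delta_{X_i}$. $B_\delta(x)$ denotes the ball of radius $\delta$ around $x$. $B(\mathcal{X})$ is the Banach space of bounded measurable functions $f:\mathcal{X}\to\mathbb{R}$ with $\|f\|_{B(\mathcal{X})}=\sup_{x}|f(x)|$; $\sigma(S)\subset\mathbb{C}$ is the spectrum of a bounded operator $S$ (of its complexification). Put $d_\mu(x)=\int k(x,y)\,d\mu(y)$, $d_{n,\mu}(x)=\int k(x,y)\,d\mu_n(y)$,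 and, for $\delta>0$, $k_\delta(x;z)=\sup_{y\in B_\delta(x)}|k(x,z)-k(y,z)|$. Standing assumptions: there are constants $0<a\le 1\le M<\infty$ and a continuous increasing function $\omega:[0,+\infty]\to\mathbb{R}$ with $\lim_{\delta\to0}\omega(\delta)=0$ such that $\sup_{x,y}k(x,y)<M$; $a<\inf_x d_\mu(x)$; and $\int k_\delta(x;z)\,d\mu(z)\le\omega(\delta)$ for all $x\in\mathcal{X}$, $\delta>0$. Define $h_\mu(x,y)=\frac12k(x,y)\left(\frac1{d_\mu(x)}+\frac1{d_\mu(y)}\right)$, $h_{n,\mu}(x,y)=\frac12k(x,y)\left(\frac1{d_{n,\mu}(x)}+\frac1{d_{n,\mu}(y)}\right)$, and operators on $B(\mathcal{X})$: $T_\mu f(x)=\int h_\mu(x,y)f(y)\,d\mu(y)$, $\hat T_{n,\mu}f(x)=\int h_{n,\mu}(x,y)f(y)\,d\mu_n(y)$, $U_\mu'=I-T_\mu$, $U_{n,\mu}'=I-\hat T_{n,\mu}$. (Almost surely $\inf_x d_{n,\mu}(x)>0$ for all large $n$, so $\hat T_{n,\mu}$ is defined for all large $n$.) For bounded operators $S_n,S$ on a Banach space $E$: $S_n$ converges pointwise to $S$ if $\|S_nx-Sx\|\to0$ for all $x\in E$; $S_n$ converges compactly to $S$ if for every sequence $x_n\in E$ with $\|x_n\|\le1$, the sequence $(S-S_n)x_n$ has a convergent subsequence. Spectral projection: for a bounded operator $S$ and $W\subset\mathbb{C}$, if $\gamma$ is a (positively oriented) simple closed curve not meeting $\sigma(S)$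 whose interior $\Gamma_{\mathrm{int}}$ satisfies $\Gamma_{\mathrm{int}}\cap\sigma(S)=W\cap\sigma(S)$, the spectral projection of $\sigma(S)\cap W$ is $-\frac1{2\pi i}\int_\gamma(S-zI)^{-1}dz$.
   Formalization: It is additionally assumed that the boundary of V does not meet σ(U_μ'), since otherwise (2) and (3) can fail; in (3), pointwise almost sure convergence means that for each fixed function Pr_n v → Pr v almost surely, the exceptional null set depending on v. *)

theory Defs
  imports "HOL-Probability.Probability" "HOL-Complex_Analysis.Complex_Analysis"
begin

typedef (overloaded) 'a bmfun =
  "{f :: 'a::topological_space \<Rightarrow> real. f \<in> borel_measurable borel \<and> bounded (range f)}"
  morphisms apply_bmfun Bmfun
  by (rule exI[of _ "\<lambda>_. 0"]) auto

setup_lifting type_definition_bmfun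

lemma measurable_apply_bmfun [measurable]: "apply_bmfun f \<in> borel_measurable borel"
  using apply_bmfun[of f] by simp

lemma bounded_apply_bmfun: "bounded (range (apply_bmfun f))"
  using apply_bmfun[of f] by simp

lemma bmfun_eqI: "(\<And>x. apply_bmfun f x = apply_bmfun g x) \<Longrightarrow> f = g"
  by transfer auto

lemma apply_Bmfun:
  "f \<in> borel_measurable borel \<Longrightarrow> bounded (range f) \<Longrightarrow> apply_bmfun (Bmfun f) = f"
  by (simp add: Bmfun_inverse)

instantiation bmfun :: (topological_space) real_vector
begin

lift_definition zero_bmfun :: "'a bmfun" is "\<lambda>_. 0" by auto

lift_definition plus_bmfun :: "'a bmfun \<Rightarrow> 'a bmfun \<Rightarrow> 'a bmfun" is "\<lambda>f g x. f x + g x"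
  by (auto intro: bounded_plus_comp)

lift_definition minus_bmfun :: "'a bmfun \<Rightarrow> 'a bmfun \<Rightarrow> 'a bmfun" is "\<lambda>f g x. f x - g x"
  by (auto intro: bounded_minus_comp)

lift_definition uminus_bmfun :: "'a bmfun \<Rightarrow> 'a bmfun" is "\<lambda>f x. - f x"
  by auto

lift_definition scaleR_bmfun :: "real \<Rightarrow> 'a bmfun \<Rightarrow> 'a bmfun" is "\<lambda>r f x. r *\<^sub>R f x"
  by (auto intro: bounded_scaleR_comp simp del: real_scaleR_def)

lemmas bmfun_rep_eqs = zero_bmfun.rep_eq plus_bmfun.rep_eq minus_bmfun.rep_eq
  uminus_bmfun.rep_eq scaleR_bmfun.rep_eq

instance
proof
  fix a b :: real and f g h :: "'a bmfun"
  show "f + g + h = f + (g + h)" "f + g = g + f" "0 + f = f" "- f + f = 0" "f - g = f + - g"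
    "a *\<^sub>R (f + g) = a *\<^sub>R f + a *\<^sub>R g" "(a + b) *\<^sub>R f = a *\<^sub>R f + b *\<^sub>R f"
    "a *\<^sub>R b *\<^sub>R f = (a * b) *\<^sub>R f" "1 *\<^sub>R f = f"
    by (rule bmfun_eqI; simp add: bmfun_rep_eqs algebra_simps)+
qed

end

instantiation bmfun :: (topological_space) real_normed_vector
begin

definition norm_bmfun :: "'a bmfun \<Rightarrow> real" where
  "norm_bmfun f = (SUP x. \<bar>apply_bmfun f x\<bar>)"

definition dist_bmfun :: "'a bmfun \<Rightarrow> 'a bmfun \<Rightarrow> real" where
  "dist_bmfun f g = norm (f - g)"

definition sgn_bmfun :: "'a bmfun \<Rightarrow> 'a bmfun" where
  "sgn_bmfun f = inverse (norm f) *\<^sub>R f"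

definition uniformity_bmfun :: "('a bmfun \<times> 'a bmfun) filter" where
  "uniformity_bmfun = (INF e\<in>{0 <..}. principal {(x, y). dist x y < e})"

definition open_bmfun :: "'a bmfun set \<Rightarrow> bool" where
  "open_bmfun S = (\<forall>x\<in>S. \<forall>\<^sub>F (x', y) in uniformity. x' = x \<longrightarrow> y \<in> S)"

lemma abs_apply_bmfun_le_norm: "\<bar>apply_bmfun f x\<bar> \<le> norm f"
proof -
  obtain B where "\<And>y. \<bar>apply_bmfun f y\<bar> \<le> B"
    using bounded_apply_bmfun[of f] by (auto simp: bounded_iff)
  then show ?thesis
    unfolding norm_bmfun_def by (intro cSUP_upper bdd_aboveI2[where M = B]) auto
qed

lemma norm_bmfun_le: "(\<And>x. \<bar>apply_bmfun f x\<bar> \<le> B) \<Longrightarrow> norm f \<le> B"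
  unfolding norm_bmfun_def by (rule cSUP_least) auto

instance
proof
  fix a :: real and f g :: "'a bmfun"
  show "dist f g = norm (f - g)" by (rule dist_bmfun_def)
  show "sgn f = f /\<^sub>R norm f" by (rule sgn_bmfun_def)
  show "(uniformity :: ('a bmfun \<times> 'a bmfun) filter) =
      (INF e\<in>{0 <..}. principal {(x, y). dist x y < e})"
    by (rule uniformity_bmfun_def)
  show "open S = (\<forall>x\<in>S. \<forall>\<^sub>F (x', y) in uniformity. x' = x \<longrightarrow> y \<in> S)" for S :: "'a bmfun set"
    by (rule open_bmfun_def)
  show "norm f = 0 \<longleftrightarrow> f = 0"
  proof
    assume "norm f = 0"
    then have "apply_bmfun f x = 0" for x
      using abs_apply_bmfun_le_norm[of f x] by simp
    then show "f = 0" by (intro bmfun_eqI) (simp add: bmfun_rep_eqs)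
  next
    assume "f = 0"
    then show "norm f = 0" by (simp add: norm_bmfun_def bmfun_rep_eqs)
  qed
  show "norm (f + g) \<le> norm f + norm g"
  proof (rule norm_bmfun_le)
    fix x
    show "\<bar>apply_bmfun (f + g) x\<bar> \<le> norm f + norm g"
      using abs_apply_bmfun_le_norm[of f x] abs_apply_bmfun_le_norm[of g x]
      by (simp add: bmfun_rep_eqs)
  qed
  have scale_le: "norm (c *\<^sub>R u) \<le> \<bar>c\<bar> * norm u" for c and u :: "'a bmfun"
    by (rule norm_bmfun_le)
      (simp add: bmfun_rep_eqs abs_mult mult_left_mono abs_apply_bmfun_le_norm)
  show "norm (a *\<^sub>R f) = \<bar>a\<bar> * norm f"
  proof (cases "a = 0")
    case True
    then show ?thesis by (simp add: norm_bmfun_def bmfun_rep_eqs)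
  next
    case False
    have "f = inverse a *\<^sub>R (a *\<^sub>R f)"
      using False by (intro bmfun_eqI) (simp add: bmfun_rep_eqs)
    then have "norm f \<le> \<bar>inverse a\<bar> * norm (a *\<^sub>R f)"
      by (metis scale_le)
    then have "\<bar>a\<bar> * norm f \<le> norm (a *\<^sub>R f)"
      using False by (simp add: field_simps)
    with scale_le[of a f] show ?thesis by simp
  qed
qed

end

instance bmfun :: (topological_space) banach
proof
  fix F :: "nat \<Rightarrow> 'a bmfun"
  assume C: "Cauchy F"
  have ptC: "Cauchy (\<lambda>n. apply_bmfun (F n) x)" for x
  proof (rule metric_CauchyI)
    fix e :: real assume "e > 0"
    then obtain N where N: "\<And>m n. m \<ge> N \<Longrightarrow> n \<ge> N \<Longrightarrow> norm (F m - F n) < e"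
      using C by (meson CauchyD)
    show "\<exists>N. \<forall>m\<ge>N. \<forall>n\<ge>N. dist (apply_bmfun (F m) x) (apply_bmfun (F n) x) < e"
    proof (intro exI allI impI)
      fix m n assume "m \<ge> N" "n \<ge> N"
      then show "dist (apply_bmfun (F m) x) (apply_bmfun (F n) x) < e"
        using abs_apply_bmfun_le_norm[of "F m - F n" x] N[of m n]
        by (simp add: dist_real_def bmfun_rep_eqs)
    qed
  qed
  define g where "g x = lim (\<lambda>n. apply_bmfun (F n) x)" for x
  have lim: "(\<lambda>n. apply_bmfun (F n) x) \<longlonglongrightarrow> g x" for x
    unfolding g_def using ptC[of x] by (simp add: Cauchy_convergent_iff convergent_LIMSEQ_iff)
  have unif: "\<bar>apply_bmfun (F n) x - g x\<bar> \<le> e"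
    if N: "\<And>m n. m \<ge> N \<Longrightarrow> n \<ge> N \<Longrightarrow> norm (F m - F n) < e" and n: "n \<ge> N" for e N n x
  proof (rule LIMSEQ_le_const2)
    show "(\<lambda>m. \<bar>apply_bmfun (F n) x - apply_bmfun (F m) x\<bar>) \<longlonglongrightarrow> \<bar>apply_bmfun (F n) x - g x\<bar>"
      by (intro tendsto_intros lim)
    show "\<exists>N. \<forall>m\<ge>N. \<bar>apply_bmfun (F n) x - apply_bmfun (F m) x\<bar> \<le> e"
    proof (intro exI allI impI)
      fix m assume "m \<ge> N"
      then show "\<bar>apply_bmfun (F n) x - apply_bmfun (F m) x\<bar> \<le> e"
        using abs_apply_bmfun_le_norm[of "F n - F m" x] N[of n m] n
        by (simp add: bmfun_rep_eqs)
    qed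
  qed
  have gm: "g \<in> borel_measurable borel"
    by (rule borel_measurable_LIMSEQ_real[OF lim]) auto
  obtain N1 where N1: "\<And>m n. m \<ge> N1 \<Longrightarrow> n \<ge> N1 \<Longrightarrow> norm (F m - F n) < 1"
    using C by (meson CauchyD zero_less_one)
  have "\<bar>g x\<bar> \<le> norm (F N1) + 1" for x
    using N1 unif[of N1 1 N1 x] abs_apply_bmfun_le_norm[of "F N1" x] by fastforce
  then have gb: "bounded (range g)"
    by (auto simp: bounded_iff)
  have "F \<longlonglongrightarrow> Bmfun g"
  proof (rule metric_LIMSEQ_I)
    fix e :: real assume e: "e > 0"
    then obtain N where N: "\<And>m n. m \<ge> N \<Longrightarrow> n \<ge> N \<Longrightarrow> norm (F m - F n) < e / 2"
      using C by (meson CauchyD half_gt_zero)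
    show "\<exists>N. \<forall>n\<ge>N. dist (F n) (Bmfun g) < e"
    proof (intro exI allI impI)
      fix n assume "n \<ge> N"
      then have "norm (F n - Bmfun g) \<le> e / 2"
        using unif[OF N] by (intro norm_bmfun_le) (simp add: bmfun_rep_eqs apply_Bmfun gm gb)
      then show "dist (F n) (Bmfun g) < e"
        using e by (simp add: dist_norm)
    qed
  qed
  then show "convergent F" by (auto simp: convergent_def)
qed

text \<open>The complexification of a real Banach space \<open>'e\<close> is \<open>'e \<times> 'e\<close>, the pair \<open>(x, y)\<close>
  standing for \<open>x + i y\<close>.  The product norm is not homogeneous for complex scalars, but it is
  equivalent to the usual complexification norms, and only the topology matters below.\<close>

lift_definition complexify ::
  "('e::real_normed_vector \<Rightarrow>\<^sub>L 'e) \<Rightarrow> ('e \<times> 'e) \<Rightarrow>\<^sub>L ('e \<times> 'e)"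
  is "\<lambda>S v. (S (fst v), S (snd v))"
  by (intro bounded_linear_Pair bounded_linear_compose[OF _ bounded_linear_fst]
      bounded_linear_compose[OF _ bounded_linear_snd])

lift_definition cscale :: "complex \<Rightarrow> ('e::real_normed_vector \<times> 'e) \<Rightarrow>\<^sub>L ('e \<times> 'e)"
  is "\<lambda>z v. (Re z *\<^sub>R fst v - Im z *\<^sub>R snd v, Im z *\<^sub>R fst v + Re z *\<^sub>R snd v)"
  by (intro bounded_linear_Pair bounded_linear_sub bounded_linear_add
      bounded_linear_compose[OF bounded_linear_scaleR_right bounded_linear_fst]
      bounded_linear_compose[OF bounded_linear_scaleR_right bounded_linear_snd])

definition is_resolvent ::
  "('e::real_normed_vector \<Rightarrow>\<^sub>L 'e) \<Rightarrow> complex \<Rightarrow> ('e \<times> 'e) \<Rightarrow>\<^sub>L ('e \<times> 'e) \<Rightarrow> bool" where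
  "is_resolvent S z R \<longleftrightarrow>
     R o\<^sub>L (complexify S - cscale z) = id_blinfun \<and> (complexify S - cscale z) o\<^sub>L R = id_blinfun"

definition op_spectrum :: "('e::real_normed_vector \<Rightarrow>\<^sub>L 'e) \<Rightarrow> complex set" where
  "op_spectrum S = {z. \<not> (\<exists>R. is_resolvent S z R)}"

definition resolvent ::
  "('e::real_normed_vector \<Rightarrow>\<^sub>L 'e) \<Rightarrow> complex \<Rightarrow> ('e \<times> 'e) \<Rightarrow>\<^sub>L ('e \<times> 'e)" where
  "resolvent S z = (THE R. is_resolvent S z R)"

definition op_eigenvalue :: "('e::real_normed_vector \<Rightarrow>\<^sub>L 'e) \<Rightarrow> complex \<Rightarrow> bool" where
  "op_eigenvalue S z \<longleftrightarrow>
     (\<exists>v. v \<noteq> 0 \<and> blinfun_apply (complexify S) v = blinfun_apply (cscale z) v)"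

text \<open>Operator-valued version of \<^const>\<open>contour_integral\<close>, with the same parametrised integrand.\<close>

definition op_contour_integral ::
  "(real \<Rightarrow> complex) \<Rightarrow> (complex \<Rightarrow> ('e::real_normed_vector \<times> 'e) \<Rightarrow>\<^sub>L ('e \<times> 'e))
     \<Rightarrow> ('e \<times> 'e) \<Rightarrow>\<^sub>L ('e \<times> 'e)" where
  "op_contour_integral g F =
     integral {0..1} (\<lambda>t. cscale (vector_derivative g (at t within {0..1})) o\<^sub>L F (g t))"

definition pos_simple_closed_curve :: "(real \<Rightarrow> complex) \<Rightarrow> bool" where
  "pos_simple_closed_curve g \<longleftrightarrow>
     valid_path g \<and> simple_path g \<and> pathfinish g = pathstart g \<and>
     (\<forall>z\<in>inside (path_image g). winding_number g z = 1)"

definition is_spectral_projection ::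
  "('e::real_normed_vector \<Rightarrow>\<^sub>L 'e) \<Rightarrow> complex set \<Rightarrow> ('e \<times> 'e) \<Rightarrow>\<^sub>L ('e \<times> 'e) \<Rightarrow> bool" where
  "is_spectral_projection S W P \<longleftrightarrow>
     (\<exists>g. pos_simple_closed_curve g \<and> path_image g \<inter> op_spectrum S = {} \<and>
          inside (path_image g) \<inter> op_spectrum S = W \<inter> op_spectrum S \<and>
          P = cscale (- 1 / (2 * complex_of_real pi * \<i>)) o\<^sub>L op_contour_integral g (resolvent S))"

text \<open>The contour integral does not depend on the admissible curve, hence the definite
  description.\<close>

definition spectral_projection ::
  "('e::real_normed_vector \<Rightarrow>\<^sub>L 'e) \<Rightarrow> complex set \<Rightarrow> ('e \<times> 'e) \<Rightarrow>\<^sub>L ('e \<times> 'e)" where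
  "spectral_projection S W = (THE P. is_spectral_projection S W P)"

definition converges_compactly ::
  "(nat \<Rightarrow> 'e::real_normed_vector \<Rightarrow>\<^sub>L 'e) \<Rightarrow> ('e \<Rightarrow>\<^sub>L 'e) \<Rightarrow> bool" where
  "converges_compactly Sn S \<longleftrightarrow>
     (\<forall>x. (\<forall>n. norm (x n) \<le> 1) \<longrightarrow>
        (\<exists>r l. strict_mono (r :: nat \<Rightarrow> nat) \<and>
               (\<lambda>j. blinfun_apply (S - Sn (r j)) (x (r j))) \<longlonglongrightarrow> l))"

definition degree_fun :: "('a \<Rightarrow> 'a \<Rightarrow> real) \<Rightarrow> 'a measure \<Rightarrow> 'a \<Rightarrow> real" where
  "degree_fun k \<nu> x = (\<integral>y. k x y \<partial>\<nu>)"

definition norm_kernel :: "('a \<Rightarrow> 'a \<Rightarrow> real) \<Rightarrow> 'a measure \<Rightarrow> 'a \<Rightarrow> 'a \<Rightarrow> real" where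
  "norm_kernel k \<nu> x y = 1 / 2 * k x y * (1 / degree_fun k \<nu> x + 1 / degree_fun k \<nu> y)"

text \<open>Meaningful if \<open>h\<close> is bounded and measurable and \<open>\<nu>\<close> is a finite Borel measure; see
  \<open>apply_kernel_op\<close> below.\<close>

definition kernel_op ::
  "('a::topological_space \<Rightarrow> 'a \<Rightarrow> real) \<Rightarrow> 'a measure \<Rightarrow> 'a bmfun \<Rightarrow>\<^sub>L 'a bmfun" where
  "kernel_op h \<nu> = Blinfun (\<lambda>f. Bmfun (\<lambda>x. \<integral>y. h x y * apply_bmfun f y \<partial>\<nu>))"

definition U_op ::
  "('a::topological_space \<Rightarrow> 'a \<Rightarrow> real) \<Rightarrow> 'a measure \<Rightarrow> 'a bmfun \<Rightarrow>\<^sub>L 'a bmfun" where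
  "U_op k \<nu> = id_blinfun - kernel_op (norm_kernel k \<nu>) \<nu>"

text \<open>The measure \<open>1/n \<Sum>i=1..n. \<delta>\<^bsub>xs i\<^esub>\<close>.\<close>

definition empirical_measure :: "(nat \<Rightarrow> 'a::topological_space) \<Rightarrow> nat \<Rightarrow> 'a measure" where
  "empirical_measure xs n = distr (uniform_count_measure {1..n}) borel xs"

text \<open>For Borel measurable \<open>k\<close> on a compact space, a supremum over uncountably many \<open>y\<close> need not be
  Borel in \<open>z\<close>, but its superlevel sets are analytic and hence measurable for the completion of
  every finite Borel measure.  Integrals of this function are therefore taken with respect to
  completions.\<close>

definition kernel_osc :: "('a::metric_space \<Rightarrow> 'a \<Rightarrow> real) \<Rightarrow> real \<Rightarrow> 'a \<Rightarrow> 'a \<Rightarrow> real" where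
  "kernel_osc k \<delta> x z = (SUP y\<in>ball x \<delta>. \<bar>k x z - k y z\<bar>)"

lemma integral_empirical_measure:
  fixes f :: "'a::topological_space \<Rightarrow> real"
  assumes "f \<in> borel_measurable borel"
  shows "(\<integral>y. f y \<partial>empirical_measure xs n) = (\<Sum>i=1..n. f (xs i)) / real n"
proof -
  have "xs \<in> uniform_count_measure {1..n} \<rightarrow>\<^sub>M borel"
    by (simp add: measurable_def space_uniform_count_measure sets_uniform_count_measure)
  then show ?thesis
    using assms unfolding empirical_measure_def
    by (simp add: integral_distr integral_uniform_count_measure)
qed

lemma apply_kernel_op:
  fixes h :: "'a::topological_space \<Rightarrow> 'a \<Rightarrow> real"
  assumes "finite_measure \<nu>" and sets: "sets \<nu> = sets borel"
    and meas: "(\<lambda>(x, y). h x y) \<in> borel_measurable (borel \<Otimes>\<^sub>M borel)"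
    and bound: "\<And>x y. \<bar>h x y\<bar> \<le> B"
  shows "apply_bmfun (blinfun_apply (kernel_op h \<nu>) f) x = (\<integral>y. h x y * apply_bmfun f y \<partial>\<nu>)"
proof -
  interpret finite_measure \<nu> by fact
  have meas': "(\<lambda>(x, y). h x y) \<in> borel_measurable (borel \<Otimes>\<^sub>M \<nu>)"
    using meas by (simp cong: measurable_cong_sets sets_pair_measure_cong add: sets)
  have B: "B \<ge> 0" using bound[of undefined undefined] by linarith
  have ap: "apply_bmfun f \<in> borel_measurable \<nu>" for f :: "'a bmfun"
    using measurable_apply_bmfun[of f] by (simp cong: measurable_cong_sets add: sets)
  have hx: "h x \<in> borel_measurable \<nu>" for x
    using measurable_Pair2[OF meas', of x] by simp
  have ptw: "\<bar>h x y * apply_bmfun f y\<bar> \<le> B * norm f" for x y and f :: "'a bmfun"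
    unfolding abs_mult by (intro mult_mono bound abs_apply_bmfun_le_norm) (use B in auto)
  have int: "integrable \<nu> (\<lambda>y. h x y * apply_bmfun f y)" for x and f :: "'a bmfun"
    by (rule integrable_const_bound[where B = "B * norm f"])
      (use ptw hx ap in \<open>auto intro!: borel_measurable_times\<close>)
  have le: "\<bar>\<integral>y. h x y * apply_bmfun f y \<partial>\<nu>\<bar> \<le> norm f * (B * measure \<nu> (space \<nu>))"
    for x and f :: "'a bmfun"
  proof -
    have "\<bar>\<integral>y. h x y * apply_bmfun f y \<partial>\<nu>\<bar> \<le> (\<integral>y. \<bar>h x y * apply_bmfun f y\<bar> \<partial>\<nu>)"
      by (rule integral_abs_bound)
    also have "\<dots> \<le> (\<integral>y. B * norm f \<partial>\<nu>)"
      by (rule integral_mono) (use int ptw in auto)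
    finally show ?thesis by (simp add: mult_ac)
  qed
  have im: "(\<lambda>x. \<integral>y. h x y * apply_bmfun f y \<partial>\<nu>) \<in> borel_measurable borel" for f :: "'a bmfun"
  proof (rule borel_measurable_lebesgue_integral)
    show "(\<lambda>(x, y). h x y * apply_bmfun f y) \<in> borel_measurable (borel \<Otimes>\<^sub>M \<nu>)"
      using borel_measurable_times[OF meas' measurable_compose[OF measurable_snd ap[of f]]]
      by (simp add: case_prod_beta')
  qed
  have ib: "bounded (range (\<lambda>x. \<integral>y. h x y * apply_bmfun f y \<partial>\<nu>))" for f :: "'a bmfun"
    unfolding bounded_iff using le[of _ f] by (auto simp del: norm_conv_dist)
  note ap_op = apply_Bmfun[OF im ib]
  have "bounded_linear (\<lambda>f. Bmfun (\<lambda>x. \<integral>y. h x y * apply_bmfun f y \<partial>\<nu>))"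
  proof (rule bounded_linear_intro)
    show "norm (Bmfun (\<lambda>x. \<integral>y. h x y * apply_bmfun f y \<partial>\<nu>)) \<le> norm f * (B * measure \<nu> (space \<nu>))"
      for f :: "'a bmfun"
      using le by (intro norm_bmfun_le) (simp add: ap_op)
    show "Bmfun (\<lambda>x. \<integral>y. h x y * apply_bmfun (f + g) y \<partial>\<nu>) =
        Bmfun (\<lambda>x. \<integral>y. h x y * apply_bmfun f y \<partial>\<nu>) + Bmfun (\<lambda>x. \<integral>y. h x y * apply_bmfun g y \<partial>\<nu>)"
      for f g :: "'a bmfun"
    proof (rule bmfun_eqI)
      fix x
      have "(\<integral>y. h x y * apply_bmfun (f + g) y \<partial>\<nu>) =
          (\<integral>y. h x y * apply_bmfun f y \<partial>\<nu>) + (\<integral>y. h x y * apply_bmfun g y \<partial>\<nu>)"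
        by (simp add: plus_bmfun.rep_eq distrib_left int)
      then show "apply_bmfun (Bmfun (\<lambda>x. \<integral>y. h x y * apply_bmfun (f + g) y \<partial>\<nu>)) x =
          apply_bmfun (Bmfun (\<lambda>x. \<integral>y. h x y * apply_bmfun f y \<partial>\<nu>) +
            Bmfun (\<lambda>x. \<integral>y. h x y * apply_bmfun g y \<partial>\<nu>)) x"
        unfolding ap_op plus_bmfun.rep_eq[of "Bmfun _" "Bmfun _"] by simp
    qed
    show "Bmfun (\<lambda>x. \<integral>y. h x y * apply_bmfun (r *\<^sub>R f) y \<partial>\<nu>) =
        r *\<^sub>R Bmfun (\<lambda>x. \<integral>y. h x y * apply_bmfun f y \<partial>\<nu>)"
      for r and f :: "'a bmfun"
    proof (rule bmfun_eqI)
      fix x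
      have "(\<integral>y. h x y * apply_bmfun (r *\<^sub>R f) y \<partial>\<nu>) = r * (\<integral>y. h x y * apply_bmfun f y \<partial>\<nu>)"
        by (simp add: scaleR_bmfun.rep_eq mult.left_commute[of _ r])
      then show "apply_bmfun (Bmfun (\<lambda>x. \<integral>y. h x y * apply_bmfun (r *\<^sub>R f) y \<partial>\<nu>)) x =
          apply_bmfun (r *\<^sub>R Bmfun (\<lambda>x. \<integral>y. h x y * apply_bmfun f y \<partial>\<nu>)) x"
        unfolding ap_op scaleR_bmfun.rep_eq[of r "Bmfun _"] by simp
    qed
  qed
  then show ?thesis
    by (simp add: kernel_op_def bounded_linear_Blinfun_apply ap_op)
qed

end

theory Submission
  imports Defs "Jordan_Normal_Form.Char_Poly"
begin

text \<open>
  Write \<open>T\<close> for the kernel operator of \<open>\<mu>\<close>, \<open>T\<^sub>n\<close> for that of the empirical measure and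
  \<open>\<zeta> = 1 - z\<close>, so that \<open>U - z = \<zeta> - T\<close> and \<open>U\<^sub>n - z = \<zeta> - T\<^sub>n\<close>.  On bounded measurable functions
  \<open>T\<^sub>n\<close> need not converge to \<open>T\<close> in norm, and for a nonatomic \<open>\<mu>\<close> there is not even one
  event of probability one on which \<open>T\<^sub>n f \<longlonglongrightarrow> T f\<close> for all \<open>f\<close>.  What does hold almost surely is
  \<open>\<parallel>(T - T\<^sub>n) T\<^sub>n\<parallel> \<longlonglongrightarrow> 0\<close> and \<open>\<parallel>(T - T\<^sub>n) T\<parallel> \<longlonglongrightarrow> 0\<close>, and the whole proof rests on these two limits.

  \<^emph>\<open>Probability.\<close>  Cover the compact space by finitely many balls of radius \<open>\<delta>\<close> and let \<open>p\<close> be a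
  Borel map sending a point to the centre of a ball around it.  The strong law of large numbers,
  used at the centres only, bounds the empirical mean of the oscillation \<open>k\<^sub>\<delta>\<close>; this makes
  \<open>f \<mapsto> T f\<close> and, for large \<open>n\<close>, \<open>f \<mapsto> T\<^sub>n f\<close> map the unit ball to functions that nearly factor
  through \<open>p\<close>, uniformly in \<open>n\<close> (\<open>K_oscillation\<close>, \<open>osc_empirical\<close>).  A function that nearly factors
  through \<open>p\<close> is nearly a combination of the indicators of the cells \<open>p -` {c}\<close>.  Over all scales there
  are only countably many cells, so almost surely \<open>T\<^sub>n\<close> converges to \<open>T\<close> on every one of them
  (\<open>Tn_converges\<close>).  Together these facts give the two limits (\<open>compose_lim\<close>) and, by a diagonal
  argument over the centres, the compact convergence (\<open>compact_convergence\<close>).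

  \<^emph>\<open>Resolvents.\<close>  If \<open>R\<close> inverts \<open>\<zeta> - T\<close>, then \<open>(1 + R T\<^sub>n) (\<zeta> - T\<^sub>n) = \<zeta> + R (T - T\<^sub>n) T\<^sub>n\<close>, so for
  \<open>\<zeta> \<noteq> 0\<close> and large \<open>n\<close> the operator \<open>\<zeta> - T\<^sub>n\<close> has a left inverse.  As \<open>T\<^sub>n\<close> has finite rank, an
  injective \<open>\<zeta> - T\<^sub>n\<close> is invertible (\<open>finite_rank_spectrum\<close>).  If \<open>\<zeta> = 0\<close> is a regular point, \<open>T\<close> is
  invertible and \<open>\<parallel>T - T\<^sub>n\<parallel> \<longlonglongrightarrow> 0\<close> after all.  Hence on compact sets away from the limit spectrum the
  resolvents exist for large \<open>n\<close> and are uniformly bounded (\<open>resolvent_bound\<close>), which forces the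
  part of the approximating spectra in \<open>V\<close> to shrink to \<open>lam\<close>.

  \<^emph>\<open>Eigenvalues and projections.\<close>  If a disc around \<open>lam\<close> contained no spectrum of \<open>U\<^sub>n\<close>, the maximum
  principle would extend the resolvent bound from the circle to \<open>lam\<close>; but \<open>(U\<^sub>n - lam) v \<longlonglongrightarrow> 0\<close> for an
  eigenvector \<open>v\<close> of \<open>U\<close>, a contradiction (\<open>spectrum_near_eigenvalue\<close>).  Finally
  \<open>R\<^sub>n(z) v - R(z) v = R\<^sub>n(z) (T\<^sub>n - T) R(z) v\<close> and \<open>\<zeta> R(z) v = v + T R(z) v\<close>, so the resolvents at \<open>v\<close>
  converge uniformly on the circle as soon as \<open>T\<^sub>n v \<longlonglongrightarrow> T v\<close>, and this happens almost surely
  for each \<open>v\<close>.  The Riesz integrals inherit the convergence once they are known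
  not to depend on the curve (\<open>spectral_projection_eq\<close>).
\<close>

section \<open>Inverses of perturbed bounded operators\<close>

lemmas compose_distribs =
  bounded_bilinear.add_left[OF bounded_bilinear_blinfun_compose]
  bounded_bilinear.add_right[OF bounded_bilinear_blinfun_compose]
  bounded_bilinear.diff_left[OF bounded_bilinear_blinfun_compose]
  bounded_bilinear.diff_right[OF bounded_bilinear_blinfun_compose]
  bounded_bilinear.minus_left[OF bounded_bilinear_blinfun_compose]
  bounded_bilinear.minus_right[OF bounded_bilinear_blinfun_compose]

lemma compose_assoc: "(f o\<^sub>L g) o\<^sub>L h = f o\<^sub>L (g o\<^sub>L h)"
  by (rule blinfun_eqI) simp

lemma compose_id [simp]: "f o\<^sub>L id_blinfun = f" "id_blinfun o\<^sub>L f = f"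
  by (rule blinfun_eqI, simp)+

definition inverse_ops ::
  "('b::real_normed_vector \<Rightarrow>\<^sub>L 'b) \<Rightarrow> ('b \<Rightarrow>\<^sub>L 'b) \<Rightarrow> bool" where
  "inverse_ops D R \<longleftrightarrow> R o\<^sub>L D = id_blinfun \<and> D o\<^sub>L R = id_blinfun"

lemma inverse_ops_left_unique:
  assumes "inverse_ops D R" "L o\<^sub>L D = id_blinfun"
  shows "L = R"
  by (metis assms compose_assoc compose_id inverse_ops_def)

lemma neumann_series:
  fixes A :: "'b::banach \<Rightarrow>\<^sub>L 'b"
  assumes q: "norm A \<le> q" "q < 1"
  obtains N where "inverse_ops (id_blinfun - A) N" "norm N \<le> 1 / (1 - q)"
proof -
  define p where "p n = (((o\<^sub>L) A) ^^ n) id_blinfun" for n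
  have p_0: "p 0 = id_blinfun" and p_Suc: "p (Suc n) = A o\<^sub>L p n" for n
    by (simp_all add: p_def)
  have p_comm: "p n o\<^sub>L A = p (Suc n)" for n
    by (induction n) (simp_all add: p_0 p_Suc compose_assoc)
  have q0: "0 \<le> q" using q(1) norm_ge_zero[of A] by linarith
  have p_le: "norm (p n) \<le> q ^ n" for n
  proof (induction n)
    case 0
    then show ?case by (simp add: p_0 norm_blinfun_id_le)
  next
    case (Suc n)
    have "norm (p (Suc n)) \<le> norm A * norm (p n)"
      by (simp add: p_Suc norm_blinfun_compose)
    also have "\<dots> \<le> q * q ^ n"
      using Suc q q0 by (intro mult_mono) auto
    finally show ?case by simp
  qed
  have geo: "(\<lambda>n. q ^ n) sums (1 / (1 - q))"
    using q q0 by (intro geometric_sums) auto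
  have sp: "summable p"
    by (rule summable_comparison_test'[where g = "\<lambda>n. q ^ n" and N = 0, OF sums_summable[OF geo]])
      (rule p_le)
  define N where "N = suminf p"
  have N: "p sums N" by (simp add: N_def sp summable_sums)
  have N1: "(\<lambda>n. p (Suc n)) sums (N - id_blinfun)"
    using sums_split_initial_segment[OF N, of 1] by (simp add: p_0)
  have "(\<lambda>n. A o\<^sub>L p n) sums (A o\<^sub>L N)"
    by (rule bounded_linear.sums[OF bounded_bilinear.bounded_linear_right[OF
          bounded_bilinear_blinfun_compose] N])
  then have 1: "A o\<^sub>L N = N - id_blinfun"
    using N1 by (simp add: p_Suc sums_unique2)
  have "(\<lambda>n. p n o\<^sub>L A) sums (N o\<^sub>L A)"
    by (rule bounded_linear.sums[OF bounded_bilinear.bounded_linear_left[OF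
          bounded_bilinear_blinfun_compose] N])
  then have 2: "N o\<^sub>L A = N - id_blinfun"
    using N1 by (simp add: p_comm sums_unique2)
  have "norm N \<le> (\<Sum>n. q ^ n)"
    unfolding N_def using p_le geo by (intro norm_suminf_le) (auto simp: sums_iff)
  then have 3: "norm N \<le> 1 / (1 - q)" using geo by (simp add: sums_iff)
  show thesis
    by (rule that[of N]) (use 1 2 3 in \<open>auto simp: inverse_ops_def compose_distribs\<close>)
qed

text \<open>
  \<open>D' = D (1 - R (D - D'))\<close>, and the second factor is inverted by the Neumann series.
\<close>

lemma inverse_ops_perturb:
  fixes D D' R :: "'b::banach \<Rightarrow>\<^sub>L 'b"
  assumes DR: "inverse_ops D R" and q: "norm R * norm (D' - D) \<le> q" "q < 1"
  obtains R' where "inverse_ops D' R'" "norm R' \<le> norm R / (1 - q)"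
proof -
  define A where "A = R o\<^sub>L (D - D')"
  have "norm A \<le> q"
    using norm_blinfun_compose[of R "D - D'"] q by (simp add: A_def norm_minus_commute)
  then obtain N where N: "inverse_ops (id_blinfun - A) N" "norm N \<le> 1 / (1 - q)"
    using neumann_series q(2) by blast
  have DR': "R o\<^sub>L D = id_blinfun" "D o\<^sub>L R = id_blinfun"
    using DR by (auto simp: inverse_ops_def)
  have D': "D' = D o\<^sub>L (id_blinfun - A)"
    unfolding A_def compose_distribs compose_assoc[symmetric] DR' by simp
  have RD': "R o\<^sub>L D' = id_blinfun - A"
    unfolding A_def compose_distribs DR' by simp
  have "(N o\<^sub>L R) o\<^sub>L D' = id_blinfun"
    using N by (simp add: compose_assoc RD' inverse_ops_def)
  moreover have "D' o\<^sub>L (N o\<^sub>L R) = id_blinfun"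
  proof -
    have "D' o\<^sub>L (N o\<^sub>L R) = D o\<^sub>L (((id_blinfun - A) o\<^sub>L N) o\<^sub>L R)"
      by (simp add: D' compose_assoc)
    then show ?thesis using N DR' by (simp add: inverse_ops_def)
  qed
  moreover have "norm (N o\<^sub>L R) \<le> norm R / (1 - q)"
    using norm_blinfun_compose[of N R] mult_right_mono[OF N(2), of "norm R"] by simp
  ultimately show thesis by (intro that) (auto simp: inverse_ops_def)
qed

section \<open>The complexification\<close>

lemma blinfun_apply_complexify [simp]: "blinfun_apply (complexify S) v = (S (fst v), S (snd v))"
  by (simp add: complexify.rep_eq)

lemma blinfun_apply_cscale [simp]:
  "blinfun_apply (cscale z) v =
    (Re z *\<^sub>R fst v - Im z *\<^sub>R snd v, Im z *\<^sub>R fst v + Re z *\<^sub>R snd v)"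
  by (simp add: cscale.rep_eq)

lemma cscale_add: "cscale (z + w) = cscale z + cscale w"
  by (rule blinfun_eqI) (simp add: blinfun.add_left algebra_simps)

lemma cscale_diff: "cscale (z - w) = cscale z - cscale w"
  by (rule blinfun_eqI) (simp add: blinfun.diff_left algebra_simps)

lemma cscale_mult: "cscale (z * w) = cscale z o\<^sub>L cscale w"
  by (rule blinfun_eqI) (simp add: algebra_simps)

lemma cscale_0 [simp]: "cscale 0 = 0"
  by (rule blinfun_eqI) (simp add: zero_prod_def)

lemma cscale_1 [simp]: "cscale 1 = id_blinfun"
  by (rule blinfun_eqI) simp

lemma cscale_scaleR: "cscale (r *\<^sub>R z) = r *\<^sub>R cscale z"
  by (rule blinfun_eqI) (simp add: blinfun.scaleR_left algebra_simps)

lemma cscale_commute: "cscale z o\<^sub>L cscale w = cscale w o\<^sub>L cscale z"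
  by (metis cscale_mult mult.commute)

lemma cscale_inverse:
  assumes "z \<noteq> 0"
  shows "inverse_ops (cscale z) (cscale (1 / z))"
  using assms by (simp add: inverse_ops_def flip: cscale_mult)

text \<open>
  Multiplication by a complex scalar is not a similarity for the product norm, hence the factor 2;
  only the order of magnitude in \<open>z\<close> matters later.
\<close>

lemma norm_cscale_le: "norm (cscale z :: ('e::real_normed_vector \<times> 'e) \<Rightarrow>\<^sub>L _) \<le> 2 * cmod z"
proof (rule norm_blinfun_bound)
  fix v :: "'e \<times> 'e"
  have "cscale z v = Re z *\<^sub>R v + Im z *\<^sub>R (- snd v, fst v)"
    by (cases v) simp
  also have "norm \<dots> \<le> norm (Re z *\<^sub>R v) + norm (Im z *\<^sub>R (- snd v, fst v))"
    by (rule norm_triangle_ineq)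
  also have "\<dots> = (\<bar>Re z\<bar> + \<bar>Im z\<bar>) * norm v"
    by (cases v) (simp only: norm_scaleR, simp add: norm_Pair algebra_simps)
  also have "\<dots> \<le> 2 * cmod z * norm v"
    using abs_Re_le_cmod[of z] abs_Im_le_cmod[of z] by (intro mult_right_mono) auto
  finally show "norm (cscale z v) \<le> 2 * cmod z * norm v" .
qed simp

lemma bounded_linear_cscale: "bounded_linear cscale"
  by (rule bounded_linear_intro[where K = 2])
    (use norm_cscale_le in \<open>auto simp: cscale_add cscale_scaleR mult.commute\<close>)

lemma complexify_diff: "complexify (S - T) = complexify S - complexify T"
  by (rule blinfun_eqI) (simp add: blinfun.diff_left)

lemma complexify_compose: "complexify (S o\<^sub>L T) = complexify S o\<^sub>L complexify T"
  by (rule blinfun_eqI) simp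

lemma complexify_id [simp]: "complexify id_blinfun = id_blinfun"
  by (rule blinfun_eqI) simp

lemma complexify_cscale: "complexify S o\<^sub>L cscale z = cscale z o\<^sub>L complexify S"
  by (rule blinfun_eqI) (simp add: blinfun.bilinear_simps)

lemma norm_complexify_le: "norm (complexify S) \<le> norm S"
proof (rule norm_blinfun_bound)
  fix v
  have "sqrt ((norm (S (fst v)))\<^sup>2 + (norm (S (snd v)))\<^sup>2)
      \<le> sqrt ((norm S * norm (fst v))\<^sup>2 + (norm S * norm (snd v))\<^sup>2)"
    by (intro real_sqrt_le_mono add_mono power_mono norm_blinfun) auto
  also have "\<dots> = norm S * norm v"
    by (cases v) (simp add: norm_Pair power_mult_distrib real_sqrt_mult flip: distrib_left)
  finally show "norm (complexify S v) \<le> norm S * norm v" by (simp add: norm_Pair)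
qed simp

section \<open>The resolvent\<close>

lemma is_resolvent_iff: "is_resolvent S z R \<longleftrightarrow> inverse_ops (complexify S - cscale z) R"
  by (simp add: is_resolvent_def inverse_ops_def)

lemma resolvent_eqI:
  assumes R: "is_resolvent S z R"
  shows "resolvent S z = R"
  unfolding resolvent_def
proof (rule the_equality)
  show "is_resolvent S z R" by (rule R)
  fix R' assume "is_resolvent S z R'"
  then have "R' o\<^sub>L (complexify S - cscale z) = id_blinfun"
    by (simp add: is_resolvent_def)
  with R show "R' = R"
    unfolding is_resolvent_iff by (rule inverse_ops_left_unique)
qed

lemma resolvent_inverse:
  assumes "z \<notin> op_spectrum S"
  shows "inverse_ops (complexify S - cscale z) (resolvent S z)"
proof -
  obtain R where R: "is_resolvent S z R" using assms unfolding op_spectrum_def by blast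
  then show ?thesis by (simp only: resolvent_eqI[OF R] is_resolvent_iff)
qed

lemma not_in_spectrumI:
  assumes "inverse_ops (complexify S - cscale z) R"
  shows "z \<notin> op_spectrum S" "resolvent S z = R"
proof -
  have "is_resolvent S z R" using assms by (simp only: is_resolvent_iff)
  then show "z \<notin> op_spectrum S" "resolvent S z = R"
    unfolding op_spectrum_def using resolvent_eqI by blast+
qed

lemma resolvent_apply:
  assumes "z \<notin> op_spectrum S"
  shows "resolvent S z (complexify S v - cscale z v) = v"
    and "complexify S (resolvent S z v) - cscale z (resolvent S z v) = v"
proof -
  note * = resolvent_inverse[OF assms, unfolded inverse_ops_def]
  show "resolvent S z (complexify S v - cscale z v) = v"
    using arg_cong[OF conjunct1[OF *], of "\<lambda>A. blinfun_apply A v"]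
    by (simp add: blinfun.diff_left del: blinfun_apply_complexify blinfun_apply_cscale)
  show "complexify S (resolvent S z v) - cscale z (resolvent S z v) = v"
    using arg_cong[OF conjunct2[OF *], of "\<lambda>A. blinfun_apply A v"]
    by (simp add: blinfun.diff_left del: blinfun_apply_complexify blinfun_apply_cscale)
qed

text \<open>
  The resolvent is linear over the complex numbers, because \<open>S\<close> acts on both components alike.
\<close>

lemma resolvent_cscale:
  assumes "z \<notin> op_spectrum S"
  shows "resolvent S z o\<^sub>L cscale w = cscale w o\<^sub>L resolvent S z"
proof -
  define D R where "D = complexify S - cscale z" and "R = resolvent S z"
  have *: "R o\<^sub>L D = id_blinfun" "D o\<^sub>L R = id_blinfun"
    using resolvent_inverse[OF assms] by (simp_all only: inverse_ops_def D_def R_def)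
  have D: "D o\<^sub>L cscale w = cscale w o\<^sub>L D"
    unfolding D_def compose_distribs by (simp only: complexify_cscale cscale_commute)
  have "R o\<^sub>L cscale w = R o\<^sub>L ((cscale w o\<^sub>L D) o\<^sub>L R)"
    by (simp only: * compose_id compose_assoc)
  also have "\<dots> = (R o\<^sub>L D) o\<^sub>L (cscale w o\<^sub>L R)"
    by (simp only: D[symmetric] compose_assoc)
  finally show ?thesis unfolding * compose_id by (simp only: R_def)
qed

lemma resolvent_identity:
  assumes z: "z \<notin> op_spectrum S" and w: "w \<notin> op_spectrum S"
  shows "resolvent S z - resolvent S w = resolvent S z o\<^sub>L cscale (z - w) o\<^sub>L resolvent S w"
proof -
  let ?Rz = "resolvent S z" and ?Rw = "resolvent S w"
  have e: "cscale (z - w) = (complexify S - cscale w) - (complexify S - cscale z)"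
    by (simp add: cscale_diff)
  have "?Rz o\<^sub>L cscale (z - w) o\<^sub>L ?Rw =
      (?Rz o\<^sub>L ((complexify S - cscale w) o\<^sub>L ?Rw)) - ((?Rz o\<^sub>L (complexify S - cscale z)) o\<^sub>L ?Rw)"
    unfolding e compose_distribs compose_assoc by simp
  then show ?thesis
    using resolvent_inverse[OF z] resolvent_inverse[OF w] by (simp add: inverse_ops_def)
qed

text \<open>
  The perturbation \<open>w - z\<close> enters through an operator of norm at most \<open>2 |w - z|\<close>; the constant 4
  makes the ratio of the Neumann series at most \<open>1/2\<close>.
\<close>

lemma resolvent_nearby:
  fixes S :: "'e::banach \<Rightarrow>\<^sub>L 'e"
  assumes z: "z \<notin> op_spectrum S" and w: "4 * norm (resolvent S z) * cmod (w - z) \<le> 1"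
  shows "w \<notin> op_spectrum S" "norm (resolvent S w) \<le> 2 * norm (resolvent S z)"
proof -
  have "norm ((complexify S - cscale w) - (complexify S - cscale z)) \<le> 2 * cmod (w - z)"
    using norm_cscale_le[of "z - w"] by (simp add: cscale_diff norm_minus_commute)
  then have *: "norm (resolvent S z) *
      norm ((complexify S - cscale w) - (complexify S - cscale z)) \<le> 1 / 2"
    using mult_left_mono[of _ "2 * cmod (w - z)" "norm (resolvent S z)"] w
    by (fastforce simp: mult_ac)
  obtain R where R: "inverse_ops (complexify S - cscale w) R"
      "norm R \<le> norm (resolvent S z) / (1 - 1 / 2)"
    using inverse_ops_perturb[OF resolvent_inverse[OF z] *] by auto
  show "w \<notin> op_spectrum S" "norm (resolvent S w) \<le> 2 * norm (resolvent S z)"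
    using not_in_spectrumI[OF R(1)] R(2) by auto
qed

lemma resolvent_locally_bounded:
  fixes S :: "'e::banach \<Rightarrow>\<^sub>L 'e"
  assumes z: "z \<notin> op_spectrum S"
  obtains e where "e > 0" "\<And>w. w \<in> ball z e \<Longrightarrow> w \<notin> op_spectrum S"
    "\<And>w. w \<in> ball z e \<Longrightarrow> 4 * norm (resolvent S z) * cmod (w - z) \<le> 1"
    "\<And>w. w \<in> ball z e \<Longrightarrow> norm (resolvent S w) \<le> 2 * norm (resolvent S z)"
proof -
  define e where "e = 1 / (4 * norm (resolvent S z) + 1)"
  have pos: "4 * norm (resolvent S z) + 1 > 0" by (simp add: add_nonneg_pos)
  then have e: "e > 0" by (simp add: e_def)
  have *: "4 * norm (resolvent S z) * cmod (w - z) \<le> 1" if "w \<in> ball z e" for w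
  proof -
    have "4 * norm (resolvent S z) * cmod (w - z) \<le> (4 * norm (resolvent S z) + 1) * e"
      using that by (intro mult_mono) (auto simp: dist_norm norm_minus_commute)
    then show ?thesis using pos by (simp add: e_def)
  qed
  show thesis by (rule that[OF e]) (use * resolvent_nearby[OF z] in blast)+
qed

lemma open_resolvent_set:
  fixes S :: "'e::banach \<Rightarrow>\<^sub>L 'e"
  shows "open (- op_spectrum S)"
  unfolding open_contains_ball
proof
  fix z assume "z \<in> - op_spectrum S"
  then obtain e where "e > 0" "\<And>w. w \<in> ball z e \<Longrightarrow> w \<notin> op_spectrum S"
    using resolvent_locally_bounded by (metis ComplD)
  then show "\<exists>e>0. ball z e \<subseteq> - op_spectrum S" by blast
qed

lemma isCont_resolvent:
  fixes S :: "'e::banach \<Rightarrow>\<^sub>L 'e"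
  assumes z: "z \<notin> op_spectrum S"
  shows "isCont (resolvent S) z"
proof -
  obtain e where e: "e > 0" "\<And>w. w \<in> ball z e \<Longrightarrow> w \<notin> op_spectrum S"
    "\<And>w. w \<in> ball z e \<Longrightarrow> norm (resolvent S w) \<le> 2 * norm (resolvent S z)"
    using resolvent_locally_bounded[OF z] by metis
  let ?r = "norm (resolvent S z)"
  have le: "norm (resolvent S w - resolvent S z) \<le> 4 * ?r * ?r * cmod (w - z)"
    if w: "w \<in> ball z e" for w
  proof -
    have "norm (resolvent S w - resolvent S z)
        \<le> norm (resolvent S w) * norm (cscale (w - z) :: ('e \<times> 'e) \<Rightarrow>\<^sub>L _) * ?r"
      unfolding resolvent_identity[OF e(2)[OF w] z]
      by (intro order_trans[OF norm_blinfun_compose] mult_right_mono norm_blinfun_compose) auto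
    also have "\<dots> \<le> (2 * ?r) * (2 * cmod (w - z)) * ?r"
      using e(3)[OF w] norm_cscale_le[of "w - z"] by (intro mult_mono) auto
    finally show ?thesis by (simp add: mult_ac)
  qed
  have "((\<lambda>w. resolvent S w - resolvent S z) \<longlongrightarrow> 0) (at z)"
  proof (rule Lim_null_comparison)
    show "\<forall>\<^sub>F w in at z. norm (resolvent S w - resolvent S z) \<le> 4 * ?r * ?r * cmod (w - z)"
      unfolding eventually_at using e(1) le by (intro exI[of _ e]) (auto simp: dist_commute)
    show "((\<lambda>w. 4 * ?r * ?r * cmod (w - z)) \<longlongrightarrow> 0) (at z)"
      by (auto intro!: tendsto_eq_intros)
  qed
  then show ?thesis by (simp add: isCont_def LIM_zero_iff)
qed

lemma resolvent_bounded_on_compact: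
  fixes S :: "'e::banach \<Rightarrow>\<^sub>L 'e"
  assumes "compact K" "K \<inter> op_spectrum S = {}"
  obtains B where "B > 0" "\<And>z. z \<in> K \<Longrightarrow> norm (resolvent S z) \<le> B"
proof -
  have "continuous_on K (resolvent S)"
    using assms(2) by (intro continuous_at_imp_continuous_on ballI isCont_resolvent) auto
  then have "bounded (resolvent S ` K)"
    using assms(1) compact_continuous_image compact_imp_bounded by blast
  then show thesis using that unfolding bounded_pos by blast
qed

lemma spectrum_bound:
  fixes S :: "'e::banach \<Rightarrow>\<^sub>L 'e"
  assumes "z \<in> op_spectrum S"
  shows "cmod z \<le> 2 * norm S"
proof (rule ccontr)
  assume z: "\<not> cmod z \<le> 2 * norm S"
  then have "z \<noteq> 0" using norm_ge_zero[of S] by auto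
  then have inv: "inverse_ops (- cscale z :: ('e \<times> 'e) \<Rightarrow>\<^sub>L _) (- cscale (1 / z))"
    using cscale_inverse[of z, where 'a = 'e] by (simp add: inverse_ops_def compose_distribs)
  have "norm (- cscale (1 / z) :: ('e \<times> 'e) \<Rightarrow>\<^sub>L _) * norm ((complexify S - cscale z) - (- cscale z))
      \<le> (2 / cmod z) * norm S"
    using norm_cscale_le[of "1 / z"] norm_complexify_le[of S]
    by (intro mult_mono) (auto simp: norm_divide)
  moreover have "(2 / cmod z) * norm S < 1" using z \<open>z \<noteq> 0\<close> by (simp add: field_simps)
  ultimately obtain R where "inverse_ops (complexify S - cscale z) R"
    using inverse_ops_perturb[OF inv] by blast
  from not_in_spectrumI(1)[OF this] assms show False by contradiction
qed

text \<open>
  The derivative of a piecewise \<open>C\<^sup>1\<close> path may be unbounded near its exceptional points, so continuity of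
  the resolvent does not make its contour integrals exist.  Local primitives do.  Here the
  Neumann series of the resolvent at \<open>z0\<close> is integrated term by term.
\<close>

lemma resolvent_local_primitive:
  fixes S :: "'e::banach \<Rightarrow>\<^sub>L 'e"
  assumes z0: "z0 \<notin> op_spectrum S"
  obtains e G where "e > 0" "ball z0 e \<subseteq> - op_spectrum S"
    "\<And>z. z \<in> ball z0 e \<Longrightarrow> (G has_derivative (\<lambda>h. cscale h o\<^sub>L resolvent S z)) (at z)"
proof -
  let ?Q = "resolvent S z0"
  obtain e where e: "e > 0" "\<And>w. w \<in> ball z0 e \<Longrightarrow> w \<notin> op_spectrum S"
    "\<And>w. w \<in> ball z0 e \<Longrightarrow> 4 * norm ?Q * cmod (w - z0) \<le> 1"
    "\<And>w. w \<in> ball z0 e \<Longrightarrow> norm (resolvent S w) \<le> 2 * norm ?Q"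
    using resolvent_locally_bounded[OF z0] by metis
  define p where "p n = (((o\<^sub>L) ?Q) ^^ n) id_blinfun" for n
  have p_0: "p 0 = id_blinfun" and p_Suc: "p (Suc n) = ?Q o\<^sub>L p n" for n
    by (simp_all add: p_def)
  have p_le: "norm (p n) \<le> norm ?Q ^ n" for n
  proof (induction n)
    case 0
    then show ?case by (simp add: p_0 norm_blinfun_id_le)
  next
    case (Suc n)
    have "norm (p (Suc n)) \<le> norm ?Q * norm (p n)"
      by (simp add: p_Suc norm_blinfun_compose)
    also have "\<dots> \<le> norm ?Q * norm ?Q ^ n"
      using Suc by (intro mult_mono) auto
    finally show ?case by simp
  qed
  \<comment> \<open>Iterating the resolvent identity gives the remainder of the series exactly, and with it the uniform
    convergence of the derivatives on the ball.\<close>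
  have psum: "(\<Sum>i<n. cscale ((z - z0) ^ i) o\<^sub>L p (Suc i)) =
      resolvent S z - (resolvent S z o\<^sub>L cscale ((z - z0) ^ n) o\<^sub>L p n)" if "z \<in> ball z0 e" for z n
  proof (induction n)
    case 0
    then show ?case by (simp add: p_0)
  next
    case (Suc n)
    let ?u = "z - z0" and ?R = "resolvent S z"
    define X where "X = cscale (?u ^ n) o\<^sub>L p n"
    have "?R = ?Q + (?R o\<^sub>L cscale ?u o\<^sub>L ?Q)"
      using resolvent_identity[OF e(2)[OF that] z0] by (simp only: diff_eq_eq add.commute)
    from arg_cong[OF this, of "\<lambda>R. R o\<^sub>L X"]
    have "?R o\<^sub>L X = (?Q o\<^sub>L X) + (?R o\<^sub>L cscale ?u o\<^sub>L ?Q o\<^sub>L X)"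
      by (simp only: compose_distribs)
    also have "?Q o\<^sub>L X = cscale (?u ^ n) o\<^sub>L p (Suc n)"
      by (simp only: X_def p_Suc resolvent_cscale[OF z0] compose_assoc[symmetric])
    also have "?R o\<^sub>L cscale ?u o\<^sub>L ?Q o\<^sub>L X = ?R o\<^sub>L cscale ?u o\<^sub>L (?Q o\<^sub>L X)"
      by (simp only: compose_assoc)
    also have "\<dots> = ?R o\<^sub>L cscale (?u ^ Suc n) o\<^sub>L p (Suc n)"
      by (simp only: \<open>?Q o\<^sub>L X = _\<close> compose_assoc cscale_mult power_Suc)
    finally have "?R o\<^sub>L cscale (?u ^ n) o\<^sub>L p n =
        (cscale (?u ^ n) o\<^sub>L p (Suc n)) + (?R o\<^sub>L cscale (?u ^ Suc n) o\<^sub>L p (Suc n))"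
      by (simp only: X_def compose_assoc)
    then show ?case using Suc by (simp del: power_Suc)
  qed
  define f where "f n z = cscale (((z - z0) ^ Suc n) / of_nat (Suc n)) o\<^sub>L p (Suc n)" for n z
  have f': "(f n has_derivative (\<lambda>h. cscale (h * (z - z0) ^ n) o\<^sub>L p (Suc n))) (at z within ball z0 e)"
    for n z
  proof -
    have "((\<lambda>z. (z - z0) ^ Suc n / of_nat (Suc n)) has_field_derivative (z - z0) ^ n)
        (at z within ball z0 e)"
      by (auto intro!: derivative_eq_intros simp del: of_nat_Suc power_Suc)
    then have "((\<lambda>z. (z - z0) ^ Suc n / of_nat (Suc n)) has_derivative (\<lambda>h. h * (z - z0) ^ n))
        (at z within ball z0 e)"
      by (simp add: has_field_derivative_def mult_commute_abs)
    from bounded_linear.has_derivative[OF bounded_bilinear.bounded_linear_left[OF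
        bounded_bilinear_blinfun_compose] bounded_linear.has_derivative[OF bounded_linear_cscale this],
        of "p (Suc n)"]
    show ?thesis by (simp add: f_def[abs_def])
  qed
  have ev: "\<forall>\<^sub>F n in sequentially. \<forall>z\<in>ball z0 e. \<forall>h.
      norm ((\<Sum>i<n. cscale (h * (z - z0) ^ i) o\<^sub>L p (Suc i)) - (cscale h o\<^sub>L resolvent S z))
      \<le> d * norm h" if "d > 0" for d
  proof -
    have "(\<lambda>n. 8 * norm ?Q * (1 / 2) ^ n) \<longlonglongrightarrow> 0"
      by (auto intro!: tendsto_eq_intros LIMSEQ_realpow_zero)
    then have "\<forall>\<^sub>F n in sequentially. 8 * norm ?Q * (1 / 2) ^ n < d"
      using that by (auto dest: order_tendstoD(2))
    then show ?thesis
    proof eventually_elim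
      case (elim n)
      show ?case
      proof (intro ballI allI)
        fix z h assume z: "z \<in> ball z0 e"
        let ?R = "resolvent S z"
        have "(\<Sum>i<n. cscale (h * (z - z0) ^ i) o\<^sub>L p (Suc i)) =
            cscale h o\<^sub>L (\<Sum>i<n. cscale ((z - z0) ^ i) o\<^sub>L p (Suc i))"
          by (simp add: cscale_mult compose_assoc
              bounded_bilinear.sum_right[OF bounded_bilinear_blinfun_compose])
        then have "norm ((\<Sum>i<n. cscale (h * (z - z0) ^ i) o\<^sub>L p (Suc i)) - (cscale h o\<^sub>L ?R)) =
            norm (cscale h o\<^sub>L (?R o\<^sub>L (cscale ((z - z0) ^ n) o\<^sub>L p n)))"
          by (simp add: psum[OF z] compose_distribs compose_assoc)
        also have "\<dots> \<le> norm (cscale h :: ('e \<times> 'e) \<Rightarrow>\<^sub>L _) *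
            (norm ?R * (norm (cscale ((z - z0) ^ n) :: ('e \<times> 'e) \<Rightarrow>\<^sub>L _) * norm (p n)))"
          by (intro order_trans[OF norm_blinfun_compose] mult_left_mono
              norm_blinfun_compose) auto
        also have "\<dots> \<le> (2 * cmod h) *
            ((2 * norm ?Q) * ((2 * cmod (z - z0) ^ n) * norm ?Q ^ n))"
          using norm_cscale_le[of h] e(4)[OF z] norm_cscale_le[of "(z - z0) ^ n"] p_le[of n]
          by (intro mult_mono) (auto simp: norm_power)
        also have "\<dots> = 8 * norm ?Q * (norm ?Q * cmod (z - z0)) ^ n * cmod h"
          by (simp add: power_mult_distrib mult_ac)
        also have "\<dots> \<le> 8 * norm ?Q * (1 / 2) ^ n * cmod h"
          using e(3)[OF z] by (intro mult_right_mono mult_left_mono power_mono) auto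
        also have "\<dots> \<le> d * cmod h"
          using elim by (intro mult_right_mono) auto
        finally show "norm ((\<Sum>i<n. cscale (h * (z - z0) ^ i) o\<^sub>L p (Suc i)) -
            (cscale h o\<^sub>L resolvent S z)) \<le> d * norm h" .
      qed
    qed
  qed
  have f0: "(\<lambda>n. f n z0) sums 0" by (simp add: f_def)
  have z0_in: "z0 \<in> ball z0 e" using e(1) by simp
  have "\<exists>G. \<forall>z\<in>ball z0 e. (\<lambda>n. f n z) sums G z \<and>
      (G has_derivative (\<lambda>h. cscale h o\<^sub>L resolvent S z)) (at z within ball z0 e)"
    by (rule has_derivative_series[where g' = "\<lambda>z h. cscale h o\<^sub>L resolvent S z",
          OF convex_ball f' ev z0_in f0])
  then obtain G where G: "\<forall>z\<in>ball z0 e. (\<lambda>n. f n z) sums G z \<and>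
      (G has_derivative (\<lambda>h. cscale h o\<^sub>L resolvent S z)) (at z within ball z0 e)"
    by (rule exE)
  show thesis
  proof (rule that[of e G])
    show "e > 0" "ball z0 e \<subseteq> - op_spectrum S" using e(1,2) by blast+
    fix z assume z: "z \<in> ball z0 e"
    show "(G has_derivative (\<lambda>h. cscale h o\<^sub>L resolvent S z)) (at z)"
      using G[rule_format, OF z] unfolding at_within_open[OF z open_ball] by (rule conjunct2)
  qed
qed

text \<open>
  Along a short piece of the path the integrand is the derivative of the composition of the path with
  a local primitive, up to finitely many parameters, and the fundamental theorem of calculus
  for the gauge integral applies; compactness of the parameter interval glues the pieces.
\<close>

lemma resolvent_contour_integrable:
  fixes S :: "'e::banach \<Rightarrow>\<^sub>L 'e"
  assumes g: "valid_path g" and sub: "path_image g \<inter> op_spectrum S = {}"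
  shows "(\<lambda>t. cscale (vector_derivative g (at t within {0..1})) o\<^sub>L resolvent S (g t))
    integrable_on {0..1}"
proof -
  let ?F = "\<lambda>t. cscale (vector_derivative g (at t within {0..1})) o\<^sub>L resolvent S (g t)"
  obtain X where X: "finite X" "\<And>t. t \<in> {0..1} - X \<Longrightarrow> g differentiable (at t)"
    and cont: "continuous_on {0..1} g"
    using g by (auto simp: valid_path_def piecewise_C1_differentiable_on_def
        C1_differentiable_on_eq)
  have "\<exists>d>0. \<forall>u v. t \<in> cbox u v \<and> cbox u v \<subseteq> ball t d \<and> cbox u v \<subseteq> cbox 0 1 \<longrightarrow>
      ?F integrable_on cbox u v" if t: "t \<in> cbox (0::real) 1" for t
  proof -
    have "g t \<in> path_image g"
      using t by (simp add: path_image_def)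
    then have "g t \<notin> op_spectrum S" using sub by blast
    then obtain e G where e: "e > 0" "ball (g t) e \<subseteq> - op_spectrum S"
      and G: "\<And>z. z \<in> ball (g t) e \<Longrightarrow> (G has_derivative (\<lambda>h. cscale h o\<^sub>L resolvent S z)) (at z)"
      by (rule resolvent_local_primitive) blast
    have "\<forall>e>0. \<exists>d>0. \<forall>s\<in>{0..1}. dist s t < d \<longrightarrow> dist (g s) (g t) < e"
      using cont t by (simp add: continuous_on_iff)
    then obtain d where d: "d > 0" "\<And>s. s \<in> {0..1} \<Longrightarrow> dist s t < d \<Longrightarrow> dist (g s) (g t) < e"
      using e(1) by blast
    have "?F integrable_on {u..v}"
      if uv: "t \<in> {u..v}" "{u..v} \<subseteq> ball t d" "{u..v} \<subseteq> {0..1}" for u v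
    proof -
      have gs: "g s \<in> ball (g t) e" if "s \<in> {u..v}" for s
      proof -
        have "s \<in> ball t d" "s \<in> {0..1}" using that uv by blast+
        then show ?thesis using d(2)[of s] by (simp add: dist_commute)
      qed
      have "(?F has_integral ((G \<circ> g) v - (G \<circ> g) u)) {u..v}"
      proof (rule fundamental_theorem_of_calculus_interior_strong[where S = X])
        show "finite X" "u \<le> v" using X uv by auto
        show "continuous_on {u..v} (G \<circ> g)"
        proof (rule continuous_on_compose)
          show "continuous_on {u..v} g" using cont uv(3) continuous_on_subset by blast
          have "isCont G z" if "z \<in> ball (g t) e" for z
            using G[OF that] by (rule has_derivative_continuous)
          then show "continuous_on (g ` {u..v}) G"
            using gs by (intro continuous_at_imp_continuous_on) blast
        qed
        fix s assume s: "s \<in> {u<..<v} - X"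
        have "u \<in> {u..v}" "v \<in> {u..v}" using uv(1) by simp_all
        then have "u \<in> {0..1}" "v \<in> {0..1}" using uv(3) by blast+
        then have s01: "s \<in> {0<..<1}" "s \<in> {0..1} - X" using s by auto
        define g' where "g' = vector_derivative g (at s)"
        have g': "(g has_vector_derivative g') (at s)"
          using X(2)[OF s01(2)] unfolding g'_def by (rule vector_derivative_works[THEN iffD1])
        have vd: "vector_derivative g (at s within {0..1}) = g'"
          using s01 by (intro vector_derivative_at_within_ivl[OF g']) auto
        have "s \<in> {u..v}" using s by simp
        then have Gs: "(G has_derivative (\<lambda>h. cscale h o\<^sub>L resolvent S (g s))) (at (g s))"
          by (intro G gs)
        have "(\<lambda>h. cscale h o\<^sub>L resolvent S (g s)) \<circ> (\<lambda>h. h *\<^sub>R g') = (\<lambda>h. h *\<^sub>R ?F s)"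
          by (rule ext) (simp only: o_def cscale_scaleR vd
              bounded_bilinear.scaleR_left[OF bounded_bilinear_blinfun_compose])
        with diff_chain_at[OF g'[unfolded has_vector_derivative_def] Gs]
        show "((G \<circ> g) has_vector_derivative ?F s) (at s)"
          unfolding has_vector_derivative_def by (simp only:)
      qed
      then show ?thesis by blast
    qed
    then show ?thesis using d(1) unfolding cbox_interval by blast
  qed
  then have "?F integrable_on cbox 0 1"
    by (intro integrable_on_little_subintervals) blast
  then show ?thesis by simp
qed

section \<open>Perturbations of the identity by operators of finite rank\<close>

text \<open>
  Finite-dimensional linear algebra in the form needed below: off a finite set of eigenvalues the matrix
  \<open>\<zeta> - H\<close> has a two-sided inverse \<open>G\<close>.
\<close>

lemma matrix_eigenvalue_alternative:
  fixes H :: "nat \<Rightarrow> nat \<Rightarrow> complex"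
  obtains Ev where "finite Ev"
    and "\<forall>\<zeta>\<in>Ev. \<exists>c. (\<exists>i<n. c i \<noteq> 0) \<and> (\<forall>i<n. (\<Sum>j<n. H i j * c j) = \<zeta> * c i)"
    and "\<forall>\<zeta>. \<zeta> \<notin> Ev \<longrightarrow> (\<exists>G.
      (\<forall>i<n. \<forall>l<n. \<zeta> * G i l - (\<Sum>j<n. H i j * G j l) = (if i = l then 1 else 0)) \<and>
      (\<forall>i<n. \<forall>l<n. \<zeta> * G i l - (\<Sum>j<n. G i j * H j l) = (if i = l then 1 else 0)))"
proof -
  define A where "A = mat n n (\<lambda>(i, j). H i j)"
  have A: "A \<in> carrier_mat n n" by (simp add: A_def)
  define Ev where "Ev = {\<zeta>. eigenvalue A \<zeta>}"
  show thesis
  proof (rule that[of Ev]; (intro ballI allI impI)?)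
    have "char_poly A \<noteq> 0" using degree_monic_char_poly[OF A] by auto
    then show "finite Ev"
      unfolding Ev_def eigenvalue_root_char_poly[OF A] by (rule poly_roots_finite)
  next
    fix \<zeta> assume "\<zeta> \<in> Ev"
    then obtain v where "eigenvector A v \<zeta>" by (auto simp: Ev_def eigenvalue_def)
    then have v: "v \<in> carrier_vec n" "v \<noteq> 0\<^sub>v n" "A *\<^sub>v v = \<zeta> \<cdot>\<^sub>v v"
      using A by (auto simp: eigenvector_def)
    have nz: "\<exists>i<n. v $ i \<noteq> 0"
    proof (rule ccontr)
      assume "\<not> ?thesis"
      then have "v = 0\<^sub>v n" using v(1) by (intro eq_vecI) auto
      with v(2) show False by contradiction
    qed
    have "(\<Sum>j<n. H i j * v $ j) = \<zeta> * v $ i" if "i < n" for i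
    proof -
      have "(A *\<^sub>v v) $ i = (\<zeta> \<cdot>\<^sub>v v) $ i" using v(3) by simp
      then show ?thesis
        using that v(1) by (simp add: A_def scalar_prod_def atLeast0LessThan)
    qed
    with nz show "\<exists>c. (\<exists>i<n. c i \<noteq> 0) \<and> (\<forall>i<n. (\<Sum>j<n. H i j * c j) = \<zeta> * c i)"
      by (intro exI[of _ "\<lambda>i. v $ i"]) simp
  next
    fix \<zeta> assume "\<zeta> \<notin> Ev"
    then have "det (char_matrix A \<zeta>) \<noteq> 0"
      using eigenvalue_det[OF A] by (simp add: Ev_def)
    then have "char_matrix A \<zeta> \<in> Units (ring_mat TYPE(complex) n ())"
      using A by (intro det_non_zero_imp_unit) auto
    then obtain B where B: "B \<in> carrier_mat n n"
      "B * char_matrix A \<zeta> = 1\<^sub>m n" "char_matrix A \<zeta> * B = 1\<^sub>m n"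
      by (auto simp: Units_def ring_mat_simps)
    have C: "char_matrix A \<zeta> \<in> carrier_mat n n" using A by simp
    have Cij: "char_matrix A \<zeta> $$ (i, j) = H i j - (if i = j then \<zeta> else 0)"
      if "i < n" "j < n" for i j
      using that by (simp add: char_matrix_def A_def)
    define G where "G i j = - B $$ (i, j)" for i j
    have 1: "\<zeta> * G i l - (\<Sum>j<n. H i j * G j l) = (if i = l then 1 else 0)"
      if il: "i < n" "l < n" for i l
    proof -
      have "(if i = l then 1 else 0) = (char_matrix A \<zeta> * B) $$ (i, l)"
        using B(3) il by simp
      also have "\<dots> = (\<Sum>j<n. char_matrix A \<zeta> $$ (i, j) * B $$ (j, l))"
        using il B(1) C by (simp add: scalar_prod_def atLeast0LessThan)
      also have "\<dots> = (\<Sum>j<n. (if i = j then \<zeta> * G j l else 0) - H i j * G j l)"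
        by (rule sum.cong) (use il in \<open>auto simp: Cij G_def algebra_simps\<close>)
      also have "\<dots> = \<zeta> * G i l - (\<Sum>j<n. H i j * G j l)"
        using il by (simp add: sum_subtractf)
      finally show ?thesis by simp
    qed
    have 2: "\<zeta> * G i l - (\<Sum>j<n. G i j * H j l) = (if i = l then 1 else 0)"
      if il: "i < n" "l < n" for i l
    proof -
      have "(if i = l then 1 else 0) = (B * char_matrix A \<zeta>) $$ (i, l)"
        using B(2) il by simp
      also have "\<dots> = (\<Sum>j<n. B $$ (i, j) * char_matrix A \<zeta> $$ (j, l))"
        using il B(1) C by (simp add: scalar_prod_def atLeast0LessThan)
      also have "\<dots> = (\<Sum>j<n. (if j = l then \<zeta> * G i j else 0) - G i j * H j l)"
        by (rule sum.cong) (use il in \<open>auto simp: Cij G_def algebra_simps\<close>)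
      also have "\<dots> = \<zeta> * G i l - (\<Sum>j<n. G i j * H j l)"
        using il by (simp add: sum_subtractf)
      finally show ?thesis by simp
    qed
    show "\<exists>G.
      (\<forall>i<n. \<forall>l<n. \<zeta> * G i l - (\<Sum>j<n. H i j * G j l) = (if i = l then 1 else 0)) \<and>
      (\<forall>i<n. \<forall>l<n. \<zeta> * G i l - (\<Sum>j<n. G i j * H j l) = (if i = l then 1 else 0))"
      by (intro exI[of _ G] conjI allI impI 1 2)
  qed
qed

definition finite_rank :: "('e::real_normed_vector \<Rightarrow>\<^sub>L 'e) \<Rightarrow> bool" where
  "finite_rank T \<longleftrightarrow> (\<exists>(n::nat) (\<beta> :: nat \<Rightarrow> 'e \<Rightarrow>\<^sub>L real) a. \<forall>f. T f = (\<Sum>i<n. \<beta> i f *\<^sub>R a i))"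

lemma bounded_linear_cscale_apply: "bounded_linear (\<lambda>c. cscale c v)"
  by (rule bounded_linear_compose[OF blinfun.bounded_linear_left bounded_linear_cscale])

text \<open>
  Write the complexification of \<open>T\<close> as \<open>A b\<close>, where \<open>b\<close> collects the \<open>n\<close> coefficient functionals and \<open>A\<close>
  forms the combination of the \<open>n\<close> vectors.  With \<open>\<zeta> = 1 - z\<close>, inverting \<open>\<zeta> - A b\<close> reduces
  to inverting the matrix \<open>\<zeta> - H\<close>, \<open>H = b A\<close>: if \<open>G\<close> is its inverse, then \<open>\<zeta>\<^sup>-\<^sup>1 (1 + A G b)\<close> is the inverse of
  \<open>\<zeta> - A b\<close>, and \<open>A\<close> maps eigenvectors of \<open>H\<close> for \<open>\<zeta> \<noteq> 0\<close> to eigenvectors of \<open>A b\<close>.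
\<close>

lemma finite_rank_spectrum:
  fixes T :: "'e::real_normed_vector \<Rightarrow>\<^sub>L 'e"
  assumes "finite_rank T"
  shows "finite (op_spectrum (id_blinfun - T) - {1})"
    and "\<And>z. z \<in> op_spectrum (id_blinfun - T) \<Longrightarrow> z \<noteq> 1 \<Longrightarrow> op_eigenvalue (id_blinfun - T) z"
proof -
  let ?S = "id_blinfun - T"
  obtain n :: nat and \<beta> :: "nat \<Rightarrow> 'e \<Rightarrow>\<^sub>L real" and a where T: "\<And>f. T f = (\<Sum>i<n. \<beta> i f *\<^sub>R a i)"
    using assms unfolding finite_rank_def by blast
  define b where "b i v = complex_of_real (\<beta> i (fst v)) + \<i> * complex_of_real (\<beta> i (snd v))" for i v
  define A where "A c = (\<Sum>i<n. cscale (c i) (a i, 0))" for c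
  define H where "H i j = complex_of_real (\<beta> i (a j))" for i j
  have b_lin: "bounded_linear (b i)" for i
    unfolding b_def
    by (intro bounded_linear_add bounded_linear_const_mult
        bounded_linear_compose[OF bounded_linear_of_real]
        bounded_linear_compose[OF blinfun.bounded_linear_right]
        bounded_linear_fst bounded_linear_snd)
  have b_add: "b i (v + w) = b i v + b i w" for i v w
    by (rule bounded_linear.linear[OF b_lin, THEN linear_add])
  have b_diff: "b i (v - w) = b i v - b i w" for i v w
    by (rule bounded_linear.linear[OF b_lin, THEN linear_diff])
  have b_cscale: "b i (cscale \<zeta> v) = \<zeta> * b i v" for i \<zeta> v
    by (simp add: b_def blinfun.bilinear_simps complex_eq_iff)
  have b_A: "b i (A c) = (\<Sum>j<n. H i j * c j)" for i c
  proof -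
    have "b i (A c) = (\<Sum>j<n. b i (cscale (c j) (a j, 0)))"
      unfolding A_def by (rule bounded_linear.linear[OF b_lin, THEN linear_sum])
    then show ?thesis
      unfolding b_cscale by (simp add: b_def H_def blinfun.zero_right mult.commute)
  qed
  have A_scale: "A (\<lambda>i. \<zeta> * c i) = cscale \<zeta> (A c)" for \<zeta> c
    unfolding A_def blinfun.sum_right by (simp only: cscale_mult blinfun_apply_blinfun_compose)
  have A_cong: "(\<And>i. i < n \<Longrightarrow> c i = d i) \<Longrightarrow> A c = A d" for c d
    unfolding A_def by (rule sum.cong) auto
  have T_A: "complexify T v = A (\<lambda>i. b i v)" for v
    by (cases v) (simp add: A_def b_def T fst_sum snd_sum prod_eq_iff)
  have S_z: "(complexify ?S - cscale z) v = cscale (1 - z) v - A (\<lambda>i. b i v)" for z v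
    unfolding complexify_diff cscale_diff blinfun.diff_left T_A
    by (simp del: blinfun_apply_cscale blinfun_apply_complexify)
  obtain Ev where Ev: "finite Ev"
    "\<forall>\<zeta>\<in>Ev. \<exists>c. (\<exists>i<n. c i \<noteq> 0) \<and> (\<forall>i<n. (\<Sum>j<n. H i j * c j) = \<zeta> * c i)"
    "\<forall>\<zeta>. \<zeta> \<notin> Ev \<longrightarrow> (\<exists>G.
      (\<forall>i<n. \<forall>l<n. \<zeta> * G i l - (\<Sum>j<n. H i j * G j l) = (if i = l then 1 else 0)) \<and>
      (\<forall>i<n. \<forall>l<n. \<zeta> * G i l - (\<Sum>j<n. G i j * H j l) = (if i = l then 1 else 0)))"
    by (rule matrix_eigenvalue_alternative[of n H])
  have res: "z \<notin> op_spectrum ?S" if z: "z \<noteq> 1" "1 - z \<notin> Ev" for z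
  proof -
    define \<zeta> where "\<zeta> = 1 - z"
    have \<zeta>: "\<zeta> \<noteq> 0" "\<zeta> \<notin> Ev" using z by (auto simp: \<zeta>_def)
    from Ev(3)[THEN spec, THEN mp, OF \<zeta>(2)] obtain G where
      G': "\<forall>i<n. \<forall>l<n. \<zeta> * G i l - (\<Sum>j<n. H i j * G j l) = (if i = l then 1 else 0)"
        "\<forall>i<n. \<forall>l<n. \<zeta> * G i l - (\<Sum>j<n. G i j * H j l) = (if i = l then 1 else 0)"
      by (elim exE conjE)
    note G = G'(1)[rule_format] G'(2)[rule_format]
    define c where "c y i = (\<Sum>l<n. G i l * b l y)" for y i
    define R where "R y = cscale (1 / \<zeta>) (y + A (c y))" for y
    have "bounded_linear R"
      unfolding R_def A_def c_def
      by (intro bounded_linear_compose[OF blinfun.bounded_linear_right]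
          bounded_linear_add bounded_linear_ident bounded_linear_sum
          bounded_linear_compose[OF bounded_linear_cscale_apply]
          bounded_linear_const_mult b_lin)
    then have R: "blinfun_apply (Blinfun R) = R" by (rule bounded_linear_Blinfun_apply)
    have inv: "cscale (1 / \<zeta>) (cscale \<zeta> v) = v" "cscale \<zeta> (cscale (1 / \<zeta>) v) = v" for v :: "'e \<times> 'e"
      using cscale_inverse[OF \<zeta>(1), where 'a = 'e]
      by (simp_all only: inverse_ops_def blinfun_apply_id_blinfun id_apply
          flip: blinfun_apply_blinfun_compose)
    have "Blinfun R o\<^sub>L (complexify ?S - cscale z) = id_blinfun"
    proof (rule blinfun_eqI)
      fix v
      define y where "y = cscale \<zeta> v - A (\<lambda>i. b i v)"
      have "c y i = b i v" if i: "i < n" for i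
      proof -
        have "c y i = (\<Sum>l<n. G i l * (\<zeta> * b l v) - (\<Sum>j<n. G i l * (H l j * b j v)))"
          by (simp add: c_def y_def b_diff b_cscale b_A right_diff_distrib sum_distrib_left
              del: blinfun_apply_cscale)
        also have "\<dots> = (\<Sum>l<n. \<zeta> * G i l * b l v) - (\<Sum>l<n. \<Sum>j<n. G i l * H l j * b j v)"
          by (simp add: sum_subtractf mult_ac)
        also have "(\<Sum>l<n. \<Sum>j<n. G i l * H l j * b j v) = (\<Sum>j<n. (\<Sum>l<n. G i l * H l j) * b j v)"
          by (subst sum.swap) (simp add: sum_distrib_right)
        also have "(\<Sum>l<n. \<zeta> * G i l * b l v) - \<dots> =
            (\<Sum>l<n. (\<zeta> * G i l - (\<Sum>j<n. G i j * H j l)) * b l v)"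
          by (simp add: sum_subtractf left_diff_distrib)
        also have "\<dots> = (\<Sum>l<n. if i = l then b l v else 0)"
          by (rule sum.cong) (use G(2) i in auto)
        finally show ?thesis using i by simp
      qed
      then have "A (c y) = A (\<lambda>i. b i v)" by (rule A_cong)
      then have "R y = v"
        unfolding R_def by (simp add: y_def inv del: blinfun_apply_cscale)
      then show "(Blinfun R o\<^sub>L (complexify ?S - cscale z)) v = id_blinfun v"
        by (simp only: blinfun_apply_blinfun_compose S_z R y_def \<zeta>_def blinfun_apply_id_blinfun id_apply)
    qed
    moreover have "(complexify ?S - cscale z) o\<^sub>L Blinfun R = id_blinfun"
    proof (rule blinfun_eqI)
      fix y
      have "b i (R y) = c y i" if i: "i < n" for i
      proof -
        have "\<zeta> * c y i - (\<Sum>j<n. H i j * c y j) =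
            (\<Sum>l<n. \<zeta> * G i l * b l y) - (\<Sum>j<n. \<Sum>l<n. H i j * G j l * b l y)"
          by (simp add: c_def sum_distrib_left mult_ac)
        also have "(\<Sum>j<n. \<Sum>l<n. H i j * G j l * b l y) = (\<Sum>l<n. (\<Sum>j<n. H i j * G j l) * b l y)"
          by (subst sum.swap) (simp add: sum_distrib_right)
        also have "(\<Sum>l<n. \<zeta> * G i l * b l y) - \<dots> =
            (\<Sum>l<n. (\<zeta> * G i l - (\<Sum>j<n. H i j * G j l)) * b l y)"
          by (simp add: sum_subtractf left_diff_distrib)
        also have "\<dots> = (\<Sum>l<n. if i = l then b l y else 0)"
          by (rule sum.cong) (use G(1) i in auto)
        finally have "\<zeta> * c y i = b i y + (\<Sum>j<n. H i j * c y j)" using i by (simp add: algebra_simps)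
        then have "(1 / \<zeta>) * (b i y + (\<Sum>j<n. H i j * c y j)) = c y i"
          using \<zeta>(1) by (simp add: field_simps)
        then show ?thesis unfolding R_def b_cscale b_add b_A .
      qed
      then have "A (\<lambda>i. b i (R y)) = A (c y)" by (rule A_cong)
      moreover have "cscale \<zeta> (R y) = y + A (c y)"
        unfolding R_def by (rule inv)
      ultimately show "((complexify ?S - cscale z) o\<^sub>L Blinfun R) y = id_blinfun y"
        by (simp only: blinfun_apply_blinfun_compose S_z R \<zeta>_def[symmetric]
            blinfun_apply_id_blinfun id_apply add_diff_cancel_right')
    qed
    ultimately have "inverse_ops (complexify ?S - cscale z) (Blinfun R)"
      unfolding inverse_ops_def by (rule conjI)
    then show ?thesis by (rule not_in_spectrumI)
  qed
  have sub: "op_spectrum ?S - {1} \<subseteq> (\<lambda>\<zeta>. 1 - \<zeta>) ` Ev"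
  proof
    fix z assume "z \<in> op_spectrum ?S - {1}"
    then have "1 - z \<in> Ev" using res[of z] by blast
    then show "z \<in> (\<lambda>\<zeta>. 1 - \<zeta>) ` Ev" by (intro image_eqI[of _ _ "1 - z"]) auto
  qed
  then show "finite (op_spectrum ?S - {1})"
    by (rule finite_subset) (use Ev(1) in simp)
  fix z assume z: "z \<in> op_spectrum ?S" "z \<noteq> 1"
  then have "1 - z \<in> Ev" using res[of z] by blast
  from Ev(2)[THEN bspec, OF this] obtain c where
    "(\<exists>i<n. c i \<noteq> 0) \<and> (\<forall>i<n. (\<Sum>j<n. H i j * c j) = (1 - z) * c i)"
    by (rule exE)
  note c = conjunct1[OF this] conjunct2[OF this]
  have bA: "b i (A c) = (1 - z) * c i" if "i < n" for i
    using c(2) that by (simp only: b_A)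
  have "A c \<noteq> 0"
  proof
    assume "A c = 0"
    then have "(1 - z) * c i = 0" if "i < n" for i
      using bA[OF that] bounded_linear.linear[OF b_lin, THEN linear_0] by simp
    then show False using c(1) z(2) by auto
  qed
  moreover have "complexify ?S (A c) = cscale z (A c)"
  proof -
    have "A (\<lambda>i. b i (A c)) = cscale (1 - z) (A c)"
      unfolding A_scale[symmetric] by (rule A_cong) (rule bA)
    then have "(complexify ?S - cscale z) (A c) = 0"
      unfolding S_z by (simp del: blinfun_apply_cscale)
    then show ?thesis by (simp only: blinfun.diff_left right_minus_eq)
  qed
  ultimately show "op_eigenvalue ?S z"
    unfolding op_eigenvalue_def by blast
qed

section \<open>Resolvents of collectively compact approximations\<close>

text \<open>
  A left inverse excludes eigenvalues, and away from 1 the spectrum consists of eigenvalues.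
\<close>

lemma left_inverse_imp_resolvent:
  fixes T :: "'e::banach \<Rightarrow>\<^sub>L 'e"
  assumes "finite_rank T" "z \<noteq> 1"
    and L: "L o\<^sub>L (complexify (id_blinfun - T) - cscale z) = id_blinfun"
  shows "z \<notin> op_spectrum (id_blinfun - T)" "resolvent (id_blinfun - T) z = L"
proof -
  show z: "z \<notin> op_spectrum (id_blinfun - T)"
  proof
    assume "z \<in> op_spectrum (id_blinfun - T)"
    then have "op_eigenvalue (id_blinfun - T) z"
      using finite_rank_spectrum(2)[OF assms(1)] assms(2) by blast
    then obtain v where v: "v \<noteq> 0" "complexify (id_blinfun - T) v = cscale z v"
      unfolding op_eigenvalue_def by blast
    have "v = (L o\<^sub>L (complexify (id_blinfun - T) - cscale z)) v"
      unfolding L by simp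
    also have "\<dots> = L (complexify (id_blinfun - T) v - cscale z v)"
      by (simp only: blinfun_apply_blinfun_compose blinfun.diff_left)
    also have "\<dots> = 0" unfolding v(2) by (simp only: diff_self blinfun.zero_right)
    finally show False using v(1) by contradiction
  qed
  show "resolvent (id_blinfun - T) z = L"
    using inverse_ops_left_unique[OF resolvent_inverse[OF z] L] by (rule sym)
qed

text \<open>
  Collectively compact convergence reduced to what the spectral theory uses.  The difference \<open>T - Tn n\<close>
  need not tend to 0 in norm; it does so after composition with \<open>T\<close> or \<open>Tn n\<close>, which
  map into nearly compact sets.
\<close>

locale operator_approximation =
  fixes T :: "'e::banach \<Rightarrow>\<^sub>L 'e" and Tn :: "nat \<Rightarrow> 'e \<Rightarrow>\<^sub>L 'e" and C :: real
  assumes fin_rank: "\<forall>\<^sub>F n in sequentially. finite_rank (Tn n)"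
    and norm_bound: "\<forall>\<^sub>F n in sequentially. norm (Tn n) \<le> C"
    and lim_Tn: "(\<lambda>n. norm ((T - Tn n) o\<^sub>L Tn n)) \<longlonglongrightarrow> 0"
    and lim_T: "(\<lambda>n. norm ((T - Tn n) o\<^sub>L T)) \<longlonglongrightarrow> 0"
begin

abbreviation S where "S \<equiv> id_blinfun - T"
abbreviation Sn where "Sn n \<equiv> id_blinfun - Tn n"

lemma S_diff: "complexify (Sn n) - cscale z = (complexify S - cscale z) + complexify (T - Tn n)"
  by (simp add: complexify_diff)

text \<open>
  With \<open>\<zeta> = 1 - z\<close> and \<open>R\<close> the resolvent of the limit,
  \<open>(1 + R Tn) (\<zeta> - Tn) = \<zeta> + R (T - Tn) Tn\<close>, and the last term is small.  Hence
  \<open>\<zeta> - Tn\<close> has a left inverse, of a norm controlled by \<open>R\<close>, \<open>C\<close> and the distance of \<open>K\<close> from 1.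
\<close>

lemma resolvent_bound_away_from_1:
  assumes K: "compact K" "K \<inter> op_spectrum S = {}" "1 \<notin> K"
  obtains B where "\<forall>\<^sub>F n in sequentially.
    \<forall>z\<in>K. z \<notin> op_spectrum (Sn n) \<and> norm (resolvent (Sn n) z) \<le> B"
proof -
  obtain B0 where B0: "B0 > 0" "\<And>z. z \<in> K \<Longrightarrow> norm (resolvent S z) \<le> B0"
    using resolvent_bounded_on_compact[OF K(1,2)] by blast
  obtain d where d: "d > 0" "\<And>z. z \<in> K \<Longrightarrow> d \<le> dist 1 z"
    using separate_point_closed[OF compact_imp_closed[OF K(1)] K(3)] by blast
  define B where "B = 2 * (2 / d * (1 + B0 * C))"
  have "\<forall>\<^sub>F n in sequentially. norm ((T - Tn n) o\<^sub>L Tn n) < d / (4 * B0)"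
    using lim_Tn B0(1) d(1) by (auto dest: order_tendstoD(2)[where a = "d / (4 * B0)"])
  with fin_rank norm_bound
  have "\<forall>\<^sub>F n in sequentially.
    \<forall>z\<in>K. z \<notin> op_spectrum (Sn n) \<and> norm (resolvent (Sn n) z) \<le> B"
  proof eventually_elim
    case (elim n)
    show ?case
    proof
      fix z assume z: "z \<in> K"
      define \<zeta> where "\<zeta> = 1 - z"
      have \<zeta>: "d \<le> cmod \<zeta>" "\<zeta> \<noteq> 0" "z \<noteq> 1"
        using d(1) d(2)[OF z] by (auto simp: \<zeta>_def dist_norm)
      define D R Tc where "D = complexify S - cscale z" and "R = resolvent S z"
        and "Tc = complexify (Tn n)"
      define Dn where "Dn = complexify (Sn n) - cscale z"
      have z': "z \<notin> op_spectrum S" using K(2) z by blast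
      have RD: "R o\<^sub>L D = id_blinfun"
        using resolvent_inverse[OF z'] unfolding inverse_ops_def R_def D_def by (rule conjunct1)
      have Dn1: "Dn = D + complexify (T - Tn n)" unfolding Dn_def D_def by (rule S_diff)
      have Dn2: "Dn = cscale \<zeta> - Tc"
        unfolding Dn_def \<zeta>_def cscale_diff complexify_diff Tc_def by simp
      have comm: "Tc o\<^sub>L Dn = Dn o\<^sub>L Tc"
        unfolding Dn2 compose_distribs Tc_def complexify_cscale by (rule refl)
      define W where "W = complexify ((T - Tn n) o\<^sub>L Tn n)"
      have "(id_blinfun + (R o\<^sub>L Tc)) o\<^sub>L Dn = Dn + (R o\<^sub>L (Dn o\<^sub>L Tc))"
        by (simp only: compose_distribs compose_id compose_assoc comm)
      also have "R o\<^sub>L (Dn o\<^sub>L Tc) = Tc + (R o\<^sub>L W)"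
      proof -
        have "R o\<^sub>L (Dn o\<^sub>L Tc) = ((R o\<^sub>L D) o\<^sub>L Tc) + (R o\<^sub>L (complexify (T - Tn n) o\<^sub>L Tc))"
          unfolding Dn1 by (simp only: compose_distribs compose_assoc)
        then show ?thesis by (simp only: RD compose_id W_def Tc_def complexify_compose)
      qed
      also have "Dn + (Tc + (R o\<^sub>L W)) = cscale \<zeta> + (R o\<^sub>L W)"
        unfolding Dn2 by simp
      finally have approx: "(id_blinfun + (R o\<^sub>L Tc)) o\<^sub>L Dn = cscale \<zeta> + (R o\<^sub>L W)" .
      have c_inv: "cscale (1 / \<zeta>) o\<^sub>L cscale \<zeta> = (id_blinfun :: ('e \<times> 'e) \<Rightarrow>\<^sub>L _)"
        using cscale_inverse[OF \<zeta>(2)] unfolding inverse_ops_def by (rule conjunct1)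
      have c_norm: "norm (cscale (1 / \<zeta>) :: ('e \<times> 'e) \<Rightarrow>\<^sub>L _) \<le> 2 / d"
      proof -
        have "2 * cmod (1 / \<zeta>) \<le> 2 / d"
          using \<zeta>(1) d(1) by (simp add: norm_divide frac_le)
        then show ?thesis using norm_cscale_le[of "1 / \<zeta>"] by (rule order_trans[rotated])
      qed
      have R_norm: "norm R \<le> B0" using B0(2)[OF z] by (simp add: R_def)
      have Tc_norm: "norm Tc \<le> C"
        unfolding Tc_def using norm_complexify_le elim(2) by (rule order_trans)
      \<comment> \<open>The threshold \<open>d / (4 * B0)\<close> above is chosen to make this norm at most \<open>1/2\<close>.\<close>
      define Q where "Q = cscale (1 / \<zeta>) o\<^sub>L (R o\<^sub>L W)"
      have "norm Q \<le> norm (cscale (1 / \<zeta>) :: ('e \<times> 'e) \<Rightarrow>\<^sub>L _) * (norm R * norm W)"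
        unfolding Q_def
        by (intro order_trans[OF norm_blinfun_compose] mult_left_mono norm_blinfun_compose) simp
      also have "\<dots> \<le> (2 / d) * (B0 * (d / (4 * B0)))"
      proof (intro mult_mono c_norm R_norm)
        show "norm W \<le> d / (4 * B0)"
          unfolding W_def using norm_complexify_le less_imp_le[OF elim(3)] by (rule order_trans)
      qed (use d(1) B0(1) in auto)
      also have "\<dots> = 1 / 2" using d(1) B0(1) by simp
      finally have "norm (- Q) \<le> 1 / 2" by simp
      then obtain J where J: "inverse_ops (id_blinfun - (- Q)) J" "norm J \<le> 1 / (1 - 1 / 2)"
        by (rule neumann_series) auto
      define L where "L = J o\<^sub>L (cscale (1 / \<zeta>) o\<^sub>L (id_blinfun + (R o\<^sub>L Tc)))"
      have "L o\<^sub>L Dn = J o\<^sub>L (cscale (1 / \<zeta>) o\<^sub>L (cscale \<zeta> + (R o\<^sub>L W)))"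
        unfolding L_def approx[symmetric] by (simp only: compose_assoc)
      also have "\<dots> = J o\<^sub>L (id_blinfun - (- Q))"
        unfolding Q_def by (simp only: compose_distribs c_inv diff_minus_eq_add)
      finally have L: "L o\<^sub>L Dn = id_blinfun" using J(1) by (simp add: inverse_ops_def)
      note res = left_inverse_imp_resolvent[OF elim(1) \<zeta>(3) L[unfolded Dn_def]]
      have "norm L \<le> norm J * (norm (cscale (1 / \<zeta>) :: ('e \<times> 'e) \<Rightarrow>\<^sub>L _) *
          norm (id_blinfun + (R o\<^sub>L Tc)))"
        unfolding L_def
        by (intro order_trans[OF norm_blinfun_compose] mult_left_mono norm_blinfun_compose) simp
      also have "\<dots> \<le> 2 * (2 / d * (1 + B0 * C))"
      proof (intro mult_mono c_norm)
        have "norm (id_blinfun + (R o\<^sub>L Tc)) \<le> norm (id_blinfun :: ('e \<times> 'e) \<Rightarrow>\<^sub>L _) + norm (R o\<^sub>L Tc)"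
          by (rule norm_triangle_ineq)
        also have "\<dots> \<le> 1 + norm R * norm Tc"
          by (intro add_mono norm_blinfun_id_le norm_blinfun_compose)
        also have "\<dots> \<le> 1 + B0 * C"
          using R_norm Tc_norm B0(1) by (intro add_left_mono mult_mono) auto
        finally show "norm (id_blinfun + (R o\<^sub>L Tc)) \<le> 1 + B0 * C" .
      qed (use J(2) d(1) in auto)
      finally show "z \<notin> op_spectrum (Sn n) \<and> norm (resolvent (Sn n) z) \<le> B"
        using res by (simp add: B_def)
    qed
  qed
  then show thesis by (rule that)
qed

text \<open>
  At \<open>z = 1\<close> the operator \<open>S - z\<close> is \<open>-T\<close>.  So if 1 is a regular point then \<open>T\<close> is invertible,
  \<open>T - Tn = ((T - Tn) T) T\<^sup>-\<^sup>1\<close> tends to 0 in norm, and ordinary perturbation theory suffices.  (For the kernel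
  operators this is the case of an essentially finite space.)
\<close>

lemma resolvent_bound_invertible:
  assumes K: "compact K" "K \<inter> op_spectrum S = {}" and 1: "1 \<notin> op_spectrum S"
  obtains B where "\<forall>\<^sub>F n in sequentially.
    \<forall>z\<in>K. z \<notin> op_spectrum (Sn n) \<and> norm (resolvent (Sn n) z) \<le> B"
proof -
  obtain B0 where B0: "B0 > 0" "\<And>z. z \<in> K \<Longrightarrow> norm (resolvent S z) \<le> B0"
    using resolvent_bounded_on_compact[OF K] by blast
  define R1 where "R1 = resolvent S 1"
  have "complexify S - cscale 1 = - complexify T"
    by (simp add: complexify_diff)
  then have "(- complexify T) o\<^sub>L R1 = id_blinfun"
    using resolvent_inverse[OF 1] by (simp add: inverse_ops_def R1_def)
  then have T_R1: "complexify T o\<^sub>L R1 = - id_blinfun"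
    unfolding compose_distribs by (simp add: minus_equation_iff)
  have diff_le: "norm (complexify (T - Tn n)) \<le> norm ((T - Tn n) o\<^sub>L T) * norm R1" for n
  proof -
    have "complexify ((T - Tn n) o\<^sub>L T) o\<^sub>L R1 = complexify (T - Tn n) o\<^sub>L (complexify T o\<^sub>L R1)"
      by (simp only: complexify_compose compose_assoc)
    also have "\<dots> = - complexify (T - Tn n)"
      by (simp only: T_R1 compose_distribs(6) compose_id)
    finally have "complexify (T - Tn n) = - (complexify ((T - Tn n) o\<^sub>L T) o\<^sub>L R1)"
      by (simp only: minus_minus)
    then have "norm (complexify (T - Tn n)) \<le> norm (complexify ((T - Tn n) o\<^sub>L T)) * norm R1"
      using norm_blinfun_compose[of "complexify ((T - Tn n) o\<^sub>L T)" R1]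
      by (simp only: norm_minus_cancel)
    also have "\<dots> \<le> norm ((T - Tn n) o\<^sub>L T) * norm R1"
      by (intro mult_right_mono norm_complexify_le) simp
    finally show ?thesis .
  qed
  have "(\<lambda>n. B0 * (norm ((T - Tn n) o\<^sub>L T) * norm R1)) \<longlonglongrightarrow> B0 * (0 * norm R1)"
    by (intro tendsto_intros lim_T)
  then have "\<forall>\<^sub>F n in sequentially. B0 * (norm ((T - Tn n) o\<^sub>L T) * norm R1) < 1 / 2"
    by (rule order_tendstoD(2)) simp
  then have "\<forall>\<^sub>F n in sequentially.
    \<forall>z\<in>K. z \<notin> op_spectrum (Sn n) \<and> norm (resolvent (Sn n) z) \<le> 2 * B0"
  proof eventually_elim
    case (elim n)
    show ?case
    proof
      fix z assume z: "z \<in> K"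
      then have z': "z \<notin> op_spectrum S" using K(2) by blast
      have "norm (resolvent S z) * norm ((complexify (Sn n) - cscale z) - (complexify S - cscale z))
          = norm (resolvent S z) * norm (complexify (T - Tn n))"
        unfolding S_diff by (simp only: add_diff_cancel_left')
      also have "\<dots> \<le> B0 * (norm ((T - Tn n) o\<^sub>L T) * norm R1)"
        using B0 z by (intro mult_mono diff_le) auto
      also have "\<dots> \<le> 1 / 2" using elim by simp
      finally have le: "norm (resolvent S z) *
        norm ((complexify (Sn n) - cscale z) - (complexify S - cscale z)) \<le> 1 / 2" .
      obtain R' where R': "inverse_ops (complexify (Sn n) - cscale z) R'"
        "norm R' \<le> norm (resolvent S z) / (1 - 1 / 2)"
        using inverse_ops_perturb[OF resolvent_inverse[OF z'] le] by auto
      then show "z \<notin> op_spectrum (Sn n) \<and> norm (resolvent (Sn n) z) \<le> 2 * B0"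
        using not_in_spectrumI[OF R'(1)] B0(2)[OF z] by simp
    qed
  qed
  then show thesis by (rule that)
qed

lemma resolvent_bound:
  assumes K: "compact K" "K \<inter> op_spectrum S = {}"
  obtains B where "\<forall>\<^sub>F n in sequentially.
    \<forall>z\<in>K. z \<notin> op_spectrum (Sn n) \<and> norm (resolvent (Sn n) z) \<le> B"
  using resolvent_bound_invertible[OF K] resolvent_bound_away_from_1[OF K] K(2) by blast

text \<open>
  All the spectra lie in one large disc, so what has to be cleared is the compact set of points of the
  disc that belong to the closure of \<open>V\<close> but not to the small ball around \<open>lam\<close>.  The condition
  on the frontier makes this set disjoint from the limit spectrum.
\<close>

lemma spectrum_localized:
  assumes V: "V \<inter> op_spectrum S = {lam}" "frontier V \<inter> op_spectrum S = {}" and r: "0 < r"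
  shows "\<forall>\<^sub>F n in sequentially. V \<inter> op_spectrum (Sn n) \<subseteq> ball lam r"
proof -
  define K where "K = (closure V \<inter> cball 0 (2 * (1 + C))) - ball lam r"
  have "compact K" unfolding K_def
    by (intro compact_diff closed_Int_compact) auto
  moreover have "K \<inter> op_spectrum S = {}"
  proof -
    have "closure V \<inter> op_spectrum S \<subseteq> {lam}"
      using V closure_Un_frontier[of V] by blast
    then show ?thesis using r unfolding K_def by auto
  qed
  ultimately obtain B where B: "\<forall>\<^sub>F n in sequentially.
      \<forall>z\<in>K. z \<notin> op_spectrum (Sn n) \<and> norm (resolvent (Sn n) z) \<le> B"
    by (rule resolvent_bound)
  from B norm_bound show ?thesis
  proof eventually_elim
    case (elim n)
    show ?case
    proof
      fix z assume z: "z \<in> V \<inter> op_spectrum (Sn n)"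
      have "norm (Sn n) \<le> norm (id_blinfun :: 'e \<Rightarrow>\<^sub>L 'e) + norm (Tn n)"
        by (rule norm_triangle_ineq4)
      also have "\<dots> \<le> 1 + C" by (intro add_mono norm_blinfun_id_le elim(2))
      finally have "cmod z \<le> 2 * (1 + C)"
        using spectrum_bound[of z "Sn n"] z by auto
      moreover have "z \<in> closure V" using z closure_subset by blast
      moreover have "z \<notin> K" using elim(1) z by blast
      ultimately show "z \<in> ball lam r" unfolding K_def by auto
    qed
  qed
qed

text \<open>
  \<open>R\<^sub>n v - R v = - R\<^sub>n (T - Tn) R v\<close>.  The vector \<open>R v\<close> moves with \<open>z\<close>, so convergence of \<open>Tn\<close> at \<open>v\<close> alone does
  not seem enough; but \<open>\<zeta> R v = v + T R v\<close> splits it into a multiple of \<open>v\<close> and a vector in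
  the range of \<open>T\<close>, where the convergence is uniform.
\<close>

lemma resolvent_converges_pointwise:
  assumes K: "compact K" "K \<inter> op_spectrum S = {}" "1 \<notin> K"
    and v: "(\<lambda>n. complexify (T - Tn n) v) \<longlonglongrightarrow> 0" and \<epsilon>: "0 < \<epsilon>"
  shows "\<forall>\<^sub>F n in sequentially. \<forall>z\<in>K. z \<notin> op_spectrum (Sn n) \<and>
    norm (resolvent (Sn n) z v - resolvent S z v) \<le> \<epsilon>"
proof -
  obtain B0 where B0: "B0 > 0" "\<And>z. z \<in> K \<Longrightarrow> norm (resolvent S z) \<le> B0"
    using resolvent_bounded_on_compact[OF K(1,2)] by blast
  obtain d where d: "d > 0" "\<And>z. z \<in> K \<Longrightarrow> d \<le> dist 1 z"
    using separate_point_closed[OF compact_imp_closed[OF K(1)] K(3)] by blast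
  obtain B where B: "\<forall>\<^sub>F n in sequentially.
      \<forall>z\<in>K. z \<notin> op_spectrum (Sn n) \<and> norm (resolvent (Sn n) z) \<le> B"
    using resolvent_bound[OF K(1,2)] by blast
  define e where "e n = \<bar>B\<bar> * ((2 / d) * (norm (complexify (T - Tn n) v) +
    norm ((T - Tn n) o\<^sub>L T) * (B0 * norm v)))" for n
  have "e \<longlonglongrightarrow> \<bar>B\<bar> * ((2 / d) * (norm (0 :: 'e \<times> 'e) + 0 * (B0 * norm v)))"
    unfolding e_def by (intro tendsto_intros v lim_T)
  then have "\<forall>\<^sub>F n in sequentially. e n < \<epsilon>"
    using \<epsilon> by (intro order_tendstoD(2)) auto
  with B show ?thesis
  proof eventually_elim
    case (elim n)
    show ?case
    proof
      fix z assume z: "z \<in> K"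
      then have z': "z \<notin> op_spectrum S" "z \<notin> op_spectrum (Sn n)" using K(2) elim(1) by auto
      define \<zeta> where "\<zeta> = 1 - z"
      have \<zeta>: "d \<le> cmod \<zeta>" "\<zeta> \<noteq> 0"
        using d(1) d(2)[OF z] by (auto simp: \<zeta>_def dist_norm)
      define u where "u = resolvent S z v"
      define W where "W = complexify (T - Tn n)"
      have u: "complexify S u - cscale z u = v"
        unfolding u_def by (rule resolvent_apply(2)[OF z'(1)])
      have "complexify S u - cscale z u = cscale \<zeta> u - complexify T u"
        unfolding \<zeta>_def cscale_diff complexify_diff blinfun.diff_left by simp
      then have "cscale \<zeta> u = v + complexify T u" unfolding u by (simp only: eq_diff_eq)
      moreover have "cscale (1 / \<zeta>) (cscale \<zeta> u) = u"
        using cscale_inverse[OF \<zeta>(2), where 'a = 'e]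
        by (simp only: inverse_ops_def blinfun_apply_id_blinfun id_apply
            flip: blinfun_apply_blinfun_compose)
      ultimately have u_eq: "u = cscale (1 / \<zeta>) (v + complexify T u)" by simp
      have "W o\<^sub>L cscale (1 / \<zeta>) = cscale (1 / \<zeta>) o\<^sub>L W"
        unfolding W_def by (rule complexify_cscale)
      then have "W (cscale (1 / \<zeta>) w) = cscale (1 / \<zeta>) (W w)" for w
        by (simp only: flip: blinfun_apply_blinfun_compose)
      then have Wu: "W u = cscale (1 / \<zeta>) (W v + complexify ((T - Tn n) o\<^sub>L T) u)"
        using arg_cong[OF u_eq, of "blinfun_apply W"]
        by (simp only: blinfun.add_right complexify_compose blinfun_apply_blinfun_compose W_def)
      have "norm (W u) \<le> norm (cscale (1 / \<zeta>) :: ('e \<times> 'e) \<Rightarrow>\<^sub>L _) *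
          norm (W v + complexify ((T - Tn n) o\<^sub>L T) u)"
        unfolding Wu by (rule norm_blinfun)
      also have "\<dots> \<le> (2 / d) * (norm (W v) + norm ((T - Tn n) o\<^sub>L T) * (B0 * norm v))"
      proof (rule mult_mono)
        have "2 * cmod (1 / \<zeta>) \<le> 2 / d"
          using \<zeta>(1) d(1) by (simp add: norm_divide frac_le)
        then show "norm (cscale (1 / \<zeta>) :: ('e \<times> 'e) \<Rightarrow>\<^sub>L _) \<le> 2 / d"
          using norm_cscale_le[of "1 / \<zeta>"] by (rule order_trans[rotated])
        have "norm u \<le> norm (resolvent S z) * norm v" unfolding u_def by (rule norm_blinfun)
        also have "\<dots> \<le> B0 * norm v" using B0(2)[OF z] by (intro mult_right_mono) auto
        finally have "norm u \<le> B0 * norm v" .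
        then have "norm (complexify ((T - Tn n) o\<^sub>L T) u) \<le> norm ((T - Tn n) o\<^sub>L T) * (B0 * norm v)"
          using norm_complexify_le
          by (intro order_trans[OF norm_blinfun] mult_mono) auto
        then show "norm (W v + complexify ((T - Tn n) o\<^sub>L T) u) \<le>
            norm (W v) + norm ((T - Tn n) o\<^sub>L T) * (B0 * norm v)"
          by (intro order_trans[OF norm_triangle_ineq] add_left_mono)
      qed (use d(1) in auto)
      finally have Wu_le: "norm (W u) \<le> \<dots>" .
      have "complexify (Sn n) u - cscale z u = v + W u"
      proof -
        have "complexify (Sn n) u - cscale z u = (complexify (Sn n) - cscale z) u"
          by (simp only: blinfun.diff_left)
        also have "\<dots> = (complexify S u - cscale z u) + W u"
          unfolding S_diff W_def by (simp only: blinfun.diff_left blinfun.add_left)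
        finally show ?thesis unfolding u .
      qed
      then have "resolvent (Sn n) z (v + W u) = u"
        using resolvent_apply(1)[OF z'(2), of u] by simp
      then have "resolvent (Sn n) z v - u = - resolvent (Sn n) z (W u)"
        by (simp add: blinfun.add_right algebra_simps)
      then have "norm (resolvent (Sn n) z v - u) \<le> norm (resolvent (Sn n) z) * norm (W u)"
        using norm_blinfun[of "resolvent (Sn n) z" "W u"] by (simp only: norm_minus_cancel)
      also have "\<dots> \<le> e n"
        unfolding e_def W_def[symmetric] using elim(1) z Wu_le by (intro mult_mono) force+
      also have "\<dots> \<le> \<epsilon>" using elim(2) by simp
      finally show "z \<notin> op_spectrum (Sn n) \<and> norm (resolvent (Sn n) z v - resolvent S z v) \<le> \<epsilon>"
        using z'(2) by (simp add: u_def)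
    qed
  qed
qed

end

section \<open>Spectral projections on the space of bounded measurable functions\<close>

text \<open>
  Evaluation at a point, extended to a complex-linear functional on the complexification.  These
  functionals separate points and determine the norm up to a factor 2, so scalar complex analysis can be applied to
  the resolvent through them.
\<close>

definition ceval :: "'a::topological_space \<Rightarrow> 'a bmfun \<times> 'a bmfun \<Rightarrow> complex" where
  "ceval x v = Complex (apply_bmfun (fst v) x) (apply_bmfun (snd v) x)"

lemma cmod_ceval_le: "cmod (ceval x v) \<le> norm v"
proof -
  have "sqrt (\<bar>apply_bmfun (fst v) x\<bar>\<^sup>2 + \<bar>apply_bmfun (snd v) x\<bar>\<^sup>2)
      \<le> sqrt ((norm (fst v))\<^sup>2 + (norm (snd v))\<^sup>2)"
    by (intro real_sqrt_le_mono add_mono power_mono abs_apply_bmfun_le_norm) auto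
  then show ?thesis by (simp add: ceval_def cmod_def norm_prod_def)
qed

lemma bounded_linear_ceval: "bounded_linear (ceval x)"
  by (rule bounded_linear_intro[where K = 1])
    (use cmod_ceval_le in \<open>auto simp: ceval_def bmfun_rep_eqs complex_eq_iff\<close>)

lemma ceval_cscale: "ceval x (cscale z v) = z * ceval x v"
  by (simp add: ceval_def bmfun_rep_eqs complex_eq_iff)

lemma ceval_eqI: "(\<And>x. ceval x v = ceval x w) \<Longrightarrow> v = w"
  by (auto simp: ceval_def prod_eq_iff intro!: bmfun_eqI)

lemma norm_le_ceval:
  assumes "\<And>x. cmod (ceval x v) \<le> B"
  shows "norm v \<le> 2 * B"
proof -
  have "\<bar>apply_bmfun (fst v) x\<bar> \<le> B" "\<bar>apply_bmfun (snd v) x\<bar> \<le> B" for x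
    using abs_Re_le_cmod[of "ceval x v"] abs_Im_le_cmod[of "ceval x v"] assms[of x]
    by (auto simp: ceval_def)
  then have "norm (fst v) \<le> B" "norm (snd v) \<le> B"
    by (auto intro: norm_bmfun_le)
  then show ?thesis using norm_Pair_le[of "fst v" "snd v"] by simp
qed

text \<open>
  A local primitive of the resolvent becomes a holomorphic function whose derivative is the given one.
\<close>

lemma resolvent_holomorphic:
  fixes S :: "'a::topological_space bmfun \<Rightarrow>\<^sub>L 'a bmfun"
  shows "(\<lambda>z. ceval x (resolvent S z v)) holomorphic_on (- op_spectrum S)"
proof (rule analytic_imp_holomorphic)
  let ?f = "\<lambda>z. ceval x (resolvent S z v)"
  show "?f analytic_on (- op_spectrum S)"
    unfolding analytic_on_def
  proof
    fix z0 assume "z0 \<in> - op_spectrum S"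
    then have z0: "z0 \<notin> op_spectrum S" by simp
    obtain e G where e: "e > 0" "ball z0 e \<subseteq> - op_spectrum S"
      and G: "\<And>z. z \<in> ball z0 e \<Longrightarrow> (G has_derivative (\<lambda>h. cscale h o\<^sub>L resolvent S z)) (at z)"
      using resolvent_local_primitive[OF z0] by metis
    define F where "F z = ceval x (G z v)" for z
    have F: "(F has_field_derivative ?f z) (at z)" if "z \<in> ball z0 e" for z
    proof -
      have "(F has_derivative (\<lambda>h. ceval x ((cscale h o\<^sub>L resolvent S z) v))) (at z)"
        unfolding F_def
        by (rule bounded_linear.has_derivative[OF bounded_linear_ceval])
          (rule bounded_linear.has_derivative[OF blinfun.bounded_linear_left G[OF that]])
      then show ?thesis
        unfolding has_field_derivative_def
        by (simp only: blinfun_apply_blinfun_compose ceval_cscale mult.commute[of _ "?f z"])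
    qed
    then have "F holomorphic_on ball z0 e"
      by (intro holomorphic_onI) (auto simp: field_differentiable_def intro: has_field_derivative_at_within)
    then have "deriv F holomorphic_on ball z0 e" by (intro holomorphic_deriv) auto
    then have "?f holomorphic_on ball z0 e"
      by (rule holomorphic_transform) (use F DERIV_imp_deriv in blast)
    with e(1) show "\<exists>e>0. ?f holomorphic_on ball z0 e" by blast
  qed
qed

lemma ceval_op_contour_integral:
  fixes S :: "'a::topological_space bmfun \<Rightarrow>\<^sub>L 'a bmfun"
  assumes "valid_path g" "path_image g \<inter> op_spectrum S = {}"
  shows "((\<lambda>z. ceval x (resolvent S z v)) has_contour_integral
    ceval x (op_contour_integral g (resolvent S) v)) g"
proof -
  let ?F = "\<lambda>t. cscale (vector_derivative g (at t within {0..1})) o\<^sub>L resolvent S (g t)"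
  have "(?F has_integral op_contour_integral g (resolvent S)) {0..1}"
    unfolding op_contour_integral_def
    by (rule integrable_integral[OF resolvent_contour_integrable[OF assms]])
  from has_integral_linear[OF has_integral_linear[OF this blinfun.bounded_linear_left[of v]]
      bounded_linear_ceval[of x]]
  show ?thesis
    unfolding has_contour_integral_def
    by (simp only: o_def blinfun_apply_blinfun_compose ceval_cscale mult.commute)
qed

text \<open>
  The right-hand side does not mention the curve, and this is the point of the lemma.
\<close>

lemma op_contour_integral_residues:
  fixes S :: "'a::topological_space bmfun \<Rightarrow>\<^sub>L 'a bmfun"
  assumes g: "pos_simple_closed_curve g" "path_image g \<inter> op_spectrum S = {}"
    and ins: "inside (path_image g) \<inter> op_spectrum S = W" and fin: "finite W"
  shows "ceval x (op_contour_integral g (resolvent S) v) =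
    of_real (2 * pi) * \<i> * (\<Sum>p\<in>W. residue (\<lambda>z. ceval x (resolvent S z v)) p)"
proof -
  have g': "valid_path g" "simple_path g" "pathfinish g = pathstart g"
    "\<And>z. z \<in> inside (path_image g) \<Longrightarrow> winding_number g z = 1"
    using g(1) by (auto simp: pos_simple_closed_curve_def)
  note J = Jordan_inside_outside[OF g'(2,3)]
  let ?f = "\<lambda>z. ceval x (resolvent S z v)"
  define \<Omega> where "\<Omega> = - op_spectrum S \<union> inside (path_image g)"
  have \<Omega>: "open \<Omega>" unfolding \<Omega>_def using J by (intro open_Un open_resolvent_set) blast
  \<comment> \<open>The residue theorem wants a connected domain.  The union of the inside of the curve and the
    resolvent set may be disconnected, so take its component containing the curve.  It contains the inside as
    well, because by the Jordan curve theorem the closure of the inside is connected and includes the curve.\<close>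
  define U where "U = connected_component_set \<Omega> (pathstart g)"
  have cl: "closure (inside (path_image g)) = inside (path_image g) \<union> path_image g"
    using J closure_Un_frontier by metis
  have "connected (closure (inside (path_image g)))" using J by (intro connected_imp_connected_closure) blast
  moreover have "closure (inside (path_image g)) \<subseteq> \<Omega>"
    unfolding cl \<Omega>_def using g(2) by blast
  moreover have "pathstart g \<in> closure (inside (path_image g))"
    unfolding cl by (simp add: pathstart_in_path_image)
  ultimately have sub: "inside (path_image g) \<union> path_image g \<subseteq> U"
    unfolding U_def cl[symmetric] by (intro connected_component_maximal)
  have "contour_integral g ?f = of_real (2 * pi) * \<i> * (\<Sum>p\<in>W. winding_number g p * residue ?f p)"
  proof (rule Residue_theorem[where S = U])
    show "open U" unfolding U_def by (rule open_connected_component[OF \<Omega>])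
    show "connected U" unfolding U_def by (rule connected_connected_component)
    have "U \<subseteq> \<Omega>" unfolding U_def by (rule connected_component_subset)
    then have "U - W \<subseteq> - op_spectrum S" using ins unfolding \<Omega>_def by blast
    then show "?f holomorphic_on U - W" by (rule holomorphic_on_subset[OF resolvent_holomorphic])
    show "path_image g \<subseteq> U - W" using sub g(2) ins by blast
    show "\<forall>z. z \<notin> U \<longrightarrow> winding_number g z = 0"
    proof (intro allI impI)
      fix z assume "z \<notin> U"
      then have "z \<in> outside (path_image g)" using sub union_with_inside[of "path_image g"] by blast
      then show "winding_number g z = 0"
        using g' by (intro winding_number_zero_in_outside valid_path_imp_path) auto
    qed
  qed (use g' fin in auto)
  also have "(\<Sum>p\<in>W. winding_number g p * residue ?f p) = (\<Sum>p\<in>W. residue ?f p)"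
    using g'(4) ins by (intro sum.cong) auto
  finally show ?thesis
    using contour_integral_unique[OF ceval_op_contour_integral[OF g'(1) g(2), of x v]] by simp
qed

text \<open>
  Two admissible curves enclose the same points of the spectrum, hence give the same residues
  after every evaluation.  This is what makes the definite description meaningful.
\<close>

lemma spectral_projection_eq:
  fixes S :: "'a::topological_space bmfun \<Rightarrow>\<^sub>L 'a bmfun"
  assumes P: "is_spectral_projection S W P" and fin: "finite (W \<inter> op_spectrum S)"
  shows "spectral_projection S W = P"
  unfolding spectral_projection_def
proof (rule the_equality)
  show "is_spectral_projection S W P" by (rule P)
  fix P' assume P': "is_spectral_projection S W P'"
  obtain g where g: "pos_simple_closed_curve g" "path_image g \<inter> op_spectrum S = {}"
    "inside (path_image g) \<inter> op_spectrum S = W \<inter> op_spectrum S"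
    "P = cscale (- 1 / (2 * complex_of_real pi * \<i>)) o\<^sub>L op_contour_integral g (resolvent S)"
    using P unfolding is_spectral_projection_def by (elim exE conjE)
  obtain g' where g': "pos_simple_closed_curve g'" "path_image g' \<inter> op_spectrum S = {}"
    "inside (path_image g') \<inter> op_spectrum S = W \<inter> op_spectrum S"
    "P' = cscale (- 1 / (2 * complex_of_real pi * \<i>)) o\<^sub>L op_contour_integral g' (resolvent S)"
    using P' unfolding is_spectral_projection_def by (elim exE conjE)
  have "op_contour_integral g (resolvent S) = op_contour_integral g' (resolvent S)"
  proof (intro blinfun_eqI ceval_eqI)
    fix v x
    show "ceval x (op_contour_integral g (resolvent S) v) =
        ceval x (op_contour_integral g' (resolvent S) v)"
      unfolding op_contour_integral_residues[OF g(1-3) fin] op_contour_integral_residues[OF g'(1-3) fin]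
      by (rule refl)
  qed
  then show "P' = P" unfolding g(4) g'(4) by (rule arg_cong[OF sym])
qed

lemma spectral_projection_circle:
  fixes S :: "'a::topological_space bmfun \<Rightarrow>\<^sub>L 'a bmfun"
  assumes r: "0 < r" and sph: "sphere lam r \<inter> op_spectrum S = {}"
    and bl: "ball lam r \<inter> op_spectrum S = W \<inter> op_spectrum S" and fin: "finite (W \<inter> op_spectrum S)"
  shows "spectral_projection S W = cscale (- 1 / (2 * complex_of_real pi * \<i>)) o\<^sub>L
    op_contour_integral (circlepath lam r) (resolvent S)"
proof (rule spectral_projection_eq[OF _ fin])
  have ins: "inside (path_image (circlepath lam r)) = ball lam r"
    using inside_frontier_eq_interior[of "ball lam r"] r by (simp add: frontier_ball)
  have "pos_simple_closed_curve (circlepath lam r)"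
    unfolding pos_simple_closed_curve_def ins using r
    by (auto simp: simple_path_circlepath dist_norm norm_minus_commute intro!: winding_number_circlepath)
  then show "is_spectral_projection S W (cscale (- 1 / (2 * complex_of_real pi * \<i>)) o\<^sub>L
      op_contour_integral (circlepath lam r) (resolvent S))"
    unfolding is_spectral_projection_def using sph bl ins r
    by (intro exI[of _ "circlepath lam r"]) simp
qed

text \<open>
  The circle has length \<open>2 * pi * r\<close>; the remaining factor 2 comes from \<open>norm_cscale_le\<close>.
\<close>

lemma spectral_projection_circle_diff:
  fixes S S' :: "'a::topological_space bmfun \<Rightarrow>\<^sub>L 'a bmfun"
  assumes r: "0 < r" and S: "sphere lam r \<inter> op_spectrum S = {}" 
    and S': "sphere lam r \<inter> op_spectrum S' = {}"
    and \<epsilon>: "\<And>z. z \<in> sphere lam r \<Longrightarrow> norm (resolvent S z v - resolvent S' z v) \<le> \<epsilon>"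
  shows "norm (op_contour_integral (circlepath lam r) (resolvent S) v -
    op_contour_integral (circlepath lam r) (resolvent S') v) \<le> 4 * pi * r * \<epsilon>"
proof -
  let ?g = "circlepath lam r"
  let ?F = "\<lambda>S t. cscale (vector_derivative ?g (at t within {0..1})) o\<^sub>L resolvent S (?g t)"
  have img: "path_image ?g = sphere lam r" using r by simp
  have int: "((\<lambda>t. ?F S t v) has_integral op_contour_integral ?g (resolvent S) v) {0..1}"
    if "sphere lam r \<inter> op_spectrum S = {}" for S :: "'a bmfun \<Rightarrow>\<^sub>L 'a bmfun"
  proof -
    have "(?F S has_integral op_contour_integral ?g (resolvent S)) {0..1}"
      unfolding op_contour_integral_def
      by (rule integrable_integral[OF resolvent_contour_integrable]) (use that img in auto)
    from has_integral_linear[OF this blinfun.bounded_linear_left[of v]] show ?thesis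
      by (simp only: o_def)
  qed
  have "lam + r \<in> sphere lam r" using r by (simp add: dist_norm)
  then have \<epsilon>0: "0 \<le> \<epsilon>" using \<epsilon>[of "lam + r"] norm_ge_zero order_trans by blast
  have "norm (op_contour_integral ?g (resolvent S) v - op_contour_integral ?g (resolvent S') v)
      \<le> 4 * pi * r * \<epsilon> * measure lborel {0..1::real}"
  proof (rule has_integral_bound_real[where S = "{}"])
    show "((\<lambda>t. ?F S t v - ?F S' t v) has_integral (op_contour_integral ?g (resolvent S) v -
        op_contour_integral ?g (resolvent S') v)) {0..1}"
      by (rule has_integral_diff[OF int[OF S] int[OF S']])
    show "0 \<le> 4 * pi * r * \<epsilon>" using r \<epsilon>0 by simp
    fix t :: real assume "t \<in> {0..1} - {}"
    then have t: "0 \<le> t" "t \<le> 1" by auto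
    let ?d = "vector_derivative ?g (at t within {0..1})"
    have "?g t \<in> path_image ?g" using t by (simp add: path_image_def)
    then have gt: "?g t \<in> sphere lam r" by (simp only: img)
    have "cmod ?d = 2 * pi * r"
      using t r by (simp add: vector_derivative_circlepath01 norm_mult norm_exp_eq_Re)
    then have d: "norm (cscale ?d :: ('a bmfun \<times> 'a bmfun) \<Rightarrow>\<^sub>L _) \<le> 2 * (2 * pi * r)"
      using norm_cscale_le[of ?d] by metis
    have "?F S t v - ?F S' t v = cscale ?d (resolvent S (?g t) v - resolvent S' (?g t) v)"
      by (simp only: blinfun_apply_blinfun_compose blinfun.diff_right)
    then have "norm (?F S t v - ?F S' t v) \<le>
        norm (cscale ?d :: ('a bmfun \<times> 'a bmfun) \<Rightarrow>\<^sub>L _) * norm (resolvent S (?g t) v - resolvent S' (?g t) v)"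
      by (simp only: norm_blinfun)
    also have "\<dots> \<le> 2 * (2 * pi * r) * \<epsilon>"
      using d \<epsilon>[OF gt] r by (intro mult_mono) auto
    finally show "norm (?F S t v - ?F S' t v) \<le> 4 * pi * r * \<epsilon>" by simp
  qed auto
  then show ?thesis by simp
qed

section \<open>The strong law of large numbers for bounded observables\<close>

text \<open>
  For bounded observables the Hoeffding inequality gives geometrically decreasing tail
  probabilities, and the Borel--Cantelli lemma turns them into almost sure convergence.
\<close>

lemma strong_law_bounded:
  fixes X :: "nat \<Rightarrow> 'w \<Rightarrow> 'a::topological_space" and g :: "'a \<Rightarrow> real"
  assumes P: "prob_space P"
    and indep: "prob_space.indep_vars P (\<lambda>_. borel) X {1..}"
    and law: "\<And>i. 1 \<le> i \<Longrightarrow> distr P borel (X i) = \<mu>"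
    and g: "g \<in> borel_measurable borel" and bound: "\<And>x. \<bar>g x\<bar> \<le> B"
  shows "AE w in P. (\<lambda>n. (\<Sum>i=1..n. g (X i w)) / real n) \<longlonglongrightarrow> (\<integral>x. g x \<partial>\<mu>)"
proof -
  interpret prob_space P by (rule P)
  have X: "X i \<in> P \<rightarrow>\<^sub>M borel" if "1 \<le> i" for i
    using indep that by (auto simp: indep_vars_def)
  have gX: "(\<lambda>w. g (X i w)) \<in> borel_measurable P" if "1 \<le> i" for i
    by (rule measurable_compose[OF X[OF that] g])
  have mean: "expectation (\<lambda>w. g (X 1 w)) = (\<integral>x. g x \<partial>\<mu>)"
    unfolding law[OF order_refl, symmetric] by (rule integral_distr[OF X g, symmetric]) simp
  define m where "m = (\<integral>x. g x \<partial>\<mu>)"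
  define S where "S n w = (\<Sum>i=1..n. g (X i w)) / real n" for n w
  have S_meas: "S n \<in> borel_measurable P" for n
    unfolding S_def by (intro borel_measurable_divide borel_measurable_sum gX) auto
  \<comment> \<open>The interval is widened by 1 to be nondegenerate even if \<open>B = 0\<close>.\<close>
  define a b where "a = - \<bar>B\<bar> - 1" and "b = \<bar>B\<bar> + 1"
  have ab: "a < b" by (simp add: a_def b_def)
  have gab: "g x \<in> {a..b}" for x using bound[of x] by (auto simp: a_def b_def)
  have tail: "prob {w \<in> space P. \<bar>S n w - m\<bar> \<ge> \<epsilon>} \<le> 2 * exp (-2 * real n * \<epsilon>\<^sup>2 / (b - a)\<^sup>2)"
    if \<epsilon>: "0 \<le> \<epsilon>" and n: "1 \<le> n" for \<epsilon> n
  proof -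
    have iid: "iid_interval_bounded_random_variables P {1..n} (\<lambda>i w. g (X i w)) (\<lambda>w. g (X 1 w)) a b"
    proof
      show "indep_vars (\<lambda>_. borel) (\<lambda>i w. g (X i w)) {1..n}"
        by (rule indep_vars_subset[OF indep_vars_compose2[OF indep g]]) auto
      show "distr P borel (\<lambda>w. g (X i w)) = distr P borel (\<lambda>w. g (X 1 w))" if "i \<in> {1..n}" for i
      proof -
        have "distr P borel (\<lambda>w. g (X j w)) = distr \<mu> borel g" if "1 \<le> j" for j
          unfolding law[OF that, symmetric] distr_distr[OF g X[OF that]] by (simp add: comp_def)
        then show ?thesis using that by simp
      qed
      show "AE w in P. g (X 1 w) \<in> {a..b}" using gab by auto
    qed (use gX in auto)
    interpret H: Hoeffding_ineq_iid P "{1..n}" "\<lambda>i w. g (X i w)" "\<lambda>w. g (X 1 w)" a b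
        "expectation (\<lambda>w. g (X 1 w))"
      using iid by (simp add: Hoeffding_ineq_iid_def)
    show ?thesis
      using H.Hoeffding_ineq_abs_ge'[OF \<epsilon> ab] n by (simp only: mean S_def m_def) simp
  qed
  have ev: "AE w in P. \<forall>\<^sub>F n in sequentially. \<bar>S n w - m\<bar> < \<epsilon>" if \<epsilon>: "0 < \<epsilon>" for \<epsilon>
  proof -
    define A where "A n = {w \<in> space P. \<bar>S n w - m\<bar> \<ge> \<epsilon>}" for n
    define q where "q = exp (-2 * \<epsilon>\<^sup>2 / (b - a)\<^sup>2)"
    have q: "0 \<le> q" "q < 1" using \<epsilon> ab by (auto simp: q_def)
    have A: "A n \<in> sets P" for n unfolding A_def using S_meas[of n] by measurable
    have le: "prob (A n) \<le> 2 * q ^ n" if "1 \<le> n" for n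
    proof -
      have "q ^ n = exp (-2 * real n * \<epsilon>\<^sup>2 / (b - a)\<^sup>2)"
        by (simp add: q_def flip: exp_of_nat_mult)
      then show ?thesis using tail[of \<epsilon> n] \<epsilon> that by (simp add: A_def)
    qed
    have "summable (\<lambda>n. 2 * q ^ n)"
      using q by (intro summable_mult summable_geometric) simp
    then have "summable (\<lambda>n. prob (A n))"
      by (rule summable_comparison_test'[where N = 1]) (use le in simp)
    then have "AE w in P. \<forall>\<^sub>F n in sequentially. w \<in> space P - A n"
      using A by (intro borel_cantelli_AE1) (auto simp: emeasure_eq_measure)
    then show ?thesis
    proof (rule AE_mp, intro AE_I2 impI)
      fix w assume "\<forall>\<^sub>F n in sequentially. w \<in> space P - A n"
      then show "\<forall>\<^sub>F n in sequentially. \<bar>S n w - m\<bar> < \<epsilon>"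
        by (rule eventually_mono) (auto simp: A_def not_le)
    qed
  qed
  have "AE w in P. \<forall>k. \<forall>\<^sub>F n in sequentially. \<bar>S n w - m\<bar> < inverse (real (Suc k))"
    unfolding AE_all_countable by (intro allI ev) simp
  then have "AE w in P. (\<lambda>n. S n w) \<longlonglongrightarrow> m"
  proof (rule AE_mp, intro AE_I2 impI)
    fix w assume all: "\<forall>k. \<forall>\<^sub>F n in sequentially. \<bar>S n w - m\<bar> < inverse (real (Suc k))"
    show "(\<lambda>n. S n w) \<longlonglongrightarrow> m"
    proof (rule tendstoI)
      fix e :: real assume "0 < e"
      then obtain k where k: "inverse (real (Suc k)) < e" using reals_Archimedean by blast
      from all[THEN spec, of k] show "\<forall>\<^sub>F n in sequentially. dist (S n w) m < e"
        unfolding dist_real_def by (rule eventually_mono) (use k in linarith)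
    qed
  qed
  then show ?thesis unfolding S_def m_def .
qed

section \<open>Normalised kernel operators\<close>

lemma apply_bmfun_sum: "apply_bmfun (\<Sum>i\<in>I. f i) x = (\<Sum>i\<in>I. apply_bmfun (f i) x)"
  by (induction I rule: infinite_finite_induct) (simp_all add: bmfun_rep_eqs)

text \<open>
  Compactness gives finitely many balls of radius \<open>e\<close> that cover the space; a point is sent to the
  first centre, in some fixed order, whose ball contains it.
\<close>

lemma finite_range_selector:
  fixes e :: real
  assumes "compact (UNIV :: 'a::metric_space set)" and e: "0 < e"
  obtains p :: "'a::metric_space \<Rightarrow> 'a" where "p \<in> borel \<rightarrow>\<^sub>M borel" "finite (range p)" "\<And>x. x \<in> ball (p x) e"
proof -
  obtain C where C: "finite C" "(UNIV :: 'a::metric_space set) \<subseteq> (\<Union>c\<in>C. ball c e)"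
    using assms compact_eq_totally_bounded[of "UNIV :: 'a set"] by blast
  obtain cs where cs: "set cs = C" using finite_list[OF C(1)] by blast
  \<comment> \<open>The default value is never reached on a covering list, but it keeps the recursion total.\<close>
  define sel where "sel cs x = foldr (\<lambda>c y. if dist c x < e then c else y) cs undefined" for cs and x :: 'a
  have meas: "sel cs \<in> borel \<rightarrow>\<^sub>M borel" for cs
  proof (induction cs)
    case Nil
    then show ?case by (simp add: sel_def)
  next
    case (Cons c cs)
    have "{x. dist c x < e} = ball c e" by auto
    then have "{x \<in> space borel. dist c x < e} \<in> sets borel" by simp
    then have "(\<lambda>x. if dist c x < e then c else sel cs x) \<in> borel \<rightarrow>\<^sub>M borel"
      by (intro measurable_If Cons) auto
    moreover have "sel (c # cs) = (\<lambda>x. if dist c x < e then c else sel cs x)"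
      by (rule ext) (simp add: sel_def)
    ultimately show ?case by simp
  qed
  have rng: "sel cs x \<in> insert undefined (set cs)" for cs x
    by (induction cs) (auto simp: sel_def)
  have near: "dist (sel cs x) x < e" if "\<exists>c\<in>set cs. dist c x < e" for cs x
    using that by (induction cs) (auto simp: sel_def)
  show thesis
  proof (rule that[of "sel cs"])
    show "finite (range (sel cs))"
      by (rule finite_subset[of _ "insert undefined (set cs)"]) (use rng in auto)
    fix x
    have "x \<in> (\<Union>c\<in>C. ball c e)" using C(2) by blast
    then have "\<exists>c\<in>set cs. dist c x < e" unfolding cs by simp
    then show "x \<in> ball (sel cs x) e" using near by simp
  qed (rule meas)
qed

locale bounded_kernel =
  fixes k :: "'a::metric_space \<Rightarrow> 'a \<Rightarrow> real" and M :: real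
  assumes k_meas: "(\<lambda>(x, y). k x y) \<in> borel_measurable (borel \<Otimes>\<^sub>M borel)"
    and k_nonneg: "\<And>x y. 0 \<le> k x y" and k_le: "\<And>x y. k x y \<le> M"
begin

abbreviation K :: "'a measure \<Rightarrow> 'a bmfun \<Rightarrow>\<^sub>L 'a bmfun" where
  "K \<nu> \<equiv> kernel_op (norm_kernel k \<nu>) \<nu>"

lemma M_nonneg: "0 \<le> M"
  using k_nonneg[of undefined undefined] k_le[of undefined undefined] by linarith

lemma k_diff_le: "\<bar>k x z - k y z\<bar> \<le> M"
  using k_nonneg[of x z] k_le[of x z] k_nonneg[of y z] k_le[of y z] by linarith

lemma k_meas_right: "k x \<in> borel_measurable borel"
  using measurable_Pair2[OF k_meas, of x] by simp

context
  fixes \<nu> :: "'a measure"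
  assumes prob: "prob_space \<nu>" and sets: "sets \<nu> = sets borel"
begin

interpretation prob_space \<nu> by (rule prob)

lemma meas_iff: "f \<in> borel_measurable \<nu> \<longleftrightarrow> f \<in> borel_measurable borel" for f :: "'a \<Rightarrow> real"
  by (rule arg_cong[where f = "\<lambda>A. f \<in> A"]) (rule measurable_cong_sets[OF sets refl])

lemma integrable_bounded: "f \<in> borel_measurable borel \<Longrightarrow> (\<And>x. \<bar>f x\<bar> \<le> B) \<Longrightarrow> integrable \<nu> f"
  for f :: "'a \<Rightarrow> real"
  by (rule integrable_const_bound[where B = B]) (auto simp: meas_iff)

lemma k_integrable: "integrable \<nu> (k x)"
  by (rule integrable_bounded[where B = M, OF k_meas_right]) (use k_nonneg k_le in auto)

lemma k_diff_integrable: "integrable \<nu> (\<lambda>z. \<bar>k x z - k y z\<bar>)"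
  by (intro integrable_abs Bochner_Integration.integrable_diff k_integrable)

lemma degree_meas: "degree_fun k \<nu> \<in> borel_measurable borel"
proof -
  have "(\<lambda>(x, y). k x y) \<in> borel_measurable (borel \<Otimes>\<^sub>M \<nu>)"
    using k_meas measurable_cong_sets[OF sets_pair_measure_cong[OF refl sets] refl] by blast
  from borel_measurable_lebesgue_integral[OF this] show ?thesis
    by (simp add: degree_fun_def[abs_def])
qed

lemma norm_kernel_meas: "(\<lambda>(x, y). norm_kernel k \<nu> x y) \<in> borel_measurable (borel \<Otimes>\<^sub>M borel)"
proof -
  have "(\<lambda>z. k (fst z) (snd z)) \<in> borel_measurable (borel \<Otimes>\<^sub>M borel)"
    using k_meas by (simp add: case_prod_beta')
  moreover have "(\<lambda>z. degree_fun k \<nu> (fst z)) \<in> borel_measurable (borel \<Otimes>\<^sub>M borel)"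
    "(\<lambda>z. degree_fun k \<nu> (snd z)) \<in> borel_measurable (borel \<Otimes>\<^sub>M borel)"
    by (rule measurable_compose[OF measurable_fst degree_meas] measurable_compose[OF measurable_snd degree_meas])+
  ultimately show ?thesis
    unfolding norm_kernel_def case_prod_beta'
    by (intro borel_measurable_times borel_measurable_add borel_measurable_divide borel_measurable_const)
qed

lemma norm_kernel_meas_right: "norm_kernel k \<nu> x \<in> borel_measurable borel"
  using measurable_Pair2[OF norm_kernel_meas, of x] by simp

lemma degree_diff_le:
  assumes "(\<integral>z. \<bar>k x z - k y z\<bar> \<partial>\<nu>) \<le> \<eta>"
  shows "\<bar>degree_fun k \<nu> x - degree_fun k \<nu> y\<bar> \<le> \<eta>"
proof -
  have "degree_fun k \<nu> x - degree_fun k \<nu> y = (\<integral>z. k x z - k y z \<partial>\<nu>)"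
    unfolding degree_fun_def by (simp add: k_integrable)
  also have "\<bar>\<dots>\<bar> \<le> (\<integral>z. \<bar>k x z - k y z\<bar> \<partial>\<nu>)" by (rule integral_abs_bound)
  finally show ?thesis using assms by linarith
qed

context
  fixes b :: real
  assumes b: "0 < b" and deg: "\<And>x. b \<le> degree_fun k \<nu> x"
begin

lemma inverse_degree: "0 \<le> 1 / degree_fun k \<nu> x" "1 / degree_fun k \<nu> x \<le> 1 / b"
  using b deg[of x] by (auto simp: frac_le)

lemma norm_kernel_bound: "\<bar>norm_kernel k \<nu> x y\<bar> \<le> M / b"
proof -
  have "\<bar>norm_kernel k \<nu> x y\<bar> = 1 / 2 * k x y * (1 / degree_fun k \<nu> x + 1 / degree_fun k \<nu> y)"
    unfolding norm_kernel_def using k_nonneg inverse_degree(1) by (intro abs_of_nonneg mult_nonneg_nonneg add_nonneg_nonneg) auto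
  also have "\<dots> \<le> 1 / 2 * M * (1 / b + 1 / b)"
    using k_nonneg k_le inverse_degree M_nonneg by (intro mult_mono add_mono mult_nonneg_nonneg add_nonneg_nonneg) auto
  finally show ?thesis by simp
qed

lemma apply_K: "apply_bmfun (K \<nu> f) x = (\<integral>y. norm_kernel k \<nu> x y * apply_bmfun f y \<partial>\<nu>)"
  by (rule apply_kernel_op[OF finite_measure_axioms sets norm_kernel_meas norm_kernel_bound])

lemma kernel_integrable: "integrable \<nu> (\<lambda>y. norm_kernel k \<nu> x y * apply_bmfun f y)"
proof (rule integrable_bounded[where B = "M / b * norm f"])
  show "\<bar>norm_kernel k \<nu> x y * apply_bmfun f y\<bar> \<le> M / b * norm f" for y
    unfolding abs_mult using M_nonneg b
    by (intro mult_mono norm_kernel_bound abs_apply_bmfun_le_norm) auto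
qed (intro borel_measurable_times norm_kernel_meas_right measurable_apply_bmfun)

lemma norm_K_le: "norm (K \<nu>) \<le> M / b"
proof (rule norm_blinfun_bound)
  show "0 \<le> M / b" using M_nonneg b by simp
  fix f
  show "norm (K \<nu> f) \<le> M / b * norm f"
  proof (rule norm_bmfun_le)
    fix x
    have "\<bar>\<integral>y. norm_kernel k \<nu> x y * apply_bmfun f y \<partial>\<nu>\<bar> \<le> (\<integral>y. \<bar>norm_kernel k \<nu> x y * apply_bmfun f y\<bar> \<partial>\<nu>)"
      by (rule integral_abs_bound)
    also have "\<dots> \<le> (\<integral>y. M / b * norm f \<partial>\<nu>)"
    proof (rule integral_mono)
      show "\<bar>norm_kernel k \<nu> x y * apply_bmfun f y\<bar> \<le> M / b * norm f" for y
        unfolding abs_mult using M_nonneg b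
        by (intro mult_mono norm_kernel_bound abs_apply_bmfun_le_norm) auto
    qed (use kernel_integrable in auto)
    also have "\<dots> = M / b * norm f" by (simp add: prob_space)
    finally show "\<bar>apply_bmfun (K \<nu> f) x\<bar> \<le> M / b * norm f" unfolding apply_K .
  qed
qed

text \<open>
  \<open>h x z - h y z = 1/2 (k x z - k y z) (1/d x + 1/d z) + 1/2 k y z (1/d x - 1/d y)\<close> for the degree function \<open>d\<close>.
\<close>

lemma norm_kernel_diff_le:
  assumes \<eta>: "\<bar>degree_fun k \<nu> x - degree_fun k \<nu> y\<bar> \<le> \<eta>"
  shows "\<bar>norm_kernel k \<nu> x z - norm_kernel k \<nu> y z\<bar> \<le> 1 / b * \<bar>k x z - k y z\<bar> + M / (2 * b\<^sup>2) * \<eta>"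
proof -
  let ?d = "degree_fun k \<nu>"
  have pos: "0 < ?d x" for x using b deg[of x] by linarith
  have "1 / ?d x - 1 / ?d y = (?d y - ?d x) / (?d x * ?d y)"
    using pos[of x] pos[of y] by (simp add: field_simps)
  then have "\<bar>1 / ?d x - 1 / ?d y\<bar> = \<bar>?d x - ?d y\<bar> / (?d x * ?d y)"
    using pos[of x] pos[of y] by (simp add: abs_mult)
  also have "\<dots> \<le> \<eta> / (b * b)"
    using \<eta> b deg[of x] deg[of y] by (intro frac_le mult_mono) auto
  finally have dd: "\<bar>1 / ?d x - 1 / ?d y\<bar> \<le> \<eta> / (b * b)" .
  have split: "1 / 2 * p * (A + Z) - 1 / 2 * q * (B + Z) =
      1 / 2 * ((p - q) * (A + Z)) + 1 / 2 * (q * (A - B))" for p q A B Z :: real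
    by (simp add: field_simps)
  have "norm_kernel k \<nu> x z - norm_kernel k \<nu> y z =
      1 / 2 * ((k x z - k y z) * (1 / ?d x + 1 / ?d z)) + 1 / 2 * (k y z * (1 / ?d x - 1 / ?d y))"
    unfolding norm_kernel_def split by (rule refl)
  also have "\<bar>\<dots>\<bar> \<le> 1 / 2 * (\<bar>k x z - k y z\<bar> * \<bar>1 / ?d x + 1 / ?d z\<bar>) +
      1 / 2 * (\<bar>k y z\<bar> * \<bar>1 / ?d x - 1 / ?d y\<bar>)"
    by (rule order_trans[OF abs_triangle_ineq]) (simp add: abs_mult)
  also have "\<dots> \<le> 1 / 2 * (\<bar>k x z - k y z\<bar> * (1 / b + 1 / b)) + 1 / 2 * (M * (\<eta> / (b * b)))"
  proof (intro add_mono mult_left_mono mult_mono dd)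
    show "\<bar>1 / ?d x + 1 / ?d z\<bar> \<le> 1 / b + 1 / b"
      using inverse_degree[of x] inverse_degree[of z] by linarith
    show "\<bar>k y z\<bar> \<le> M" using k_nonneg[of y z] k_le[of y z] by simp
  qed (use M_nonneg in auto)
  also have "\<dots> = 1 / b * \<bar>k x z - k y z\<bar> + M / (2 * b\<^sup>2) * \<eta>"
    by (simp add: power2_eq_square field_simps)
  finally show ?thesis .
qed

text \<open>
  The mean oscillation of the kernel controls the oscillation of the image of a function, through
  the norm of the function only.  This is the source of compactness, for \<open>\<mu>\<close> and for the
  empirical measures alike.
\<close>

lemma K_oscillation:
  assumes \<eta>: "(\<integral>z. \<bar>k x z - k y z\<bar> \<partial>\<nu>) \<le> \<eta>"
  shows "\<bar>apply_bmfun (K \<nu> f) x - apply_bmfun (K \<nu> f) y\<bar> \<le> (1 / b + M / (2 * b\<^sup>2)) * \<eta> * norm f"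
proof -
  let ?h = "norm_kernel k \<nu>"
  have "apply_bmfun (K \<nu> f) x - apply_bmfun (K \<nu> f) y =
      (\<integral>z. ?h x z * apply_bmfun f z - ?h y z * apply_bmfun f z \<partial>\<nu>)"
    unfolding apply_K by (rule Bochner_Integration.integral_diff[symmetric]; rule kernel_integrable)
  also have "\<bar>\<dots>\<bar> \<le> (\<integral>z. \<bar>?h x z * apply_bmfun f z - ?h y z * apply_bmfun f z\<bar> \<partial>\<nu>)"
    by (rule integral_abs_bound)
  also have "\<dots> \<le> (\<integral>z. (1 / b * \<bar>k x z - k y z\<bar> + M / (2 * b\<^sup>2) * \<eta>) * norm f \<partial>\<nu>)"
  proof (rule integral_mono)
    show "integrable \<nu> (\<lambda>z. \<bar>?h x z * apply_bmfun f z - ?h y z * apply_bmfun f z\<bar>)"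
      by (intro integrable_abs Bochner_Integration.integrable_diff kernel_integrable)
    show "integrable \<nu> (\<lambda>z. (1 / b * \<bar>k x z - k y z\<bar> + M / (2 * b\<^sup>2) * \<eta>) * norm f)"
      by (intro integrable_mult_left Bochner_Integration.integrable_add integrable_mult_right
          k_diff_integrable integrable_const)
    fix z
    have "\<bar>?h x z * apply_bmfun f z - ?h y z * apply_bmfun f z\<bar> = \<bar>?h x z - ?h y z\<bar> * \<bar>apply_bmfun f z\<bar>"
      by (simp add: left_diff_distrib flip: abs_mult)
    also have "\<dots> \<le> (1 / b * \<bar>k x z - k y z\<bar> + M / (2 * b\<^sup>2) * \<eta>) * norm f"
      using norm_kernel_diff_le[OF degree_diff_le[OF \<eta>]]
      by (intro mult_mono abs_apply_bmfun_le_norm) (auto intro: order_trans[OF abs_ge_zero])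
    finally show "\<bar>?h x z * apply_bmfun f z - ?h y z * apply_bmfun f z\<bar>
      \<le> (1 / b * \<bar>k x z - k y z\<bar> + M / (2 * b\<^sup>2) * \<eta>) * norm f" .
  qed
  also have "\<dots> = (1 / b * (\<integral>z. \<bar>k x z - k y z\<bar> \<partial>\<nu>) + M / (2 * b\<^sup>2) * \<eta>) * norm f"
    by (simp add: k_diff_integrable prob_space)
  also have "\<dots> \<le> (1 / b * \<eta> + M / (2 * b\<^sup>2) * \<eta>) * norm f"
    using \<eta> b by (intro mult_right_mono add_right_mono mult_left_mono) auto
  finally show ?thesis by (simp only: distrib_right)
qed

end

end

lemma prob_space_empirical: "1 \<le> n \<Longrightarrow> prob_space (empirical_measure xs n)"
  unfolding empirical_measure_def
  by (intro prob_space.prob_space_distr prob_space_uniform_count_measure)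
    (auto simp: measurable_def space_uniform_count_measure sets_uniform_count_measure)

lemma sets_empirical: "sets (empirical_measure xs n) = sets borel"
  by (simp add: empirical_measure_def)

lemma bounded_linear_eval: "bounded_linear (\<lambda>f. apply_bmfun f x)"
  by (rule bounded_linear_intro[where K = 1])
    (use abs_apply_bmfun_le_norm in \<open>auto simp: bmfun_rep_eqs\<close>)

text \<open>
  The integral over an empirical measure is a sum over the sample points, so the operator only sees
  the values of a function at these points.
\<close>

lemma finite_rank_empirical:
  assumes n: "1 \<le> n" and b: "0 < b" and deg: "\<And>x. b \<le> degree_fun k (empirical_measure xs n) x"
  shows "finite_rank (K (empirical_measure xs n))"
proof -
  define \<nu> where "\<nu> = empirical_measure xs n"
  have \<nu>: "prob_space \<nu>" "sets \<nu> = sets borel" and deg': "\<And>x. b \<le> degree_fun k \<nu> x"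
    using prob_space_empirical[OF n] sets_empirical deg by (auto simp: \<nu>_def)
  define A where "A i = Bmfun (\<lambda>x. norm_kernel k \<nu> x (xs (Suc i)) / real n)" for i
  have A: "apply_bmfun (A i) x = norm_kernel k \<nu> x (xs (Suc i)) / real n" for i x
  proof -
    have "(\<lambda>x. norm_kernel k \<nu> x (xs (Suc i))) \<in> borel_measurable borel"
      using measurable_Pair1[OF norm_kernel_meas[OF \<nu>], of "xs (Suc i)"] by simp
    then have "(\<lambda>x. norm_kernel k \<nu> x (xs (Suc i)) / real n) \<in> borel_measurable borel"
      by (intro borel_measurable_divide borel_measurable_const)
    moreover have "bounded (range (\<lambda>x. norm_kernel k \<nu> x (xs (Suc i)) / real n))"
    proof (rule boundedI[where B = "M / b / real n"])
      fix y assume "y \<in> range (\<lambda>x. norm_kernel k \<nu> x (xs (Suc i)) / real n)"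
      then obtain x where "y = norm_kernel k \<nu> x (xs (Suc i)) / real n" by blast
      then show "norm y \<le> M / b / real n"
        using divide_right_mono[OF norm_kernel_bound[OF \<nu> b deg', of x "xs (Suc i)"], of "real n"]
        by (simp add: abs_divide)
    qed
    ultimately show ?thesis unfolding A_def by (simp add: apply_Bmfun)
  qed
  have K_eq: "K \<nu> f = (\<Sum>i<n. Blinfun (\<lambda>f. apply_bmfun f (xs (Suc i))) f *\<^sub>R A i)" for f
  proof (rule bmfun_eqI)
    fix x
    have "apply_bmfun (K \<nu> f) x = (\<integral>y. norm_kernel k \<nu> x y * apply_bmfun f y \<partial>\<nu>)"
      by (rule apply_K[OF \<nu> b deg'])
    also have "\<dots> = (\<Sum>i=1..n. norm_kernel k \<nu> x (xs i) * apply_bmfun f (xs i)) / real n"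
      unfolding \<nu>_def by (rule integral_empirical_measure)
        (intro borel_measurable_times measurable_apply_bmfun norm_kernel_meas_right[OF \<nu>, unfolded \<nu>_def])
    also have "\<dots> = (\<Sum>i<n. apply_bmfun f (xs (Suc i)) * (norm_kernel k \<nu> x (xs (Suc i)) / real n))"
      by (simp add: sum.atLeast1_atMost_eq sum_divide_distrib mult_ac)
    finally show "apply_bmfun (K \<nu> f) x =
        apply_bmfun (\<Sum>i<n. Blinfun (\<lambda>f. apply_bmfun f (xs (Suc i))) f *\<^sub>R A i) x"
      unfolding apply_bmfun_sum scaleR_bmfun.rep_eq A
      by (simp add: bounded_linear_Blinfun_apply[OF bounded_linear_eval])
  qed
  show ?thesis unfolding finite_rank_def \<nu>_def[symmetric]
    by (intro exI[of _ n] exI[of _ "\<lambda>i. Blinfun (\<lambda>f. apply_bmfun f (xs (Suc i)))"] exI[of _ A] allI K_eq)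
qed

end

section \<open>Convergence of the eigenvalues and of the spectral projections\<close>

locale isolated_eigenvalue_approximation = operator_approximation T Tn C
  for T :: "'a::topological_space bmfun \<Rightarrow>\<^sub>L 'a bmfun" and Tn C +
  fixes lam :: complex and V :: "complex set"
  assumes lam_ev: "op_eigenvalue S lam" and lam_ne: "lam \<noteq> 1"
    and V_open: "open V" and V_isol: "V \<inter> op_spectrum S = {lam}"
    and V_frontier: "frontier V \<inter> op_spectrum S = {}"
begin

lemma admissible_radius:
  assumes "0 < \<epsilon>"
  obtains r where "0 < r" "r < \<epsilon>" "cball lam r \<subseteq> V" "1 \<notin> cball lam r"
    "sphere lam r \<inter> op_spectrum S = {}"
proof -
  have "lam \<in> V" using V_isol by blast
  then obtain e where e: "e > 0" "cball lam e \<subseteq> V" using V_open open_contains_cball by blast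
  define r where "r = min (min e (\<epsilon> / 2)) (dist lam 1 / 2)"
  have "r \<le> e" "r \<le> \<epsilon> / 2" "r \<le> dist lam 1 / 2" by (auto simp: r_def)
  moreover have "0 < r" using e(1) assms lam_ne by (simp add: r_def)
  moreover have "r < \<epsilon>" using \<open>r \<le> \<epsilon> / 2\<close> assms by linarith
  moreover have sub: "cball lam r \<subseteq> V" using e(2) \<open>r \<le> e\<close> by force
  moreover have "dist lam 1 > r" using \<open>r \<le> dist lam 1 / 2\<close> \<open>0 < r\<close> by linarith
  moreover have "sphere lam r \<subseteq> V - {lam}" using sub \<open>0 < r\<close> by auto
  then have "sphere lam r \<inter> op_spectrum S = {}" using V_isol by blast
  ultimately show thesis by (intro that[of r]) auto
qed

text \<open>
  An eigenvector for \<open>lam \<noteq> 1\<close> lies in the range of \<open>T\<close>, where \<open>Tn\<close> converges to \<open>T\<close>.  It is therefore an approximate eigenvector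
  of \<open>Sn n\<close>.
\<close>

lemma eigenvector_residual:
  obtains v where "v \<noteq> 0" "(\<lambda>n. complexify (T - Tn n) v) \<longlonglongrightarrow> 0"
    "\<forall>n. complexify (Sn n) v - cscale lam v = complexify (T - Tn n) v"
proof -
  obtain v where v: "v \<noteq> 0" "complexify S v = cscale lam v"
    using lam_ev unfolding op_eigenvalue_def by blast
  define \<zeta> where "\<zeta> = 1 - lam"
  have \<zeta>: "\<zeta> \<noteq> 0" using lam_ne by (simp add: \<zeta>_def)
  have "complexify T v = v - complexify S v"
    unfolding complexify_diff blinfun.diff_left by simp
  also have "\<dots> = cscale \<zeta> v"
    unfolding v(2) \<zeta>_def cscale_diff blinfun.diff_left by simp
  finally have Tv: "complexify T v = cscale \<zeta> v" .
  have "cscale (1 / \<zeta>) (cscale \<zeta> v) = v"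
    using cscale_inverse[OF \<zeta>, where 'a = "'a bmfun"]
    by (simp only: inverse_ops_def blinfun_apply_id_blinfun id_apply
        flip: blinfun_apply_blinfun_compose)
  then have v_eq: "v = cscale (1 / \<zeta>) (complexify T v)" unfolding Tv by (rule sym)
  have W: "complexify (T - Tn n) v = cscale (1 / \<zeta>) (complexify ((T - Tn n) o\<^sub>L T) v)" for n
  proof -
    have "complexify (T - Tn n) v = (complexify (T - Tn n) o\<^sub>L cscale (1 / \<zeta>)) (complexify T v)"
      unfolding blinfun_apply_blinfun_compose v_eq[symmetric] by (rule refl)
    then show ?thesis
      unfolding complexify_cscale complexify_compose by (simp only: blinfun_apply_blinfun_compose)
  qed
  have g0: "(\<lambda>n. norm ((T - Tn n) o\<^sub>L T) * norm v) \<longlonglongrightarrow> 0"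
    by (rule tendsto_mult_left_zero[OF lim_T])
  have "(\<lambda>n. complexify ((T - Tn n) o\<^sub>L T) v) \<longlonglongrightarrow> 0"
  proof (rule Lim_null_comparison[OF always_eventually g0], intro allI)
    fix n
    show "norm (complexify ((T - Tn n) o\<^sub>L T) v) \<le> norm ((T - Tn n) o\<^sub>L T) * norm v"
      by (rule order_trans[OF norm_blinfun mult_right_mono[OF norm_complexify_le norm_ge_zero]])
  qed
  from blinfun.tendsto[OF tendsto_const this, of "cscale (1 / \<zeta>)"]
  have lim: "(\<lambda>n. complexify (T - Tn n) v) \<longlonglongrightarrow> 0"
    unfolding W blinfun.zero_right .
  have res: "complexify (Sn n) v - cscale lam v = complexify (T - Tn n) v" for n
  proof -
    have "complexify (Sn n) v - cscale lam v = (complexify (Sn n) - cscale lam) v"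
      by (simp only: blinfun.diff_left)
    also have "\<dots> = (complexify S v - cscale lam v) + complexify (T - Tn n) v"
      unfolding S_diff by (simp only: blinfun.diff_left blinfun.add_left)
    finally show ?thesis unfolding v(2) by simp
  qed
  show thesis by (rule that[OF v(1) lim allI[OF res]])
qed

text \<open>
  Suppose that the disc contains no spectrum of \<open>Sn n\<close>, and let \<open>w = (Sn n - lam) v\<close> for an
  eigenvector \<open>v\<close> of \<open>S\<close>.  Then the resolvent applied to \<open>w\<close> is holomorphic on the disc and takes the value \<open>v\<close> at \<open>lam\<close>,
  while on the circle it is bounded by a constant times \<open>norm w\<close>.  By the maximum principle \<open>v\<close> is small,
  because \<open>w\<close> tends to 0: a contradiction.
\<close>

lemma spectrum_near_eigenvalue:
  assumes r: "0 < r" "sphere lam r \<inter> op_spectrum S = {}"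
  shows "\<forall>\<^sub>F n in sequentially. ball lam r \<inter> op_spectrum (Sn n) \<noteq> {}"
proof -
  obtain v where v: "v \<noteq> 0" "(\<lambda>n. complexify (T - Tn n) v) \<longlonglongrightarrow> 0"
    "\<forall>n. complexify (Sn n) v - cscale lam v = complexify (T - Tn n) v"
    by (rule eigenvector_residual)
  obtain B where B: "\<forall>\<^sub>F n in sequentially.
      \<forall>z\<in>sphere lam r. z \<notin> op_spectrum (Sn n) \<and> norm (resolvent (Sn n) z) \<le> B"
    using resolvent_bound[OF compact_sphere r(2)] by blast
  have "(\<lambda>n. 2 * (\<bar>B\<bar> * norm (complexify (T - Tn n) v))) \<longlonglongrightarrow> 2 * (\<bar>B\<bar> * norm (0 :: 'a bmfun \<times> 'a bmfun))"
    by (intro tendsto_intros v(2))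
  then have "\<forall>\<^sub>F n in sequentially. 2 * (\<bar>B\<bar> * norm (complexify (T - Tn n) v)) < norm v"
    by (rule order_tendstoD(2)) (use v(1) in simp)
  with B show ?thesis
  proof eventually_elim
    case (elim n)
    show ?case
    proof
      assume empty: "ball lam r \<inter> op_spectrum (Sn n) = {}"
      define w where "w = complexify (T - Tn n) v"
      have sub: "cball lam r \<subseteq> - op_spectrum (Sn n)"
      proof
        fix z assume "z \<in> cball lam r"
        then have "z \<in> ball lam r \<or> z \<in> sphere lam r" by auto
        then show "z \<in> - op_spectrum (Sn n)" using empty elim(1) by blast
      qed
      have Rw: "resolvent (Sn n) lam w = v"
      proof -
        have "lam \<notin> op_spectrum (Sn n)" using subsetD[OF sub, of lam] r(1) by simp
        from resolvent_apply(1)[OF this, of v] show ?thesis unfolding v(3)[THEN spec] w_def .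
      qed
      have "cmod (ceval x v) \<le> \<bar>B\<bar> * norm w" for x
      proof -
        let ?f = "\<lambda>z. ceval x (resolvent (Sn n) z w)"
        have hol: "?f holomorphic_on cball lam r"
          using resolvent_holomorphic sub by (rule holomorphic_on_subset)
        have "cmod (?f lam) \<le> \<bar>B\<bar> * norm w"
        proof (rule maximum_modulus_frontier[where f = ?f and S = "cball lam r"])
          show "?f holomorphic_on interior (cball lam r)"
            using hol interior_subset by (rule holomorphic_on_subset)
          show "continuous_on (closure (cball lam r)) ?f"
            using hol by (simp add: holomorphic_on_imp_continuous_on)
          fix z assume "z \<in> frontier (cball lam r)"
          then have z: "z \<in> sphere lam r" using r(1) by (simp add: frontier_cball)
          have "cmod (?f z) \<le> norm (resolvent (Sn n) z w)" by (rule cmod_ceval_le)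
          also have "\<dots> \<le> norm (resolvent (Sn n) z) * norm w" by (rule norm_blinfun)
          also have "\<dots> \<le> \<bar>B\<bar> * norm w" using elim(1) z by (intro mult_right_mono) force+
          finally show "cmod (?f z) \<le> \<bar>B\<bar> * norm w" .
        qed (use r(1) in auto)
        then show ?thesis unfolding Rw .
      qed
      then have "norm v \<le> 2 * (\<bar>B\<bar> * norm w)" by (rule norm_le_ceval)
      then show False using elim(2) unfolding w_def by linarith
    qed
  qed
qed

theorem eigenvalues_converge:
  assumes "0 < \<epsilon>"
  shows "\<forall>\<^sub>F n in sequentially.
    (let E = {z \<in> op_spectrum (Sn n) \<inter> V. op_eigenvalue (Sn n) z}
     in E \<noteq> {} \<and> (\<forall>z\<in>E. dist z lam < \<epsilon>))"
proof -
  obtain r where r: "0 < r" "r < \<epsilon>" "cball lam r \<subseteq> V" "1 \<notin> cball lam r"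
    "sphere lam r \<inter> op_spectrum S = {}"
    by (rule admissible_radius[OF assms])
  from spectrum_localized[OF V_isol V_frontier r(1)] spectrum_near_eigenvalue[OF r(1,5)] fin_rank
  show ?thesis
  proof eventually_elim
    case (elim n)
    obtain z where z: "z \<in> ball lam r" "z \<in> op_spectrum (Sn n)" using elim(2) by blast
    then have zV: "z \<in> V" "z \<noteq> 1" using r(3,4) by auto
    have "op_eigenvalue (Sn n) z" by (rule finite_rank_spectrum(2)[OF elim(3) z(2) zV(2)])
    then have "z \<in> {z \<in> op_spectrum (Sn n) \<inter> V. op_eigenvalue (Sn n) z}" using z zV by blast
    moreover have "dist y lam < \<epsilon>" if "y \<in> op_spectrum (Sn n) \<inter> V" for y
    proof -
      have "y \<in> ball lam r" using elim(1) that by blast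
      then show ?thesis using r(2) by (simp add: dist_commute)
    qed
    ultimately show ?case unfolding Let_def by blast
  qed
qed

text \<open>
  For large \<open>n\<close> the set \<open>V\<close> meets the spectrum of \<open>Sn n\<close> exactly inside a fixed small circle around \<open>lam\<close>, so
  both projections are integrals over this circle and the integrands converge uniformly at \<open>v\<close>.
\<close>

theorem spectral_projections_converge:
  assumes v: "(\<lambda>n. complexify (T - Tn n) v) \<longlonglongrightarrow> 0"
  shows "(\<lambda>n. spectral_projection (Sn n) V v) \<longlonglongrightarrow> spectral_projection S V v"
proof (rule tendstoI)
  fix e :: real assume e: "0 < e"
  obtain r where r: "0 < r" "r < e" "cball lam r \<subseteq> V" "1 \<notin> cball lam r"
    "sphere lam r \<inter> op_spectrum S = {}"
    by (rule admissible_radius[OF e])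
  let ?c = "- 1 / (2 * complex_of_real pi * \<i>)"
  let ?I = "\<lambda>S. op_contour_integral (circlepath lam r) (resolvent S)"
  \<comment> \<open>The length of the circle and the two factors from \<open>norm_cscale_le\<close> amount to \<open>4 * r\<close>.\<close>
  define \<epsilon> where "\<epsilon> = e / (8 * r)"
  have \<epsilon>: "0 < \<epsilon>" using e r(1) by (simp add: \<epsilon>_def)
  have one: "1 \<notin> sphere lam r" using r(4) by auto
  have c: "norm (cscale ?c :: ('a bmfun \<times> 'a bmfun) \<Rightarrow>\<^sub>L _) \<le> 1 / pi"
    using norm_cscale_le[of ?c, where 'e = "'a bmfun"] by (simp add: norm_divide norm_mult)
  have ballV: "ball lam r \<subseteq> V" using r(3) ball_subset_cball by blast
  have lamV: "lam \<in> ball lam r" using r(1) by simp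
  have "ball lam r \<inter> op_spectrum S = V \<inter> op_spectrum S"
  proof
    show "ball lam r \<inter> op_spectrum S \<subseteq> V \<inter> op_spectrum S" using ballV by blast
    have "lam \<in> op_spectrum S" using V_isol by blast
    then show "V \<inter> op_spectrum S \<subseteq> ball lam r \<inter> op_spectrum S" unfolding V_isol using lamV by simp
  qed
  moreover have "finite (V \<inter> op_spectrum S)" unfolding V_isol by simp
  ultimately have PS: "spectral_projection S V = cscale ?c o\<^sub>L ?I S"
    by (rule spectral_projection_circle[OF r(1,5)])
  from spectrum_localized[OF V_isol V_frontier r(1)] fin_rank
    resolvent_converges_pointwise[OF compact_sphere r(5) one v \<epsilon>]
  show "\<forall>\<^sub>F n in sequentially. dist (spectral_projection (Sn n) V v) (spectral_projection S V v) < e"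
  proof eventually_elim
    case (elim n)
    have sph: "sphere lam r \<inter> op_spectrum (Sn n) = {}" using elim(3) by blast
    have V_eq: "ball lam r \<inter> op_spectrum (Sn n) = V \<inter> op_spectrum (Sn n)"
      using elim(1) ballV by blast
    have "1 \<notin> ball lam r" using r(4) by auto
    then have "V \<inter> op_spectrum (Sn n) \<subseteq> op_spectrum (Sn n) - {1}" using elim(1) by blast
    then have "finite (V \<inter> op_spectrum (Sn n))"
      using finite_rank_spectrum(1)[OF elim(2)] by (rule finite_subset)
    then have "spectral_projection (Sn n) V = cscale ?c o\<^sub>L ?I (Sn n)"
      by (rule spectral_projection_circle[OF r(1) sph V_eq])
    then have "dist (spectral_projection (Sn n) V v) (spectral_projection S V v) =
        norm (cscale ?c (?I (Sn n) v - ?I S v))"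
      unfolding PS dist_norm by (simp only: blinfun_apply_blinfun_compose blinfun.diff_right)
    also have "\<dots> \<le> norm (cscale ?c :: ('a bmfun \<times> 'a bmfun) \<Rightarrow>\<^sub>L _) * norm (?I (Sn n) v - ?I S v)"
      by (rule norm_blinfun)
    also have "\<dots> \<le> (1 / pi) * (4 * pi * r * \<epsilon>)"
    proof (intro mult_mono c)
      show "norm (?I (Sn n) v - ?I S v) \<le> 4 * pi * r * \<epsilon>"
        using elim(3) by (intro spectral_projection_circle_diff r(1,5) sph) blast
    qed auto
    also have "\<dots> = e / 2" using r(1) by (simp add: \<epsilon>_def)
    also have "\<dots> < e" using e by simp
    finally show ?case .
  qed
qed

end

section \<open>Approximation of a kernel operator by operators on sampled points\<close>

text \<open>
  The deterministic content of a good sample.  At the scale \<open>m\<close> the selector \<open>p m\<close> replaces a point by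
  one of finitely many centres, at the price of the mean oscillation \<open>\<eta> m\<close>.  Convergence of integrals is
  required for countably many integrands only: those attached to the centres and to the cells on which a
  selector is constant.
\<close>

locale kernel_approximation = bounded_kernel k M
  for k :: "'a::metric_space \<Rightarrow> 'a \<Rightarrow> real" and M :: real +
  fixes \<mu> :: "'a measure" and \<nu> :: "nat \<Rightarrow> 'a measure" and p :: "nat \<Rightarrow> 'a \<Rightarrow> 'a"
    and \<eta> :: "nat \<Rightarrow> real" and a :: real
  assumes prob_\<mu>: "prob_space \<mu>" and sets_\<mu>: "sets \<mu> = sets borel"
    and prob_\<nu>: "\<And>n. 1 \<le> n \<Longrightarrow> prob_space (\<nu> n)" and sets_\<nu>: "\<And>n. sets (\<nu> n) = sets borel"
    and fin_rank_\<nu>: "\<And>n b. 1 \<le> n \<Longrightarrow> 0 < b \<Longrightarrow> (\<And>x. b \<le> degree_fun k (\<nu> n) x) \<Longrightarrow>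
      finite_rank (kernel_op (norm_kernel k (\<nu> n)) (\<nu> n))"
    and a_pos: "0 < a" and degree_ge: "\<And>x. a \<le> degree_fun k \<mu> x"
    and p_meas: "\<And>m. p m \<in> borel \<rightarrow>\<^sub>M borel" and p_finite: "\<And>m. finite (range (p m))"
    and \<eta>_lim: "\<eta> \<longlonglongrightarrow> 0"
    and osc_\<mu>: "\<And>m x. (\<integral>z. \<bar>k x z - k (p m x) z\<bar> \<partial>\<mu>) \<le> \<eta> m"
    and osc_\<nu>: "\<And>m. \<forall>\<^sub>F n in sequentially. \<forall>x. (\<integral>z. \<bar>k x z - k (p m x) z\<bar> \<partial>\<nu> n) \<le> \<eta> m"
    and degree_conv: "\<And>m c. c \<in> range (p m) \<Longrightarrow>
      (\<lambda>n. degree_fun k (\<nu> n) c) \<longlonglongrightarrow> degree_fun k \<mu> c"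
    and cell_conv: "\<And>m m' c c'. c \<in> range (p m) \<Longrightarrow> c' \<in> range (p m') \<Longrightarrow>
      (\<lambda>n. \<integral>z. norm_kernel k \<mu> c z * (if p m' z = c' then 1 else 0) \<partial>\<nu> n) \<longlonglongrightarrow>
      (\<integral>z. norm_kernel k \<mu> c z * (if p m' z = c' then 1 else 0) \<partial>\<mu>)"
begin

text \<open>
  \<open>b\<close> is a lower bound for the degrees of \<open>\<mu>\<close> and, for large \<open>n\<close>, of \<open>\<nu> n\<close>; the constants \<open>L\<close> and \<open>C\<close> are
  those of \<open>K_oscillation\<close> and \<open>norm_K_le\<close> for this bound.
\<close>

definition b :: real where "b = a / 2"
definition L :: real where "L = 1 / b + M / (2 * b\<^sup>2)"
definition C :: real where "C = M / b"

abbreviation T where "T \<equiv> K \<mu>"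
abbreviation Tn where "Tn n \<equiv> K (\<nu> n)"

lemma b_pos: "0 < b" using a_pos by (simp add: b_def)
lemma L_nonneg: "0 \<le> L" using b_pos M_nonneg by (simp add: L_def)
lemma C_nonneg: "0 \<le> C" using b_pos M_nonneg by (simp add: C_def)
lemma degree_ge_b: "b \<le> degree_fun k \<mu> x" using degree_ge[of x] a_pos by (simp add: b_def)

lemma \<eta>_nonneg: "0 \<le> \<eta> m"
proof -
  have "0 \<le> (\<integral>z. \<bar>k undefined z - k (p m undefined) z\<bar> \<partial>\<mu>)"
    by (rule Bochner_Integration.integral_nonneg) simp
  then show ?thesis using osc_\<mu> by (rule order_trans)
qed

lemma \<eta>_small:
  assumes "0 < e"
  obtains m where "\<eta> m < e"
  using order_tendstoD(2)[OF \<eta>_lim assms] eventually_happens'[OF sequentially_bot] by blast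

text \<open>
  Convergence at the finitely many centres of one scale is uniform, and the oscillation bound carries it to all
  other points.
\<close>

lemma degree_uniform:
  assumes "0 < \<epsilon>"
  shows "\<forall>\<^sub>F n in sequentially. \<forall>x. \<bar>degree_fun k (\<nu> n) x - degree_fun k \<mu> x\<bar> \<le> \<epsilon>"
proof -
  obtain m where m: "\<eta> m < \<epsilon> / 3" using \<eta>_small[of "\<epsilon> / 3"] assms by auto
  have "\<forall>\<^sub>F n in sequentially. \<forall>c\<in>range (p m). dist (degree_fun k (\<nu> n) c) (degree_fun k \<mu> c) < \<epsilon> / 3"
    using assms by (intro eventually_ball_finite p_finite ballI tendstoD[OF degree_conv]) auto
  with osc_\<nu>[of m] eventually_ge_at_top[of 1] show ?thesis
  proof eventually_elim
    case (elim n)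
    show ?case
    proof
      fix x
      have "\<bar>degree_fun k (\<nu> n) x - degree_fun k (\<nu> n) (p m x)\<bar> \<le> \<eta> m"
        using elim(1) by (intro degree_diff_le[OF prob_\<nu>[OF elim(2)] sets_\<nu>]) blast
      moreover have "\<bar>degree_fun k \<mu> x - degree_fun k \<mu> (p m x)\<bar> \<le> \<eta> m"
        by (rule degree_diff_le[OF prob_\<mu> sets_\<mu> osc_\<mu>])
      moreover have "\<bar>degree_fun k (\<nu> n) (p m x) - degree_fun k \<mu> (p m x)\<bar> < \<epsilon> / 3"
        using elim(3) by (simp add: dist_real_def)
      ultimately show "\<bar>degree_fun k (\<nu> n) x - degree_fun k \<mu> x\<bar> \<le> \<epsilon>" using m by linarith
    qed
  qed
qed

lemma degree_lower:
  "\<forall>\<^sub>F n in sequentially. 1 \<le> n \<and> (\<forall>x. b \<le> degree_fun k (\<nu> n) x)"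
  using degree_uniform[OF b_pos] eventually_ge_at_top[of 1]
proof eventually_elim
  case (elim n)
  have "b \<le> degree_fun k (\<nu> n) x" for x
    using elim(1)[THEN spec, of x] degree_ge[of x] unfolding b_def by linarith
  with elim(2) show ?case by blast
qed

lemma fin_rank_K: "\<forall>\<^sub>F n in sequentially. finite_rank (Tn n)"
  using degree_lower
proof eventually_elim
  case (elim n)
  then show ?case by (intro fin_rank_\<nu>[OF _ b_pos]) blast+
qed

lemma norm_T: "norm T \<le> C"
  unfolding C_def by (rule norm_K_le[OF prob_\<mu> sets_\<mu> b_pos degree_ge_b])

lemma norm_Tn: "\<forall>\<^sub>F n in sequentially. norm (Tn n) \<le> C"
  using degree_lower
proof eventually_elim
  case (elim n)
  then show ?case unfolding C_def
    by (intro norm_K_le[OF prob_\<nu> sets_\<nu> b_pos]) blast+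
qed

lemma osc_T: "\<bar>apply_bmfun (T f) x - apply_bmfun (T f) (p m x)\<bar> \<le> L * \<eta> m * norm f"
  unfolding L_def by (rule K_oscillation[OF prob_\<mu> sets_\<mu> b_pos degree_ge_b osc_\<mu>])

lemma osc_Tn: "\<forall>\<^sub>F n in sequentially.
  \<forall>f x. \<bar>apply_bmfun (Tn n f) x - apply_bmfun (Tn n f) (p m x)\<bar> \<le> L * \<eta> m * norm f"
  using degree_lower osc_\<nu>[of m]
proof eventually_elim
  case (elim n)
  show ?case
  proof (intro allI)
    fix f x
    show "\<bar>apply_bmfun (Tn n f) x - apply_bmfun (Tn n f) (p m x)\<bar> \<le> L * \<eta> m * norm f"
      unfolding L_def using elim
      by (intro K_oscillation[OF prob_\<nu> sets_\<nu> b_pos]) blast+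
  qed
qed

lemma norm_kernel_conv:
  assumes deg: "\<And>x. b \<le> degree_fun k (\<nu> n) x"
    and \<epsilon>: "\<And>x. \<bar>degree_fun k (\<nu> n) x - degree_fun k \<mu> x\<bar> \<le> \<epsilon>"
  shows "\<bar>norm_kernel k (\<nu> n) x y - norm_kernel k \<mu> x y\<bar> \<le> M / b\<^sup>2 * \<epsilon>"
proof -
  let ?d = "degree_fun k (\<nu> n)" and ?e = "degree_fun k \<mu>"
  have inv: "\<bar>1 / ?d x - 1 / ?e x\<bar> \<le> \<epsilon> / (b * b)" for x
  proof -
    have pos: "0 < ?d x" "0 < ?e x" using b_pos deg[of x] degree_ge_b[of x] by linarith+
    then have "\<bar>1 / ?d x - 1 / ?e x\<bar> = \<bar>?d x - ?e x\<bar> / (?d x * ?e x)"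
      by (simp add: divide_simps abs_mult abs_minus_commute)
    also have "\<dots> \<le> \<epsilon> / (b * b)"
      using \<epsilon>[of x] b_pos deg[of x] degree_ge_b[of x] by (intro frac_le mult_mono) auto
    finally show ?thesis .
  qed
  have "norm_kernel k (\<nu> n) x y - norm_kernel k \<mu> x y =
      1 / 2 * k x y * ((1 / ?d x - 1 / ?e x) + (1 / ?d y - 1 / ?e y))"
    unfolding norm_kernel_def by (simp add: algebra_simps)
  also have "\<bar>\<dots>\<bar> = 1 / 2 * k x y * \<bar>(1 / ?d x - 1 / ?e x) + (1 / ?d y - 1 / ?e y)\<bar>"
    using k_nonneg[of x y] by (simp add: abs_mult)
  also have "\<dots> \<le> 1 / 2 * M * (\<epsilon> / (b * b) + \<epsilon> / (b * b))"
    using k_nonneg[of x y] k_le[of x y] M_nonneg inv[of x] inv[of y] by (intro mult_mono) auto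
  also have "\<dots> = M / b\<^sup>2 * \<epsilon>" by (simp add: power2_eq_square)
  finally show ?thesis .
qed

text \<open>
  Pointwise convergence at the centres again becomes uniform convergence.  At a centre there are two
  errors: replacing the sampled degrees by the true ones, and replacing \<open>\<nu> n\<close> by \<open>\<mu>\<close> for a fixed
  integrand.
\<close>

theorem Tn_converges:
  assumes conv: "\<And>m c. c \<in> range (p m) \<Longrightarrow>
    (\<lambda>n. \<integral>z. norm_kernel k \<mu> c z * apply_bmfun f z \<partial>\<nu> n) \<longlonglongrightarrow>
    (\<integral>z. norm_kernel k \<mu> c z * apply_bmfun f z \<partial>\<mu>)"
  shows "(\<lambda>n. Tn n f) \<longlonglongrightarrow> T f"
proof (rule tendstoI)
  fix e :: real assume e: "0 < e"
  \<comment> \<open>The increments by 1 in this bound and in that for \<open>\<epsilon>\<close> avoid a division by 0 when \<open>f = 0\<close>.\<close>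
  obtain m where m: "\<eta> m < e / (8 * (L * norm f + 1))"
    using \<eta>_small[of "e / (8 * (L * norm f + 1))"] e L_nonneg by (auto simp: add_nonneg_pos)
  define \<epsilon> where "\<epsilon> = e / (4 * (M / b\<^sup>2 * norm f + 1))"
  have Mb: "0 \<le> M / b\<^sup>2 * norm f" using M_nonneg by simp
  have Lf: "0 \<le> L * norm f" using L_nonneg by simp
  have \<epsilon>: "0 < \<epsilon>" unfolding \<epsilon>_def using e Mb by (simp add: add_nonneg_pos)
  have m': "L * \<eta> m * norm f \<le> e / 8"
  proof -
    have "L * \<eta> m * norm f \<le> (L * norm f + 1) * \<eta> m" using \<eta>_nonneg[of m] by (simp add: algebra_simps)
    also have "\<dots> \<le> (L * norm f + 1) * (e / (8 * (L * norm f + 1)))"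
      using m Lf by (intro mult_left_mono) auto
    also have "\<dots> = e / 8" using Lf by (simp add: field_simps add_nonneg_eq_0_iff)
    finally show ?thesis .
  qed
  have \<epsilon>': "M / b\<^sup>2 * \<epsilon> * norm f \<le> e / 4"
  proof -
    have "M / b\<^sup>2 * \<epsilon> * norm f \<le> (M / b\<^sup>2 * norm f + 1) * \<epsilon>" using \<epsilon> by (simp add: algebra_simps)
    also have "\<dots> = e / 4"
    proof -
      have "x * (e / (4 * x)) = e / 4" if "0 < x" for x using that by simp
      moreover have "0 < M / b\<^sup>2 * norm f + 1" using Mb by linarith
      ultimately show ?thesis unfolding \<epsilon>_def by blast
    qed
    finally show ?thesis .
  qed
  have "\<forall>\<^sub>F n in sequentially. \<forall>c\<in>range (p m).
      dist (\<integral>z. norm_kernel k \<mu> c z * apply_bmfun f z \<partial>\<nu> n)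
        (\<integral>z. norm_kernel k \<mu> c z * apply_bmfun f z \<partial>\<mu>) < e / 4"
    using e by (intro eventually_ball_finite p_finite ballI tendstoD[OF conv]) auto
  with osc_Tn[of m] degree_uniform[OF \<epsilon>] degree_lower
  show "\<forall>\<^sub>F n in sequentially. dist (Tn n f) (T f) < e"
  proof eventually_elim
    case (elim n)
    have n: "1 \<le> n" and deg: "\<And>x. b \<le> degree_fun k (\<nu> n) x" using elim(3) by auto
    interpret nu: prob_space "\<nu> n" by (rule prob_\<nu>[OF n])
    note nu = prob_\<nu>[OF n] sets_\<nu>
    have "\<bar>apply_bmfun (Tn n f) x - apply_bmfun (T f) x\<bar> \<le> 3 / 4 * e" for x
    proof -
      define c where "c = p m x"
      let ?hn = "\<lambda>z. norm_kernel k (\<nu> n) c z * apply_bmfun f z"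
      let ?h = "\<lambda>z. norm_kernel k \<mu> c z * apply_bmfun f z"
      have int_hn: "integrable (\<nu> n) ?hn" by (rule kernel_integrable[OF nu b_pos deg])
      have int_h: "integrable (\<nu> n) ?h"
      proof (rule integrable_bounded[OF nu, where B = "M / b * norm f"])
        show "\<bar>?h z\<bar> \<le> M / b * norm f" for z
          unfolding abs_mult using M_nonneg b_pos
          by (intro mult_mono norm_kernel_bound[OF prob_\<mu> sets_\<mu> b_pos degree_ge_b]
              abs_apply_bmfun_le_norm) auto
      qed (intro borel_measurable_times norm_kernel_meas_right[OF prob_\<mu> sets_\<mu>] measurable_apply_bmfun)
      have "(\<integral>z. ?hn z \<partial>\<nu> n) - (\<integral>z. ?h z \<partial>\<nu> n) = (\<integral>z. ?hn z - ?h z \<partial>\<nu> n)"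
        using int_hn int_h by simp
      also have "\<bar>\<dots>\<bar> \<le> (\<integral>z. \<bar>?hn z - ?h z\<bar> \<partial>\<nu> n)" by (rule integral_abs_bound)
      also have "\<dots> \<le> (\<integral>z. M / b\<^sup>2 * \<epsilon> * norm f \<partial>\<nu> n)"
      proof (rule integral_mono)
        show "integrable (\<nu> n) (\<lambda>z. \<bar>?hn z - ?h z\<bar>)" using int_hn int_h by simp
        fix z
        have "\<bar>?hn z - ?h z\<bar> = \<bar>norm_kernel k (\<nu> n) c z - norm_kernel k \<mu> c z\<bar> * \<bar>apply_bmfun f z\<bar>"
          by (simp add: left_diff_distrib flip: abs_mult)
        also have "\<dots> \<le> M / b\<^sup>2 * \<epsilon> * norm f"
          using M_nonneg \<epsilon> elim(2)
          by (intro mult_mono norm_kernel_conv abs_apply_bmfun_le_norm deg) auto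
        finally show "\<bar>?hn z - ?h z\<bar> \<le> M / b\<^sup>2 * \<epsilon> * norm f" .
      qed simp
      also have "\<dots> \<le> e / 4" using \<epsilon>' by (simp add: nu.prob_space)
      finally have 1: "\<bar>(\<integral>z. ?hn z \<partial>\<nu> n) - (\<integral>z. ?h z \<partial>\<nu> n)\<bar> \<le> e / 4" .
      have 2: "\<bar>(\<integral>z. ?h z \<partial>\<nu> n) - (\<integral>z. ?h z \<partial>\<mu>)\<bar> < e / 4"
        using elim(4) by (simp add: c_def dist_real_def)
      have 3: "apply_bmfun (Tn n f) c = (\<integral>z. ?hn z \<partial>\<nu> n)" by (rule apply_K[OF nu b_pos deg])
      have 4: "apply_bmfun (T f) c = (\<integral>z. ?h z \<partial>\<mu>)"
        by (rule apply_K[OF prob_\<mu> sets_\<mu> b_pos degree_ge_b])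
      have 5: "\<bar>apply_bmfun (Tn n f) x - apply_bmfun (Tn n f) c\<bar> \<le> e / 8"
        using elim(1) m' unfolding c_def by (meson order_trans)
      have 6: "\<bar>apply_bmfun (T f) x - apply_bmfun (T f) c\<bar> \<le> e / 8"
        unfolding c_def using osc_T m' by (rule order_trans)
      show ?thesis using 1 2 5 6 unfolding 3 4 by linarith
    qed
    then have "norm (Tn n f - T f) \<le> 3 / 4 * e"
      by (intro norm_bmfun_le) (simp add: bmfun_rep_eqs)
    then show ?case using e by (simp add: dist_norm)
  qed
qed

definition cell :: "nat \<Rightarrow> 'a \<Rightarrow> 'a bmfun" where
  "cell m c = Bmfun (\<lambda>z. if p m z = c then 1 else 0)"

lemma apply_cell: "apply_bmfun (cell m c) = (\<lambda>z. if p m z = c then 1 else 0)"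
proof -
  have "{z \<in> space borel. p m z = c} = p m -` {c} \<inter> space borel" by auto
  also have "\<dots> \<in> sets borel" by (rule measurable_sets[OF p_meas]) simp
  finally have "(\<lambda>z. if p m z = c then 1 else 0 :: real) \<in> borel_measurable borel"
    by (intro measurable_If) auto
  moreover have "bounded (range (\<lambda>z. if p m z = c then 1 else 0 :: real))"
    by (rule boundedI[where B = 1]) auto
  ultimately show ?thesis unfolding cell_def by (rule apply_Bmfun)
qed

definition cell_error :: "nat \<Rightarrow> nat \<Rightarrow> real" where
  "cell_error m n = (\<Sum>c\<in>range (p m). norm ((T - Tn n) (cell m c)))"

lemma cell_error_lim: "(\<lambda>n. cell_error m n) \<longlonglongrightarrow> 0"
proof -
  have "(\<lambda>n. norm ((T - Tn n) (cell m c))) \<longlonglongrightarrow> 0" if "c \<in> range (p m)" for c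
  proof -
    have "(\<lambda>n. Tn n (cell m c)) \<longlonglongrightarrow> T (cell m c)"
      by (rule Tn_converges) (use cell_conv that in \<open>simp add: apply_cell\<close>)
    then have "(\<lambda>n. T (cell m c) - Tn n (cell m c)) \<longlonglongrightarrow> T (cell m c) - T (cell m c)"
      by (rule tendsto_diff[OF tendsto_const])
    then show ?thesis
      unfolding diff_self blinfun.diff_left[symmetric] by (rule tendsto_norm_zero)
  qed
  then show ?thesis unfolding cell_error_def by (rule tendsto_null_sum)
qed

text \<open>
  A function that nearly factors through \<open>p m\<close> is close to the combination \<open>s\<close> of cell indicators with its
  values at the centres as coefficients.
\<close>

lemma diff_le_cell_error:
  assumes n: "norm (Tn n) \<le> C" and D: "\<And>x. \<bar>apply_bmfun g x - apply_bmfun g (p m x)\<bar> \<le> D"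
  shows "norm ((T - Tn n) g) \<le> 2 * C * D + norm g * cell_error m n"
proof -
  define s where "s = (\<Sum>c\<in>range (p m). apply_bmfun g c *\<^sub>R cell m c)"
  have s: "apply_bmfun s x = apply_bmfun g (p m x)" for x
  proof -
    have "apply_bmfun s x = (\<Sum>c\<in>range (p m). if p m x = c then apply_bmfun g c else 0)"
      unfolding s_def apply_bmfun_sum by (rule sum.cong) (auto simp: bmfun_rep_eqs apply_cell)
    then show ?thesis using p_finite[of m] by simp
  qed
  have "norm (g - s) \<le> D"
    using D by (intro norm_bmfun_le) (simp add: bmfun_rep_eqs s)
  moreover have "norm (T - Tn n) \<le> 2 * C"
    using norm_triangle_ineq4[of T "Tn n"] norm_T n by linarith
  ultimately have 1: "norm ((T - Tn n) (g - s)) \<le> 2 * C * D"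
    using C_nonneg by (intro order_trans[OF norm_blinfun] mult_mono) auto
  have "norm ((T - Tn n) s) \<le> (\<Sum>c\<in>range (p m). norm ((T - Tn n) (apply_bmfun g c *\<^sub>R cell m c)))"
    unfolding s_def blinfun.sum_right by (rule norm_sum)
  also have "\<dots> \<le> (\<Sum>c\<in>range (p m). norm g * norm ((T - Tn n) (cell m c)))"
    unfolding blinfun.scaleR_right norm_scaleR
    by (intro sum_mono mult_right_mono abs_apply_bmfun_le_norm norm_ge_zero)
  also have "\<dots> = norm g * cell_error m n" unfolding cell_error_def by (rule sum_distrib_left[symmetric])
  finally have 2: "norm ((T - Tn n) s) \<le> norm g * cell_error m n" .
  have "(T - Tn n) g = (T - Tn n) (g - s) + (T - Tn n) s"
    by (simp flip: blinfun.add_right)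
  then show ?thesis
    using order_trans[OF norm_triangle_ineq add_mono[OF 1 2]] by simp
qed

text \<open>
  The images \<open>A n f\<close> of the unit ball nearly factor through \<open>p m\<close>, so the error of \<open>T - Tn n\<close> on them reduces to
  the error on finitely many cells: first choose the scale \<open>m\<close>, then \<open>n\<close>.
\<close>

lemma compose_lim:
  fixes A :: "nat \<Rightarrow> 'a bmfun \<Rightarrow>\<^sub>L 'a bmfun"
  assumes A: "\<forall>\<^sub>F n in sequentially. norm (A n) \<le> C"
    and osc: "\<And>m. \<forall>\<^sub>F n in sequentially.
      \<forall>f x. \<bar>apply_bmfun (A n f) x - apply_bmfun (A n f) (p m x)\<bar> \<le> L * \<eta> m * norm f"
  shows "(\<lambda>n. norm ((T - Tn n) o\<^sub>L A n)) \<longlonglongrightarrow> 0"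
proof (rule tendstoI)
  fix e :: real assume e: "0 < e"
  obtain m where m: "\<eta> m < e / (4 * (C * L + 1))"
    using \<eta>_small[of "e / (4 * (C * L + 1))"] e C_nonneg L_nonneg by (auto simp: add_nonneg_pos)
  have CL: "0 \<le> C * L" using C_nonneg L_nonneg by simp
  have m': "2 * C * (L * \<eta> m) \<le> e / 2"
  proof -
    have "2 * C * (L * \<eta> m) \<le> 2 * ((C * L + 1) * \<eta> m)" using \<eta>_nonneg[of m] by (simp add: algebra_simps)
    also have "\<dots> \<le> 2 * ((C * L + 1) * (e / (4 * (C * L + 1))))"
      using m CL by (intro mult_left_mono) auto
    also have "\<dots> = e / 2"
    proof -
      have "2 * (x * (e / (4 * x))) = e / 2" if "0 < x" for x using that by simp
      moreover have "0 < C * L + 1" using CL by linarith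
      ultimately show ?thesis by blast
    qed
    finally show ?thesis .
  qed
  have "(\<lambda>n. C * cell_error m n) \<longlonglongrightarrow> C * 0" by (intro tendsto_intros cell_error_lim)
  then have "\<forall>\<^sub>F n in sequentially. C * cell_error m n < e / 2"
    using e by (intro order_tendstoD(2)) auto
  with A osc[of m] norm_Tn
  show "\<forall>\<^sub>F n in sequentially. dist (norm ((T - Tn n) o\<^sub>L A n)) 0 < e"
  proof eventually_elim
    case (elim n)
    have err: "0 \<le> cell_error m n" unfolding cell_error_def by (intro sum_nonneg) auto
    have "norm ((T - Tn n) o\<^sub>L A n) \<le> 2 * C * (L * \<eta> m) + C * cell_error m n"
    proof (rule norm_blinfun_bound)
      show "0 \<le> 2 * C * (L * \<eta> m) + C * cell_error m n"
        using C_nonneg L_nonneg \<eta>_nonneg[of m] err by simp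
      fix f
      have "norm ((T - Tn n) (A n f)) \<le> 2 * C * (L * \<eta> m * norm f) + norm (A n f) * cell_error m n"
        using elim(2,3) by (intro diff_le_cell_error) auto
      also have "\<dots> \<le> 2 * C * (L * \<eta> m * norm f) + (C * norm f) * cell_error m n"
        using err order_trans[OF norm_blinfun mult_right_mono[OF elim(1) norm_ge_zero]]
        by (intro add_left_mono mult_right_mono) auto
      also have "\<dots> = (2 * C * (L * \<eta> m) + C * cell_error m n) * norm f" by (simp add: algebra_simps)
      finally show "norm (((T - Tn n) o\<^sub>L A n) f) \<le> (2 * C * (L * \<eta> m) + C * cell_error m n) * norm f"
        by simp
    qed
    then show ?case using m' elim(4) by (simp add: dist_real_def)
  qed
qed

sublocale operator_approximation T Tn C
proof
  show "(\<lambda>n. norm ((T - Tn n) o\<^sub>L Tn n)) \<longlonglongrightarrow> 0"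
    by (rule compose_lim[OF norm_Tn osc_Tn])
  show "(\<lambda>n. norm ((T - Tn n) o\<^sub>L T)) \<longlonglongrightarrow> 0"
    by (rule compose_lim) (auto intro: norm_T osc_T)
qed (rule fin_rank_K norm_Tn)+

text \<open>
  A diagonal subsequence converges at all of the countably many centres.  At a fixed scale finitely many
  centres control the sup norm up to the oscillation, so the subsequence is Cauchy.
\<close>

theorem compact_convergence: "converges_compactly Sn S"
  unfolding converges_compactly_def
proof (intro allI impI)
  fix f :: "nat \<Rightarrow> 'a bmfun" assume f: "\<forall>n. norm (f n) \<le> 1"
  define g where "g n = (S - Sn n) (f n)" for n
  have g: "g n = Tn n (f n) - T (f n)" for n
    by (simp add: g_def blinfun.diff_left)
  \<comment> \<open>The operators \<open>Tn n\<close> with small \<open>n\<close> are not controlled, so the subsequence is taken beyond \<open>N\<close>.\<close>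
  obtain N where N: "\<And>n. N \<le> n \<Longrightarrow> norm (Tn n) \<le> C"
    using norm_Tn unfolding eventually_sequentially by blast
  have C1: "norm (A (f n)) \<le> C" if "norm A \<le> C" for A :: "'a bmfun \<Rightarrow>\<^sub>L 'a bmfun" and n
  proof -
    have "norm (A (f n)) \<le> norm A * norm (f n)" by (rule norm_blinfun)
    also have "\<dots> \<le> C * 1" using that f C_nonneg by (intro mult_mono) auto
    finally show ?thesis by simp
  qed
  have g_bound: "norm (g n) \<le> 2 * C" if "N \<le> n" for n
    unfolding g using norm_triangle_ineq4[of "Tn n (f n)" "T (f n)"] C1[OF N[OF that], of n] C1[OF norm_T, of n]
    by linarith
  have g_osc: "\<forall>\<^sub>F n in sequentially. \<forall>x. \<bar>apply_bmfun (g n) x - apply_bmfun (g n) (p m x)\<bar> \<le> 2 * (L * \<eta> m)" for m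
    using osc_Tn[of m]
  proof eventually_elim
    case (elim n)
    have le: "L * \<eta> m * norm (f n) \<le> L * \<eta> m"
      using f L_nonneg \<eta>_nonneg[of m] by (intro mult_left_le) auto
    show ?case
    proof
      fix x
      have "\<bar>apply_bmfun (Tn n (f n)) x - apply_bmfun (Tn n (f n)) (p m x)\<bar> \<le> L * \<eta> m"
        using elim le by (meson order_trans)
      moreover have "\<bar>apply_bmfun (T (f n)) x - apply_bmfun (T (f n)) (p m x)\<bar> \<le> L * \<eta> m"
        using osc_T le by (rule order_trans)
      ultimately show "\<bar>apply_bmfun (g n) x - apply_bmfun (g n) (p m x)\<bar> \<le> 2 * (L * \<eta> m)"
        unfolding g minus_bmfun.rep_eq by linarith
    qed
  qed
  have "countable (\<Union>m. range (p m))" by (rule countable_UN) (auto intro: countable_finite p_finite)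
  moreover have "norm (apply_bmfun (g (n + N)) x) \<le> 2 * C" for n x
    using abs_apply_bmfun_le_norm[of "g (n + N)" x] g_bound[of "n + N"] by simp
  ultimately obtain r where r: "strict_mono (r :: nat \<Rightarrow> nat)"
    and lim: "\<And>x. x \<in> (\<Union>m. range (p m)) \<Longrightarrow> \<exists>l. (\<lambda>n. apply_bmfun (g (r n + N)) x) \<longlonglongrightarrow> l"
    using function_convergent_subsequence[of "\<Union>m. range (p m)" "\<lambda>n x. apply_bmfun (g (n + N)) x" "2 * C"]
    by metis
  define q where "q n = r n + N" for n
  have q: "strict_mono q" using r by (simp add: q_def strict_mono_def)
  define l where "l x = lim (\<lambda>n. apply_bmfun (g (q n)) x)" for x
  have l: "(\<lambda>n. apply_bmfun (g (q n)) c) \<longlonglongrightarrow> l c" if "c \<in> range (p m)" for c m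
    using lim[of c] that unfolding l_def q_def by (metis UN_iff UNIV_I limI)
  have "Cauchy (\<lambda>n. g (q n))"
  proof (rule CauchyI)
    fix e :: real assume e: "0 < e"
    obtain m where m: "\<eta> m < e / (8 * (L + 1))"
      using \<eta>_small[of "e / (8 * (L + 1))"] e L_nonneg by (auto simp: add_nonneg_pos)
    have m': "L * \<eta> m \<le> e / 8"
    proof -
      have "L * \<eta> m \<le> (L + 1) * \<eta> m" using \<eta>_nonneg[of m] by (simp add: algebra_simps)
      also have "\<dots> \<le> (L + 1) * (e / (8 * (L + 1)))" using m L_nonneg by (intro mult_left_mono) auto
      also have "\<dots> = e / 8" using L_nonneg by (simp add: field_simps add_nonneg_eq_0_iff)
      finally show ?thesis .
    qed
    have "\<forall>\<^sub>F n in sequentially. \<forall>c\<in>range (p m). dist (apply_bmfun (g (q n)) c) (l c) < e / 8"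
      using e by (intro eventually_ball_finite p_finite ballI tendstoD[OF l]) auto
    moreover have "\<forall>\<^sub>F n in sequentially.
        \<forall>x. \<bar>apply_bmfun (g (q n)) x - apply_bmfun (g (q n)) (p m x)\<bar> \<le> 2 * (L * \<eta> m)"
      by (rule eventually_subseq[OF q g_osc])
    ultimately obtain N' where N': "\<And>n c. N' \<le> n \<Longrightarrow> c \<in> range (p m) \<Longrightarrow> dist (apply_bmfun (g (q n)) c) (l c) < e / 8"
      "\<And>n x. N' \<le> n \<Longrightarrow> \<bar>apply_bmfun (g (q n)) x - apply_bmfun (g (q n)) (p m x)\<bar> \<le> 2 * (L * \<eta> m)"
      using eventually_conj unfolding eventually_sequentially by (metis (no_types, lifting) nle_le order_trans)
    show "\<exists>M. \<forall>i\<ge>M. \<forall>j\<ge>M. norm (g (q i) - g (q j)) < e"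
    proof (intro exI allI impI)
      fix i j assume ij: "N' \<le> i" "N' \<le> j"
      have "\<bar>apply_bmfun (g (q i)) x - apply_bmfun (g (q j)) x\<bar> \<le> 3 / 4 * e" for x
        using N'(1)[OF ij(1) rangeI[of "p m" x]] N'(1)[OF ij(2) rangeI[of "p m" x]]
          N'(2)[OF ij(1), of x] N'(2)[OF ij(2), of x] m'
        unfolding dist_real_def by linarith
      then have "norm (g (q i) - g (q j)) \<le> 3 / 4 * e"
        by (intro norm_bmfun_le) (simp add: bmfun_rep_eqs)
      then show "norm (g (q i) - g (q j)) < e" using e by linarith
    qed
  qed
  then obtain h where "(\<lambda>n. g (q n)) \<longlonglongrightarrow> h"
    using Cauchy_convergent convergent_def by blast
  then show "\<exists>r l. strict_mono r \<and> (\<lambda>j. (S - Sn (r j)) (f (r j))) \<longlonglongrightarrow> l"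
    using q unfolding g_def by blast
qed

end

section \<open>Kernel operators on independent samples\<close>

context bounded_kernel
begin

lemma kernel_osc_upper:
  assumes "x \<in> ball c \<delta>"
  shows "\<bar>k x z - k c z\<bar> \<le> kernel_osc k \<delta> c z"
proof -
  have "\<bar>k c z - k x z\<bar> \<le> (SUP y\<in>ball c \<delta>. \<bar>k c z - k y z\<bar>)"
    using assms k_diff_le by (intro cSUP_upper bdd_aboveI2[where M = M])
  then show ?thesis by (simp add: kernel_osc_def abs_minus_commute)
qed

lemma kernel_osc_le: "0 < \<delta> \<Longrightarrow> kernel_osc k \<delta> c z \<le> M"
  unfolding kernel_osc_def using k_diff_le by (intro cSUP_least) auto

lemma kernel_osc_nonneg: "0 < \<delta> \<Longrightarrow> 0 \<le> kernel_osc k \<delta> c z"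
  using kernel_osc_upper[of c c \<delta> z] by simp

end

locale sampled_kernel = bounded_kernel k M
  for k :: "'a::metric_space \<Rightarrow> 'a \<Rightarrow> real" and M :: real +
  fixes P :: "'w measure" and X :: "nat \<Rightarrow> 'w \<Rightarrow> 'a" and \<mu> :: "'a measure"
    and a :: real and \<omega> :: "ennreal \<Rightarrow> real"
  assumes prob_P: "prob_space P" and compact: "compact (UNIV :: 'a set)"
    and prob_\<mu>: "prob_space \<mu>" and sets_\<mu>: "sets \<mu> = sets borel"
    and indep: "prob_space.indep_vars P (\<lambda>_. borel) X {1..}"
    and law: "\<And>i. 1 \<le> i \<Longrightarrow> distr P borel (X i) = \<mu>"
    and a_pos: "0 < a" and degree_ge: "\<And>x. a \<le> degree_fun k \<mu> x"
    and \<omega>_lim: "(\<omega> \<longlongrightarrow> 0) (at_right 0)"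
    and osc: "\<And>x \<delta>. 0 < \<delta> \<Longrightarrow> integrable (completion \<mu>) (kernel_osc k \<delta> x) \<and>
      (\<integral>z. kernel_osc k \<delta> x z \<partial>completion \<mu>) \<le> \<omega> (ennreal \<delta>)"
begin

abbreviation emp :: "'w \<Rightarrow> nat \<Rightarrow> 'a measure" where
  "emp w \<equiv> empirical_measure (\<lambda>i. X i w)"

lemma empirical_integral_converges:
  fixes g :: "'a \<Rightarrow> real"
  assumes g: "g \<in> borel_measurable borel" and B: "\<And>x. \<bar>g x\<bar> \<le> B"
  shows "AE w in P. (\<lambda>n. \<integral>x. g x \<partial>emp w n) \<longlonglongrightarrow> (\<integral>x. g x \<partial>\<mu>)"
  unfolding integral_empirical_measure[OF g]
  by (rule strong_law_bounded[OF prob_P indep _ g B]) (rule law)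

lemma osc_\<mu>:
  assumes "0 < \<delta>" "x \<in> ball c \<delta>"
  shows "(\<integral>z. \<bar>k x z - k c z\<bar> \<partial>\<mu>) \<le> \<omega> (ennreal \<delta>)"
proof -
  have int: "integrable \<mu> (\<lambda>z. \<bar>k x z - k c z\<bar>)"
    by (rule k_diff_integrable[OF prob_\<mu> sets_\<mu>])
  then have meas: "(\<lambda>z. \<bar>k x z - k c z\<bar>) \<in> borel_measurable \<mu>" by simp
  have "(\<integral>z. \<bar>k x z - k c z\<bar> \<partial>\<mu>) = (\<integral>z. \<bar>k x z - k c z\<bar> \<partial>completion \<mu>)"
    by (rule integral_completion[OF meas, symmetric])
  also have "\<dots> \<le> (\<integral>z. kernel_osc k \<delta> c z \<partial>completion \<mu>)"
    using osc[OF assms(1)] int integrable_completion[OF meas] kernel_osc_upper[OF assms(2)]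
    by (intro integral_mono) auto
  also have "\<dots> \<le> \<omega> (ennreal \<delta>)" using osc[OF assms(1)] by blast
  finally show ?thesis .
qed

text \<open>
  The oscillation function is measurable for the completion of \<open>\<mu>\<close> only.  It is replaced by a Borel function that
  agrees with it \<open>\<mu>\<close>-almost everywhere, hence almost surely at all sample points, and to which the
  strong law applies.
\<close>

lemma osc_empirical:
  assumes \<delta>: "0 < \<delta>" and gt: "\<omega> (ennreal \<delta>) < \<eta>"
  shows "AE w in P. \<forall>\<^sub>F n in sequentially. \<forall>x\<in>ball c \<delta>. (\<integral>z. \<bar>k x z - k c z\<bar> \<partial>emp w n) \<le> \<eta>"
proof -
  interpret P: prob_space P by (rule prob_P)
  have osc_meas: "kernel_osc k \<delta> c \<in> borel_measurable (completion \<mu>)" using osc[OF \<delta>] by auto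
  then obtain g' where g': "g' \<in> borel_measurable \<mu>" "AE x in \<mu>. kernel_osc k \<delta> c x = g' x"
    using completion_ex_borel_measurable_real by blast
  \<comment> \<open>Clipping keeps the almost everywhere equality and makes the function bounded everywhere.\<close>
  define g where "g x = max 0 (min M (g' x))" for x
  have g_meas: "g \<in> borel_measurable \<mu>" unfolding g_def using g'(1) by measurable
  then have g_borel: "g \<in> borel_measurable borel" using meas_iff[OF prob_\<mu> sets_\<mu>] by blast
  have g_le: "\<bar>g x\<bar> \<le> M" for x using M_nonneg by (auto simp: g_def)
  have g_AE: "AE x in \<mu>. kernel_osc k \<delta> c x = g x"
  proof (rule AE_mp[OF g'(2)], intro AE_I2 impI)
    fix x assume "kernel_osc k \<delta> c x = g' x"
    then show "kernel_osc k \<delta> c x = g x"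
      using kernel_osc_le[OF \<delta>, of c x] kernel_osc_nonneg[OF \<delta>, of c x] by (simp add: g_def)
  qed
  have "(\<integral>x. g x \<partial>\<mu>) = (\<integral>x. g x \<partial>completion \<mu>)" by (rule integral_completion[OF g_meas, symmetric])
  also have "\<dots> = (\<integral>x. kernel_osc k \<delta> c x \<partial>completion \<mu>)"
  proof (rule integral_cong_AE)
    show "g \<in> borel_measurable (completion \<mu>)" by (rule measurable_completion[OF g_meas])
    show "AE x in completion \<mu>. g x = kernel_osc k \<delta> c x"
      by (rule AE_completion) (use g_AE in \<open>simp only: eq_commute\<close>)
  qed (rule osc_meas)
  also have "\<dots> < \<eta>" using osc[OF \<delta>, of c] gt by linarith
  finally have mean: "(\<integral>x. g x \<partial>\<mu>) < \<eta>" .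
  have "AE w in P. kernel_osc k \<delta> c (X i w) = g (X i w)" if "1 \<le> i" for i
  proof -
    have "X i \<in> P \<rightarrow>\<^sub>M borel" using indep that by (auto simp: P.indep_vars_def)
    then show ?thesis using g_AE unfolding law[OF that, symmetric] by (rule AE_distrD)
  qed
  then have "AE w in P. \<forall>i\<in>{1..}. kernel_osc k \<delta> c (X i w) = g (X i w)"
    by (subst AE_ball_countable) auto
  moreover have "AE w in P. (\<lambda>n. (\<Sum>i=1..n. g (X i w)) / real n) \<longlonglongrightarrow> (\<integral>x. g x \<partial>\<mu>)"
    by (rule strong_law_bounded[OF prob_P indep _ g_borel g_le]) (rule law)
  ultimately show ?thesis
  proof eventually_elim
    case (elim w)
    from order_tendstoD(2)[OF elim(2) mean] show ?case
    proof eventually_elim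
      case (elim n)
      show ?case
      proof
        fix x assume x: "x \<in> ball c \<delta>"
        have meas: "(\<lambda>z. \<bar>k x z - k c z\<bar>) \<in> borel_measurable borel"
          using k_meas_right[of x] k_meas_right[of c] by measurable
        have "(\<Sum>i=1..n. \<bar>k x (X i w) - k c (X i w)\<bar>) \<le> (\<Sum>i=1..n. g (X i w))"
        proof (rule sum_mono)
          fix i assume "i \<in> {1..n}"
          then have "kernel_osc k \<delta> c (X i w) = g (X i w)"
            using \<open>\<forall>i\<in>{1..}. kernel_osc k \<delta> c (X i w) = g (X i w)\<close> by simp
          then show "\<bar>k x (X i w) - k c (X i w)\<bar> \<le> g (X i w)"
            using kernel_osc_upper[OF x, of "X i w"] by simp
        qed
        then have "(\<integral>z. \<bar>k x z - k c z\<bar> \<partial>emp w n) \<le> (\<Sum>i=1..n. g (X i w)) / real n"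
          unfolding integral_empirical_measure[OF meas] by (rule divide_right_mono) simp
        then show "(\<integral>z. \<bar>k x z - k c z\<bar> \<partial>emp w n) \<le> \<eta>" using elim by linarith
      qed
    qed
  qed
qed

text \<open>
  The summand \<open>\<delta> m\<close> in \<open>\<eta> m\<close> is the slack that lets empirical means with limit at most \<open>\<omega> (\<delta> m)\<close> fall
  below \<open>\<eta> m\<close> eventually.
\<close>

definition \<delta> :: "nat \<Rightarrow> real" where "\<delta> m = inverse (real (Suc m))"
definition \<eta> :: "nat \<Rightarrow> real" where "\<eta> m = \<omega> (ennreal (\<delta> m)) + \<delta> m"
definition p :: "nat \<Rightarrow> 'a \<Rightarrow> 'a" where
  "p m = (SOME p. p \<in> borel \<rightarrow>\<^sub>M borel \<and> finite (range p) \<and> (\<forall>x. x \<in> ball (p x) (\<delta> m)))"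

lemma \<delta>_pos: "0 < \<delta> m" by (simp add: \<delta>_def)

lemma p: "p m \<in> borel \<rightarrow>\<^sub>M borel" "finite (range (p m))" "x \<in> ball (p m x) (\<delta> m)"
proof -
  have "\<exists>p :: 'a \<Rightarrow> 'a. p \<in> borel \<rightarrow>\<^sub>M borel \<and> finite (range p) \<and> (\<forall>x. x \<in> ball (p x) (\<delta> m))"
    by (rule finite_range_selector[OF compact \<delta>_pos[of m]]) blast
  from someI_ex[OF this] show "p m \<in> borel \<rightarrow>\<^sub>M borel" "finite (range (p m))" "x \<in> ball (p m x) (\<delta> m)"
    unfolding p_def[symmetric] by blast+
qed

lemma \<eta>_lim: "\<eta> \<longlonglongrightarrow> 0"
proof -
  have \<delta>: "\<delta> \<longlonglongrightarrow> 0" unfolding \<delta>_def by (rule LIMSEQ_inverse_real_of_nat)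
  have "filterlim (\<lambda>m. ennreal (\<delta> m)) (at_right 0) sequentially"
    unfolding filterlim_at using tendsto_ennrealI[OF \<delta>] \<delta>_pos
    by (auto simp: ennreal_eq_0_iff not_le)
  then have "(\<lambda>m. \<omega> (ennreal (\<delta> m))) \<longlonglongrightarrow> 0" by (rule filterlim_compose[OF \<omega>_lim])
  from tendsto_add[OF this \<delta>] show ?thesis by (simp add: \<eta>_def[abs_def])
qed

text \<open>
  Exceptional null sets may be collected over the centres of all scales, which are countably many.
\<close>

lemma AE_centres:
  assumes "\<And>m c. c \<in> range (p m) \<Longrightarrow> AE w in P. Q m c w"
  shows "AE w in P. \<forall>m. \<forall>c\<in>range (p m). Q m c w"
  unfolding AE_all_countable
proof
  fix m
  show "AE w in P. \<forall>c\<in>range (p m). Q m c w"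
    by (rule AE_ball_countable[OF countable_finite[OF p(2)], THEN iffD2]) (rule ballI, rule assms)
qed

lemma kernel_integral_converges:
  "AE w in P. \<forall>m. \<forall>c\<in>range (p m).
    (\<lambda>n. \<integral>z. norm_kernel k \<mu> c z * apply_bmfun f z \<partial>emp w n) \<longlonglongrightarrow>
    (\<integral>z. norm_kernel k \<mu> c z * apply_bmfun f z \<partial>\<mu>)"
proof (rule AE_centres, rule empirical_integral_converges)
  fix c z
  show "\<bar>norm_kernel k \<mu> c z * apply_bmfun f z\<bar> \<le> M / a * norm f"
    unfolding abs_mult using M_nonneg a_pos
    by (intro mult_mono norm_kernel_bound[OF prob_\<mu> sets_\<mu> a_pos degree_ge] abs_apply_bmfun_le_norm) auto
qed (intro borel_measurable_times norm_kernel_meas_right[OF prob_\<mu> sets_\<mu>] measurable_apply_bmfun)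

lemma cell_integral_converges:
  "AE w in P. \<forall>m. \<forall>c\<in>range (p m). \<forall>m'. \<forall>c'\<in>range (p m').
    (\<lambda>n. \<integral>z. norm_kernel k \<mu> c z * (if p m' z = c' then 1 else 0) \<partial>emp w n) \<longlonglongrightarrow>
    (\<integral>z. norm_kernel k \<mu> c z * (if p m' z = c' then 1 else 0) \<partial>\<mu>)"
proof (intro AE_centres empirical_integral_converges[where B = "M / a"])
  fix m' c' c z
  have "{z \<in> space borel. p m' z = c'} = p m' -` {c'} \<inter> space borel" by auto
  also have "\<dots> \<in> sets borel" by (rule measurable_sets[OF p(1)]) simp
  finally have "(\<lambda>z. if p m' z = c' then 1 else 0 :: real) \<in> borel_measurable borel"
    by (intro measurable_If) auto
  then show "(\<lambda>z. norm_kernel k \<mu> c z * (if p m' z = c' then 1 else 0)) \<in> borel_measurable borel"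
    by (intro borel_measurable_times norm_kernel_meas_right[OF prob_\<mu> sets_\<mu>])
  have "0 \<le> M / a" using M_nonneg a_pos by simp
  then show "\<bar>norm_kernel k \<mu> c z * (if p m' z = c' then 1 else 0)\<bar> \<le> M / a"
    using norm_kernel_bound[OF prob_\<mu> sets_\<mu> a_pos degree_ge, of c z] by simp
qed

theorem AE_kernel_approximation:
  "AE w in P. kernel_approximation k M \<mu> (emp w) p \<eta> a"
proof -
  have "AE w in P. \<forall>m. \<forall>c\<in>range (p m). (\<lambda>n. degree_fun k (emp w n) c) \<longlonglongrightarrow> degree_fun k \<mu> c"
    unfolding degree_fun_def
    by (intro AE_centres empirical_integral_converges[where B = M] k_meas_right)
      (use k_nonneg k_le in auto)
  moreover have "AE w in P. \<forall>m. \<forall>c\<in>range (p m). \<forall>\<^sub>F n in sequentially.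
      \<forall>x\<in>ball c (\<delta> m). (\<integral>z. \<bar>k x z - k c z\<bar> \<partial>emp w n) \<le> \<eta> m"
    by (intro AE_centres osc_empirical \<delta>_pos) (simp add: \<eta>_def \<delta>_pos)
  moreover note cell_integral_converges
  ultimately show ?thesis
  proof eventually_elim
    case (elim w)
    show ?case
    proof (intro kernel_approximation.intro kernel_approximation_axioms.intro)
      show "bounded_kernel k M" by (rule bounded_kernel_axioms)
      show "prob_space \<mu>" by (rule prob_\<mu>)
      show "sets \<mu> = sets borel" by (rule sets_\<mu>)
      show "prob_space (emp w n)" if "1 \<le> n" for n by (rule prob_space_empirical[OF that])
      show "sets (emp w n) = sets borel" for n by (rule sets_empirical)
      show "finite_rank (K (emp w n))"
        if "1 \<le> n" "0 < b" "\<And>x. b \<le> degree_fun k (emp w n) x" for n b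
        by (rule finite_rank_empirical[OF that])
      show "0 < a" by (rule a_pos)
      show "a \<le> degree_fun k \<mu> x" for x by (rule degree_ge)
      show "p m \<in> borel \<rightarrow>\<^sub>M borel" for m by (rule p(1))
      show "finite (range (p m))" for m by (rule p(2))
      show "\<eta> \<longlonglongrightarrow> 0" by (rule \<eta>_lim)
      show "(\<integral>z. \<bar>k x z - k (p m x) z\<bar> \<partial>\<mu>) \<le> \<eta> m" for m x
        using osc_\<mu>[OF \<delta>_pos p(3), of x m] \<delta>_pos[of m] unfolding \<eta>_def by linarith
      show "\<forall>\<^sub>F n in sequentially. \<forall>x. (\<integral>z. \<bar>k x z - k (p m x) z\<bar> \<partial>emp w n) \<le> \<eta> m" for m
      proof -
        have "\<forall>\<^sub>F n in sequentially. \<forall>c\<in>range (p m). \<forall>x\<in>ball c (\<delta> m).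
            (\<integral>z. \<bar>k x z - k c z\<bar> \<partial>emp w n) \<le> \<eta> m"
          by (rule eventually_ball_finite[OF p(2) elim(2)[THEN spec]])
        then show ?thesis
          by (rule eventually_mono) (use p(3) in blast)
      qed
      show "(\<lambda>n. degree_fun k (emp w n) c) \<longlonglongrightarrow> degree_fun k \<mu> c" if "c \<in> range (p m)" for m c
        using elim(1) that by blast
      show "(\<lambda>n. \<integral>z. norm_kernel k \<mu> c z * (if p m' z = c' then 1 else 0) \<partial>emp w n) \<longlonglongrightarrow>
          (\<integral>z. norm_kernel k \<mu> c z * (if p m' z = c' then 1 else 0) \<partial>\<mu>)"
        if "c \<in> range (p m)" "c' \<in> range (p m')" for m m' c c'
        by (rule elim(3)[THEN spec, THEN bspec, THEN spec, THEN bspec, OF that])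
    qed
  qed
qed

end

lemma (in kernel_approximation) isolated_eigenvalue:
  assumes "op_eigenvalue S lam" "lam \<noteq> 1" "open V" "V \<inter> op_spectrum S = {lam}"
    "frontier V \<inter> op_spectrum S = {}"
  shows "isolated_eigenvalue_approximation T Tn C lam V"
  by (intro isolated_eigenvalue_approximation.intro isolated_eigenvalue_approximation_axioms.intro
      operator_approximation_axioms assms)

lemma (in kernel_approximation) complexify_converges:
  assumes "(\<lambda>n. Tn n (fst v)) \<longlonglongrightarrow> T (fst v)" "(\<lambda>n. Tn n (snd v)) \<longlonglongrightarrow> T (snd v)"
  shows "(\<lambda>n. complexify (T - Tn n) v) \<longlonglongrightarrow> 0"
proof -
  have "(\<lambda>n. (T (fst v) - Tn n (fst v), T (snd v) - Tn n (snd v))) \<longlonglongrightarrow>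
      (T (fst v) - T (fst v), T (snd v) - T (snd v))"
    by (rule tendsto_Pair[OF tendsto_diff[OF tendsto_const assms(1)] tendsto_diff[OF tendsto_const assms(2)]])
  then show ?thesis
    unfolding blinfun_apply_complexify blinfun.diff_left diff_self zero_prod_def .
qed

theorem theorem1:
  fixes P :: "'w measure"
    and \<mu> :: "'a::metric_space measure"
    and k :: "'a \<Rightarrow> 'a \<Rightarrow> real"
    and X :: "nat \<Rightarrow> 'w \<Rightarrow> 'a"
    and a M :: real
    and \<omega> :: "ennreal \<Rightarrow> real"
    and lam :: complex
    and V :: "complex set"
  assumes "prob_space P"
    and "compact (UNIV :: 'a set)"
    and "prob_space \<mu>" and "sets \<mu> = sets borel"
    and k_meas: "(\<lambda>(x, y). k x y) \<in> borel_measurable (borel \<Otimes>\<^sub>M borel)"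
    and k_nonneg: "\<And>x y. 0 \<le> k x y"
    and k_sym: "\<And>x y. k x y = k y x"
    and X_indep: "prob_space.indep_vars P (\<lambda>_. borel) X {1..}"
    and X_law: "\<And>i. 1 \<le> i \<Longrightarrow> distr P borel (X i) = \<mu>"
    and "0 < a" and "a \<le> 1" and "1 \<le> M"
    and "continuous_on UNIV \<omega>" and "mono \<omega>" and "(\<omega> \<longlongrightarrow> 0) (at_right 0)"
    and k_bdd: "bdd_above (range (\<lambda>(x, y). k x y))" and k_sup: "(SUP (x, y). k x y) < M"
    and deg_inf: "a < (INF x. degree_fun k \<mu> x)"
    and k_osc: "\<And>x \<delta>. 0 < \<delta> \<Longrightarrow>
        integrable (completion \<mu>) (kernel_osc k \<delta> x) \<and>
        (\<integral>z. kernel_osc k \<delta> x z \<partial>completion \<mu>) \<le> \<omega> (ennreal \<delta>)"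
    and lam_ev: "op_eigenvalue (U_op k \<mu>) lam" and lam_ne: "lam \<noteq> 1"
    and V_open: "open V" and V_isol: "V \<inter> op_spectrum (U_op k \<mu>) = {lam}"
    and V_frontier: "frontier V \<inter> op_spectrum (U_op k \<mu>) = {}"
  shows
    "(AE w in P. converges_compactly
        (\<lambda>n. U_op k (empirical_measure (\<lambda>i. X i w) n)) (U_op k \<mu>))
     \<and> (AE w in P. \<forall>\<epsilon>>0. \<forall>\<^sub>F n in sequentially.
          (let E = {z \<in> op_spectrum (U_op k (empirical_measure (\<lambda>i. X i w) n)) \<inter> V.
                     op_eigenvalue (U_op k (empirical_measure (\<lambda>i. X i w) n)) z}
           in E \<noteq> {} \<and> (\<forall>z\<in>E. dist z lam < \<epsilon>)))
     \<and> (\<forall>v. AE w in P.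
          (\<lambda>n. blinfun_apply
                 (spectral_projection (U_op k (empirical_measure (\<lambda>i. X i w) n)) V) v)
            \<longlonglongrightarrow> blinfun_apply (spectral_projection (U_op k \<mu>) V) v)"
proof -
  have k_le: "k x y \<le> M" for x y
    using cSUP_upper[OF UNIV_I k_bdd, of "(x, y)"] k_sup by simp
  interpret bounded_kernel k M
    by (intro bounded_kernel.intro k_meas k_nonneg k_le)
  have degree_nonneg: "0 \<le> degree_fun k \<mu> x" for x
    unfolding degree_fun_def by (intro Bochner_Integration.integral_nonneg k_nonneg)
  have degree_ge: "a \<le> degree_fun k \<mu> x" for x
  proof -
    have "bdd_below (range (degree_fun k \<mu>))"
      using degree_nonneg by (intro bdd_belowI[where m = 0]) blast
    then have "(INF x. degree_fun k \<mu> x) \<le> degree_fun k \<mu> x" by (intro cINF_lower) auto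
    with deg_inf show ?thesis by linarith
  qed
  interpret sampled_kernel k M P X \<mu> a \<omega>
    by (intro sampled_kernel.intro sampled_kernel_axioms.intro bounded_kernel_axioms assms degree_ge)
  note lam = lam_ev[unfolded U_op_def] lam_ne V_open V_isol[unfolded U_op_def]
    V_frontier[unfolded U_op_def]
  note iso = kernel_approximation.isolated_eigenvalue[OF _ lam]
  have 1: "AE w in P. converges_compactly (\<lambda>n. U_op k (emp w n)) (U_op k \<mu>)"
    using AE_kernel_approximation
  proof eventually_elim
    case (elim w)
    show ?case unfolding U_op_def by (rule kernel_approximation.compact_convergence[OF elim])
  qed
  have 2: "AE w in P. \<forall>\<epsilon>>0. \<forall>\<^sub>F n in sequentially.
      (let E = {z \<in> op_spectrum (U_op k (emp w n)) \<inter> V. op_eigenvalue (U_op k (emp w n)) z}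
       in E \<noteq> {} \<and> (\<forall>z\<in>E. dist z lam < \<epsilon>))"
    using AE_kernel_approximation
  proof eventually_elim
    case (elim w)
    show ?case unfolding U_op_def
      by (intro allI impI isolated_eigenvalue_approximation.eigenvalues_converge[OF iso[OF elim]])
  qed
  have 3: "AE w in P. (\<lambda>n. spectral_projection (U_op k (emp w n)) V v) \<longlonglongrightarrow>
      spectral_projection (U_op k \<mu>) V v" for v
    using AE_kernel_approximation kernel_integral_converges[of "fst v"] kernel_integral_converges[of "snd v"]
  proof eventually_elim
    case (elim w)
    interpret approx: kernel_approximation k M \<mu> "emp w" p \<eta> a by (rule elim(1))
    have "(\<lambda>n. K (emp w n) (fst v)) \<longlonglongrightarrow> K \<mu> (fst v)"
      by (rule approx.Tn_converges) (rule elim(2)[THEN spec, THEN bspec])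
    moreover have "(\<lambda>n. K (emp w n) (snd v)) \<longlonglongrightarrow> K \<mu> (snd v)"
      by (rule approx.Tn_converges) (rule elim(3)[THEN spec, THEN bspec])
    ultimately have "(\<lambda>n. complexify (K \<mu> - K (emp w n)) v) \<longlonglongrightarrow> 0"
      by (rule approx.complexify_converges)
    then show ?case unfolding U_op_def
      by (rule isolated_eigenvalue_approximation.spectral_projections_converge[OF iso[OF elim(1)]])
  qed
  show ?thesis using 1 2 3 by blast
qed

end
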